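(* Let $n\ge1$. Suppose that for every $K\subseteq\{0\}\cup[n-1]$ the identity $$F^B_K(XY)=\sum_{I,J\subseteq\{0\}\cup[n-1]}c^K_{I,J}\,F^B_I(X)F^B_J(Y)$$ holds, where $c^K_{I,J}$ are the structure constants of Solomon's descent algebra of type B and $F^B_I$ are Chow's fundamental quasisymmetric functions of type B. Then, as a consequence, for all $I,J\subseteq\{0\}\cup[n-1]$, $$c^{\emptyset}_{I,J}=\sum_{\lambda\in\mathcal{P}^0(n)}d^B_{\lambda I}\,d^B_{\lambda J},$$ where $\mathcal{P}^0(n)$ is the set of partitions of $2n$ whose Young diagram can be tiled by dominoes and $d^B_{\lambda I}$ is the number of standard domino tableaux of shape $\lambda$ and descent set $I$.
   Context: $[m]=\{1,\dots,m\}$. The hyperoctahedral group $B_n$ is the group of permutations $\pi$ of $\{-n,\dots,-1,0,1,\dots,n\}$ with $\pi(-i)=-\pi(i)$ for all $i$ (so $\pi(0)=0$). The descent set of $\pi\in B_n$ is $\mathrm{set}(\pi)=\{0\le i\le n-1\mid\pi(i)>\pi(i+1)\}$. For $I\subseteq\{0\}\cup[n-1]$, $D^B_I\in\mathbb{C}B_n$ is the formal sum of all $\pi\in B_n$ with $\mathrm{set}(\pi)=I$. By Solomon's theorem the $D^B_I$ span a subalgebra of $\mathbb{C}B_n$, and $c^K_{I,J}$ (also written $c^K_{IJ}$) is the coefficient of $D^B_K$ in $D^B_ID^B_J$. Products of permutations are read from left to right: $(\sigma\tau)(i)=\tau(\sigma(i))$. Let $X=\{\dots,x_{-2},x_{-1},x_0,x_1,x_2,\dots\}$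 be commuting indeterminates indexed by $\mathbb{Z}$, ordered by their index, with the convention $x_{-i}=x_i$. For $I\subseteq\{0\}\cup[n-1]$, with $i_0=0$, $$F^B_I(X)=\sum_{\substack{0\le i_1\le i_2\le\cdots\le i_n\\ j\in I\Rightarrow i_{j+1}>i_j}}x_{i_1}x_{i_2}\cdots x_{i_n}.$$ If $Y=\{y_j\}_{j\in\mathbb{Z}}$ is a second copy of $X$ commuting with $X$, then $XY$ is the set of $(x_i,y_j)$, $(i,j)\in\mathbb{Z}^2$, identified with the products $x_iy_j$ and ordered lexicographically in $(i,j)$; $F^B_I(XY)$ is defined by the same formula, summing over sequences of indices $(0,0)\le(i_1,j_1)\le\cdots\le(i_n,j_n)$ in $\mathbb{Z}^2$ (with zeroth index $(0,0)$), strict after position $j$ whenever $j\in I$. For $\lambda\vdash 2n$, a standard domino tableau of shape $\lambda$ is a tiling of the Young diagram of $\lambda$ (English convention) by $n$ horizontal or vertical dominoes (pairs of adjacent boxes), labelled with $1,\dots,n$, each label used exactly once, such that the labels are non-decreasing along rows and down columns (equality occurring only within a single domino). It has a descent in position $i$, $1\le i\le n-1$, if the domino $i+1$ lies strictly below the domino $i$ (in strictly lower rows), and a descent in position $0$ if the domino labelled $1$ is vertical. Its descent set is the set of all its descents. *)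

theory Defs
  imports
    Complex_Main
    "HOL-Combinatorics.Permutations"
    "HOL-Library.Multiset"
    "HOL-Library.Disjoint_Sets"
    "HOL-Library.Product_Lexorder"
    "HOL-Library.Function_Algebras"
begin

section \<open>Complex-valued functions as formal sums\<close>

definition fscale :: "complex \<Rightarrow> ('a \<Rightarrow> complex) \<Rightarrow> 'a \<Rightarrow> complex"  (infixr "\<odot>" 75)
  where "a \<odot> f = (\<lambda>x. a * f x)"

global_interpretation cfun: vector_space "fscale :: complex \<Rightarrow> ('a \<Rightarrow> complex) \<Rightarrow> 'a \<Rightarrow> complex"
  defines cfun_representation = cfun.representation
  by unfold_locales (auto simp: fscale_def fun_eq_iff algebra_simps)


section \<open>The hyperoctahedral group and Solomon's descent algebra of type B\<close>

definition hyperoctahedral :: "nat \<Rightarrow> (int \<Rightarrow> int) set"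
  where "hyperoctahedral n = {\<pi>. \<pi> permutes {- int n..int n} \<and> (\<forall>i. \<pi> (- i) = - \<pi> i)}"

definition descent_set :: "nat \<Rightarrow> (int \<Rightarrow> int) \<Rightarrow> nat set"
  where "descent_set n \<pi> = {i. i < n \<and> \<pi> (int i) > \<pi> (int i + 1)}"

text \<open>
  An element of the group algebra is the function sending a group element to its coefficient.
  The left-to-right product of \<open>\<sigma>\<close> and \<open>\<tau>\<close> is \<open>\<tau> \<circ> \<sigma>\<close>.
\<close>

definition group_algebra_mult ::
    "nat \<Rightarrow> ((int \<Rightarrow> int) \<Rightarrow> complex) \<Rightarrow> ((int \<Rightarrow> int) \<Rightarrow> complex) \<Rightarrow> (int \<Rightarrow> int) \<Rightarrow> complex"
  where "group_algebra_mult n f g =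
    (\<lambda>\<rho>. \<Sum>(\<sigma>, \<tau>) \<in> {(\<sigma>, \<tau>) \<in> hyperoctahedral n \<times> hyperoctahedral n. \<tau> \<circ> \<sigma> = \<rho>}. f \<sigma> * g \<tau>)"

definition descent_class_sum :: "nat \<Rightarrow> nat set \<Rightarrow> (int \<Rightarrow> int) \<Rightarrow> complex"
  where "descent_class_sum n I =
    (\<lambda>\<pi>. if \<pi> \<in> hyperoctahedral n \<and> descent_set n \<pi> = I then 1 else 0)"

text \<open>
  The coefficient of a basis element in the expansion of the product over the descent class
  sums. By Solomon's theorem the product lies in their span, so that the default value 0 of
  \<open>representation\<close> outside the span is not used.
\<close>

definition descent_structure_const :: "nat \<Rightarrow> nat set \<Rightarrow> nat set \<Rightarrow> nat set \<Rightarrow> complex"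
  where "descent_structure_const n K I J =
    cfun_representation (descent_class_sum n ` Pow {..<n})
      (group_algebra_mult n (descent_class_sum n I) (descent_class_sum n J))
      (descent_class_sum n K)"


section \<open>Chow's fundamental quasisymmetric functions of type B\<close>

text \<open>
  A monomial is a multiset of indeterminates, and a formal power series is the function sending
  a monomial to its coefficient. Since \<open>x\<^sub>-\<^sub>i = x\<^sub>i\<close> and \<open>y\<^sub>-\<^sub>j = y\<^sub>j\<close>, the indeterminates are
  indexed by natural numbers.
\<close>

datatype indet = xvar nat | yvar nat

type_synonym power_series = "indet multiset \<Rightarrow> complex"

definition ps_mult :: "power_series \<Rightarrow> power_series \<Rightarrow> power_series"  (infixl "\<otimes>" 70)
  where "f \<otimes> g = (\<lambda>M. \<Sum>(A, B) \<in> {(A, B). A + B = M}. f A * g B)"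

text \<open>
  Index sequences are lists with the zeroth index \<open>z\<close> included. In the alphabets below only
  finitely many index sequences contribute to a given monomial.
\<close>

definition index_seqs :: "nat \<Rightarrow> 'a::linorder \<Rightarrow> nat set \<Rightarrow> 'a list set"
  where "index_seqs n z I =
    {s. length s = Suc n \<and> s ! 0 = z \<and> sorted s \<and> (\<forall>j\<in>I. s ! j < s ! Suc j)}"

definition fundamental_B ::
    "nat \<Rightarrow> 'a::linorder \<Rightarrow> ('a \<Rightarrow> indet multiset) \<Rightarrow> nat set \<Rightarrow> power_series"
  where "fundamental_B n z mon I =
    (\<lambda>M. of_nat (card {s \<in> index_seqs n z I. (\<Sum>i\<leftarrow>tl s. mon i) = M}))"

definition monX :: "int \<Rightarrow> indet multiset"
  where "monX i = {#xvar (nat \<bar>i\<bar>)#}"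

definition monY :: "int \<Rightarrow> indet multiset"
  where "monY j = {#yvar (nat \<bar>j\<bar>)#}"

definition FX :: "nat \<Rightarrow> nat set \<Rightarrow> power_series"
  where "FX n I = fundamental_B n (0::int) monX I"

definition FY :: "nat \<Rightarrow> nat set \<Rightarrow> power_series"
  where "FY n I = fundamental_B n (0::int) monY I"

text \<open>The order on pairs is the lexicographic one of \<^theory>\<open>HOL-Library.Product_Lexorder\<close>.\<close>

definition FXY :: "nat \<Rightarrow> nat set \<Rightarrow> power_series"
  where "FXY n I = fundamental_B n (0::int, 0::int) (\<lambda>(i, j). monX i + monY j) I"


section \<open>Standard domino tableaux\<close>

definition partitions_of :: "nat \<Rightarrow> nat list set"
  where "partitions_of m = {\<mu>. sorted_wrt (\<ge>) \<mu> \<and> 0 \<notin> set \<mu> \<and> sum_list \<mu> = m}"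

text \<open>Boxes are pairs of a row and a column, both counted from 0; rows are counted downwards.\<close>

type_synonym box = "nat \<times> nat"

definition diagram :: "nat list \<Rightarrow> box set"
  where "diagram \<mu> = {(r, c). r < length \<mu> \<and> c < \<mu> ! r}"

definition horizontal_domino :: "box set \<Rightarrow> bool"
  where "horizontal_domino d \<longleftrightarrow> (\<exists>r c. d = {(r, c), (r, Suc c)})"

definition vertical_domino :: "box set \<Rightarrow> bool"
  where "vertical_domino d \<longleftrightarrow> (\<exists>r c. d = {(r, c), (Suc r, c)})"

definition domino_tiling :: "nat list \<Rightarrow> box set set \<Rightarrow> bool"
  where "domino_tiling \<mu> P \<longleftrightarrow>
    partition_on (diagram \<mu>) P \<and> (\<forall>d\<in>P. horizontal_domino d \<or> vertical_domino d)"

definition domino_partitions :: "nat \<Rightarrow> nat list set"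
  where "domino_partitions n = {\<mu> \<in> partitions_of (2 * n). \<exists>P. domino_tiling \<mu> P}"

text \<open>
  A tableau is the function sending a label to its domino; extensionality makes it unique as a
  function. Distinct labels belong to distinct dominoes, so equality of labels along a row or
  column can occur only within a domino.
\<close>

definition standard_domino_tableaux :: "nat \<Rightarrow> nat list \<Rightarrow> (nat \<Rightarrow> box set) set"
  where "standard_domino_tableaux n \<mu> =
    {T \<in> extensional {1..n}.
       inj_on T {1..n} \<and> domino_tiling \<mu> (T ` {1..n}) \<and>
       (\<forall>a\<in>{1..n}. \<forall>b\<in>{1..n}. \<forall>r c c'. (r, c) \<in> T a \<and> (r, c') \<in> T b \<and> c \<le> c' \<longrightarrow> a \<le> b) \<and>
       (\<forall>a\<in>{1..n}. \<forall>b\<in>{1..n}. \<forall>r r' c. (r, c) \<in> T a \<and> (r', c) \<in> T b \<and> r \<le> r' \<longrightarrow> a \<le> b)}"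

definition tableau_descent_set :: "nat \<Rightarrow> (nat \<Rightarrow> box set) \<Rightarrow> nat set"
  where "tableau_descent_set n T =
    {i \<in> {1..n - 1}. \<forall>p \<in> T i. \<forall>q \<in> T (Suc i). fst p < fst q} \<union>
    {i. i = 0 \<and> vertical_domino (T 1)}"

definition domino_descent_count :: "nat \<Rightarrow> nat list \<Rightarrow> nat set \<Rightarrow> nat"
  where "domino_descent_count n \<mu> I =
    card {T \<in> standard_domino_tableaux n \<mu>. tableau_descent_set n T = I}"

end

theory Submission
  imports Defs
begin

text \<open>
  Evaluate both sides of the hypothesis for \<open>K = {}\<close> at the monomials \<open>x\<^sub>A y\<^sub>B\<close> with \<open>A, B \<subseteq> {0..n-1}\<close>,
  where \<open>x\<^sub>A\<close> is the product of \<open>n\<close> indeterminates \<open>x\<^sub>i\<close> whose weakly increasing indices, with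
  a zeroth index 0 in front, go up by one exactly at the positions in \<open>A\<close>. The function \<open>F\<^sub>I\<close> has coefficient 1 at
  \<open>x\<^sub>A\<close> if \<open>I \<subseteq> A\<close> and 0 otherwise, so the right hand side has the coefficient
  \<open>\<Sum>I\<subseteq>A. \<Sum>J\<subseteq>B. c I J\<close>, and these sums determine all the \<open>c I J\<close> by Moebius inversion on
  the Boolean lattice. What has to be shown is therefore that the coefficient on the left hand side,
  which counts certain multisets of pairs of integers, is the number of pairs of standard domino
  tableaux of the same shape whose descent sets are contained in \<open>A\<close> and in \<open>B\<close>. This is a
  Robinson--Schensted--Knuth correspondence for dominoes, obtained in two steps.

  From tableaux to bipartitions: a partition \<open>\<rho>\<close> is encoded by the beads \<open>\<rho> r - r - 1\<close> on the
  integers. Adding a domino moves one bead from \<open>p\<close> to the free place \<open>p + 2\<close>, and domino \<open>i + 1\<close> lies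
  strictly below domino \<open>i\<close> exactly when its bead position is smaller (\<open>domino_below_iff\<close>). With
  \<open>p\<^sub>0 = - 1\<close> this includes the descent at 0. Standard domino tableaux thus become sequences
  of bead moves, and descents become descents of the sequence of positions
  (\<open>bij_betw_domino_code\<close>, \<open>tableau_descent_set_eq\<close>). A move changes beads of one parity only, and
  the beads of each parity form again a partition: this is the 2-quotient, a pair of partitions.
  A sequence of moves in increasing order is possible between two pairs in at most one way,
  and it exists exactly if the pairs interlace componentwise (\<open>sorted_path_iff\<close>). Hence a
  tableau with descents inside \<open>A\<close> is a chain of interlacing pairs, with step sizes given by
  \<open>A\<close> (\<open>strip_chains_eq_card\<close>).

  Counting pairs of chains: for given \<open>L\<close> and \<open>M\<close>, the partitions that interlace with both from above
  correspond to the partitions that interlace with both from below together with a natural number, by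
  reflecting each row inside the interval in which it may vary (\<open>local_rule\<close>). For pairs of partitions
  there are two such numbers, one per component; they record how often the pairs \<open>(i, j)\<close> and
  \<open>(i, -j)\<close> occur in a multiset. Commuting the steps of one chain past those of the other
  gives that the number of pairs of chains with a common end is the number of
  multisets of pairs of integers with given absolute marginals (\<open>sum_strip_chains_product\<close>), which is
  the coefficient of the left hand side (\<open>FXY_coeff\<close>).
\<close>

section \<open>Partitions and interlacing\<close>

definition is_partition :: "(nat \<Rightarrow> nat) \<Rightarrow> bool"
  where "is_partition f \<longleftrightarrow> antimono f \<and> (\<exists>L. \<forall>i\<ge>L. f i = 0)"

definition psize :: "(nat \<Rightarrow> nat) \<Rightarrow> nat"
  where "psize f = (\<Sum>i | f i \<noteq> 0. f i)"

lemma psize_eq: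
  assumes "\<And>i. i \<ge> L \<Longrightarrow> f i = 0"
  shows "psize f = (\<Sum>i<L. f i)"
  unfolding psize_def
  by (rule sum.mono_neutral_left) (use assms in \<open>auto intro: ccontr simp: not_less\<close>)

lemma is_partitionD: "is_partition f \<Longrightarrow> i \<le> j \<Longrightarrow> f j \<le> f i"
  by (auto simp: is_partition_def antimono_def)

lemma is_partitionI:
  assumes "\<And>i. f (Suc i) \<le> f i" "\<And>i. i \<ge> L \<Longrightarrow> f i = 0"
  shows "is_partition f"
  unfolding is_partition_def antimono_iff_le_Suc using assms by blast

lemma is_partition_bound:
  assumes "is_partition f"
  obtains L where "\<And>i. i \<ge> L \<Longrightarrow> f i = 0"
  using assms by (auto simp: is_partition_def)

lemma is_partition_zeros: "is_partition f \<Longrightarrow> \<exists>L. \<forall>i\<ge>L. f i = 0"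
  by (simp add: is_partition_def)

lemma is_partition_le_psize:
  assumes "is_partition f"
  shows "f i \<le> psize f"
proof -
  obtain L where L: "\<And>i. i \<ge> L \<Longrightarrow> f i = 0"
    using is_partition_bound[OF assms] by blast
  show ?thesis
  proof (cases "i < L")
    case True
    then show ?thesis using member_le_sum[of i "{..<L}" f] psize_eq[OF L] by auto
  qed (use L in auto)
qed

lemma is_partition_zero_beyond_psize:
  assumes "is_partition f" "i \<ge> psize f"
  shows "f i = 0"
proof (rule ccontr)
  assume i: "f i \<noteq> 0"
  obtain L where L: "\<And>i. i \<ge> L \<Longrightarrow> f i = 0"
    using is_partition_bound[OF assms(1)] by blast
  have "i < L" using L i by (meson not_le)
  have "Suc i = (\<Sum>j\<le>i. 1)" by simp
  also have "\<dots> \<le> (\<Sum>j\<le>i. f j)"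
    by (rule sum_mono) (use is_partitionD[OF assms(1), of _ i] i in \<open>fastforce simp: Suc_le_eq\<close>)
  also have "\<dots> \<le> (\<Sum>j<L. f j)"
    by (rule sum_mono2) (use \<open>i < L\<close> in auto)
  finally show False using assms(2) psize_eq[OF L] by auto
qed

lemma psize_fun_upd:
  assumes "\<exists>L. \<forall>i\<ge>L. f i = 0"
  shows "psize (f(i := f i + k)) = psize f + k"
proof -
  obtain L0 where L0: "\<And>i. i \<ge> L0 \<Longrightarrow> f i = 0"
    using assms by blast
  define L where "L = max L0 (Suc i)"
  have L: "\<And>j. j \<ge> L \<Longrightarrow> f j = 0" "i < L" using L0 by (auto simp: L_def)
  have "psize (f(i := f i + k)) = (\<Sum>j<L. (f(i := f i + k)) j)"
    by (rule psize_eq) (use L in auto)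
  also have "\<dots> = (\<Sum>j<L. f j + (if j = i then k else 0))"
    by (rule sum.cong) auto
  also have "\<dots> = psize f + k"
    using L by (simp add: sum.distrib psize_eq[of L f])
  finally show ?thesis .
qed

text \<open>
  A pair of partitions is a function on \<open>bool\<close>; its components will describe the beads of the two
  parities of a bead configuration.
\<close>

definition bipartition :: "(bool \<Rightarrow> nat \<Rightarrow> nat) \<Rightarrow> bool"
  where "bipartition S \<longleftrightarrow> (\<forall>e. is_partition (S e))"

definition bsize :: "(bool \<Rightarrow> nat \<Rightarrow> nat) \<Rightarrow> nat"
  where "bsize S = psize (S False) + psize (S True)"

text \<open>
  Both components of \<open>S'\<close> arise from those of \<open>S\<close> by adding a horizontal strip.
\<close>

definition strip :: "(bool \<Rightarrow> nat \<Rightarrow> nat) \<Rightarrow> (bool \<Rightarrow> nat \<Rightarrow> nat) \<Rightarrow> bool"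
  where "strip S S' \<longleftrightarrow> (\<forall>e i. S e i \<le> S' e i \<and> S' e (Suc i) \<le> S e i)"

definition bipartitions_of :: "nat \<Rightarrow> (bool \<Rightarrow> nat \<Rightarrow> nat) set"
  where "bipartitions_of n = {S. bipartition S \<and> bsize S = n}"

lemma finite_bipartitions_of: "finite (bipartitions_of n)"
proof -
  define F where "F = {f :: nat \<Rightarrow> nat. \<forall>i. (i \<in> {..<n} \<longrightarrow> f i \<in> {..n}) \<and> (i \<notin> {..<n} \<longrightarrow> f i = 0)}"
  have F: "finite F" unfolding F_def
    by (rule finite_set_of_finite_funs) auto
  have "bipartitions_of n \<subseteq> {S. \<forall>e. (e \<in> UNIV \<longrightarrow> S e \<in> F) \<and>
    (e \<notin> UNIV \<longrightarrow> S e = (\<lambda>_. 0))}"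
  proof (intro subsetI CollectI allI conjI impI)
    fix S e assume S: "S \<in> bipartitions_of n"
    have p: "is_partition (S e)" and le: "psize (S e) \<le> n"
      using S by (cases e; auto simp: bipartitions_of_def bipartition_def bsize_def)+
    show "S e \<in> F" unfolding F_def
      using is_partition_le_psize[OF p] is_partition_zero_beyond_psize[OF p] le
      by (auto simp: not_less intro: order.trans)
  qed auto
  moreover have "finite {S. \<forall>e::bool. (e \<in> UNIV \<longrightarrow> S e \<in> F) \<and>
    (e \<notin> UNIV \<longrightarrow> S e = (\<lambda>_. 0::nat))}"
    by (rule finite_set_of_finite_funs) (use F in auto)
  ultimately show ?thesis by (rule finite_subset)
qed

lemma strip_bsize_le:
  assumes "bipartition S'" "strip S S'"
  shows "bsize S \<le> bsize S'"
proof -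
  have "psize (S e) \<le> psize (S' e)" for e
  proof -
    have "is_partition (S' e)" using assms(1) by (simp add: bipartition_def)
    then obtain L where L: "\<And>i. i \<ge> L \<Longrightarrow> S' e i = 0"
      using is_partition_bound by blast
    have L': "\<And>i. i \<ge> L \<Longrightarrow> S e i = 0"
      using L assms(2) by (metis strip_def le_zero_eq)
    show ?thesis
      using assms(2) by (simp add: psize_eq[OF L] psize_eq[OF L'] strip_def sum_mono)
  qed
  then show ?thesis by (simp add: bsize_def add_mono)
qed

section \<open>The local rule for interlacing partitions\<close>

text \<open>
  Suppose that \<open>\<kappa>\<close> interlaces with \<open>l\<close> and \<open>m\<close> from below and \<open>\<nu>\<close> from above. Then \<open>\<kappa> i\<close> and
  \<open>\<nu> (Suc i)\<close> vary in the same interval, from \<open>max (l (Suc i)) (m (Suc i))\<close> to \<open>min (l i) (m i)\<close>, and the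
  two maps reflect this interval. Only \<open>\<nu> 0\<close> is unbounded; its excess over the least possible
  value is the number \<open>k\<close>.
\<close>

definition toggle_up :: "(nat \<Rightarrow> nat) \<Rightarrow> (nat \<Rightarrow> nat) \<Rightarrow> (nat \<Rightarrow> nat) \<Rightarrow> nat \<Rightarrow> nat \<Rightarrow> nat"
  where "toggle_up l m \<kappa> k i = (case i of 0 \<Rightarrow> max (l 0) (m 0) + k
    | Suc i \<Rightarrow> min (l i) (m i) + max (l (Suc i)) (m (Suc i)) - \<kappa> i)"

definition toggle_down :: "(nat \<Rightarrow> nat) \<Rightarrow> (nat \<Rightarrow> nat) \<Rightarrow> (nat \<Rightarrow> nat) \<Rightarrow> nat \<Rightarrow> nat"
  where "toggle_down l m \<nu> i = min (l i) (m i) + max (l (Suc i)) (m (Suc i)) - \<nu> (Suc i)"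

lemma min_add_max: "min a b + max a b = a + (b :: nat)"
  by (simp add: min_def max_def)

text \<open>
  Each reflection turns \<open>\<kappa> i + \<nu> (Suc i)\<close> into a sum of a minimum and a maximum, and summed over all
  rows the minima and maxima add up to the rows of \<open>l\<close> and \<open>m\<close>.
\<close>

lemma psize_toggle_up:
  assumes "is_partition l" "is_partition m"
    and k: "\<And>i. \<kappa> i \<le> l i" "\<And>i. \<kappa> i \<le> m i"
  shows "psize (toggle_up l m \<kappa> k) + psize \<kappa> = psize l + psize m + k"
proof -
  obtain L1 where L1: "\<And>i. i \<ge> L1 \<Longrightarrow> l i = 0"
    using assms(1) is_partition_bound by blast
  obtain L2 where L2: "\<And>i. i \<ge> L2 \<Longrightarrow> m i = 0"
    using assms(2) is_partition_bound by blast
  define L where "L = max L1 L2"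
  have l: "\<And>i. i \<ge> L \<Longrightarrow> l i = 0" and m: "\<And>i. i \<ge> L \<Longrightarrow> m i = 0"
    using L1 L2 by (auto simp: L_def)
  have kz: "\<And>i. i \<ge> L \<Longrightarrow> \<kappa> i = 0" using l k by (metis le_zero_eq)
  have uz: "\<And>i. i \<ge> Suc L \<Longrightarrow> toggle_up l m \<kappa> k i = 0"
    using l m by (auto simp: toggle_up_def split: nat.split)
  have "psize (toggle_up l m \<kappa> k) + psize \<kappa>
      = (\<Sum>i<Suc L. toggle_up l m \<kappa> k i) + (\<Sum>i<L. \<kappa> i)"
    by (simp only: psize_eq[OF uz] psize_eq[OF kz])
  also have "\<dots> = max (l 0) (m 0) + k + (\<Sum>i<L. toggle_up l m \<kappa> k (Suc i) + \<kappa> i)"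
    by (subst sum.lessThan_Suc_shift) (simp add: toggle_up_def sum.distrib)
  also have "(\<Sum>i<L. toggle_up l m \<kappa> k (Suc i) + \<kappa> i)
      = (\<Sum>i<L. min (l i) (m i) + max (l (Suc i)) (m (Suc i)))"
    by (rule sum.cong) (use k in \<open>auto simp: toggle_up_def trans_le_add1\<close>)
  also have "\<dots> = (\<Sum>i<L. min (l i) (m i)) + (\<Sum>i<L. max (l (Suc i)) (m (Suc i)))"
    by (rule sum.distrib)
  also have "max (l 0) (m 0) + k + \<dots>
      = (\<Sum>i<L. min (l i) (m i)) + (\<Sum>i<Suc L. max (l i) (m i)) + k"
    by (simp only: sum.lessThan_Suc_shift add_ac)
  also have "\<dots> = (\<Sum>i<L. min (l i) (m i) + max (l i) (m i)) + k"
    using l[of L] m[of L] by (simp add: sum.distrib)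
  also have "(\<Sum>i<L. min (l i) (m i) + max (l i) (m i)) = psize l + psize m"
    by (simp add: psize_eq[OF l] psize_eq[OF m] sum.distrib[symmetric] min_add_max)
  finally show ?thesis .
qed

definition common_above ::
    "(bool \<Rightarrow> nat \<Rightarrow> nat) \<Rightarrow> (bool \<Rightarrow> nat \<Rightarrow> nat) \<Rightarrow> (bool \<Rightarrow> nat \<Rightarrow> nat) set"
  where "common_above L M = {N. bipartition N \<and> strip L N \<and> strip M N}"
definition common_below ::
    "(bool \<Rightarrow> nat \<Rightarrow> nat) \<Rightarrow> (bool \<Rightarrow> nat \<Rightarrow> nat) \<Rightarrow> (bool \<Rightarrow> nat \<Rightarrow> nat) set"
  where "common_below L M = {K. bipartition K \<and> strip K L \<and> strip K M}"

text \<open>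
  This is the commutation rule of adding and removing horizontal strips. The two numbers \<open>k\<close> and
  \<open>k'\<close> come from the first rows of the two components.
\<close>

lemma local_rule:
  assumes "bipartition L" "bipartition M"
  shows "bij_betw (\<lambda>N. (\<lambda>e. toggle_down (L e) (M e) (N e),
                         N False 0 - max (L False 0) (M False 0),
                         N True 0 - max (L True 0) (M True 0)))
           {N \<in> common_above L M. bsize N = s}
           {(K, k, k'). K \<in> common_below L M \<and> s + bsize K = bsize L + bsize M + k + k'}"
    (is "bij_betw ?f ?A ?B")
proof -
  define g where "g = (\<lambda>(K, k::nat, k'::nat) e. toggle_up (L e) (M e) (K e) (if e then k' else k))"
  have pL: "is_partition (L e)" and pM: "is_partition (M e)" for e
    using assms by (auto simp: bipartition_def)
  have size: "bsize (g (K, k, k')) + bsize K = bsize L + bsize M + k + k'"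
    if "K \<in> common_below L M" for K k k'
  proof -
    have *: "psize (g (K, k, k') e) + psize (K e) = psize (L e) + psize (M e) + (if e then k' else k)"
      for e unfolding g_def prod.case
      by (rule psize_toggle_up[OF pL pM]) (use that in \<open>auto simp: common_below_def strip_def\<close>)
    show ?thesis using *[of True] *[of False] by (simp add: bsize_def)
  qed
  have stg: "strip L (g (K, k, k')) \<and> strip M (g (K, k, k'))"
    if "K \<in> common_below L M" for K k k'
  proof -
    have "L e i \<le> g (K, k, k') e i \<and> g (K, k, k') e (Suc i) \<le> L e i
        \<and> M e i \<le> g (K, k, k') e i \<and> g (K, k, k') e (Suc i) \<le> M e i" for e i
    proof (cases i)
      case 0
      have a: "K e 0 \<le> L e 0" "L e (Suc 0) \<le> K e 0" "K e 0 \<le> M e 0" "M e (Suc 0) \<le> K e 0"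
        using that by (auto simp: common_below_def strip_def)
      show ?thesis using a unfolding 0
        by (cases e; simp add: g_def toggle_up_def; linarith)
    next
      case (Suc j)
      have a: "K e j \<le> L e j" "L e (Suc j) \<le> K e j" "K e j \<le> M e j" "M e (Suc j) \<le> K e j"
        "K e i \<le> L e i" "L e (Suc i) \<le> K e i" "K e i \<le> M e i" "M e (Suc i) \<le> K e i"
        using that by (auto simp: common_below_def strip_def)
      show ?thesis using a unfolding Suc
        by (cases e; simp add: g_def toggle_up_def; linarith)
    qed
    then show ?thesis by (simp add: strip_def)
  qed
  have g: "g x \<in> ?A" if "x \<in> ?B" for x
  proof -
    obtain K k k' where x: "x = (K, k, k')" by (cases x) 
    have K: "K \<in> common_below L M" and s: "s + bsize K = bsize L + bsize M + k + k'"
      using that x by auto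
    have "is_partition (g x e)" for e
    proof -
      obtain N where "\<And>i. i \<ge> N \<Longrightarrow> L e i = 0" using is_partition_bound[OF pL] by blast
      then have "\<And>i. i \<ge> Suc N \<Longrightarrow> g x e i = 0"
        using stg[OF K, of k k'] unfolding x strip_def
        by (metis Suc_le_D Suc_le_mono le_zero_eq)
      moreover have "g x e (Suc i) \<le> g x e i" for i
        using stg[OF K, of k k'] unfolding x strip_def by (meson order.trans)
      ultimately show ?thesis by (rule is_partitionI[rotated])
    qed
    then show ?thesis
      using stg[OF K, of k k'] size[OF K, of k k'] s
      by (auto simp: common_above_def bipartition_def x)
  qed
  have fN: "fst (?f N) \<in> common_below L M" "g (?f N) = N" if "N \<in> common_above L M" for N
  proof -
    have a: "L e j \<le> N e j" "N e (Suc j) \<le> L e j" "M e j \<le> N e j" "N e (Suc j) \<le> M e j" for e j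
      using that by (auto simp: common_above_def strip_def)
    have st: "toggle_down (L e) (M e) (N e) i \<le> L e i \<and>
      L e (Suc i) \<le> toggle_down (L e) (M e) (N e) i \<and>
       toggle_down (L e) (M e) (N e) i \<le> M e i \<and> M e (Suc i) \<le> toggle_down (L e) (M e) (N e) i" for e i
      using a[of e i] a[of e "Suc i"] unfolding toggle_down_def by linarith
    have "is_partition (toggle_down (L e) (M e) (N e))" for e
    proof -
      obtain n where "\<And>i. i \<ge> n \<Longrightarrow> L e i = 0" using is_partition_bound[OF pL] by blast
      then have "\<And>i. i \<ge> n \<Longrightarrow> toggle_down (L e) (M e) (N e) i = 0"
        using st by (metis le_zero_eq)
      moreover have "toggle_down (L e) (M e) (N e) (Suc i) \<le> toggle_down (L e) (M e) (N e) i" for i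
        using st by (meson order.trans)
      ultimately show ?thesis by (rule is_partitionI[rotated])
    qed
    then show "fst (?f N) \<in> common_below L M"
      using st by (auto simp: common_below_def strip_def bipartition_def)
    show "g (?f N) = N"
    proof (intro ext)
      fix e i
      show "g (?f N) e i = N e i"
        using a[of e "i - 1"] a[of e i]
        by (cases i; cases e) (simp_all add: g_def toggle_up_def toggle_down_def)
    qed
  qed
  have gf: "?f (g x) = x" if "x \<in> ?B" for x
  proof -
    obtain K k k' where x: "x = (K, k, k')" by (cases x) 
    have a: "K e j \<le> L e j" "L e (Suc j) \<le> K e j" "K e j \<le> M e j" "M e (Suc j) \<le> K e j" for e j
      using that by (auto simp: common_below_def strip_def x)
    have "toggle_down (L e) (M e) (g x e) i = K e i" for e i
      using a[of e i] unfolding x by (simp add: g_def toggle_up_def toggle_down_def)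
    then show ?thesis by (auto simp: x g_def toggle_up_def fun_eq_iff)
  qed
  show ?thesis
  proof (rule bij_betw_byWitness[where f' = g])
    show "\<forall>N\<in>?A. g (?f N) = N" using fN by blast
    show "\<forall>x\<in>?B. ?f (g x) = x" using gf by blast
    show "g ` ?B \<subseteq> ?A" using g by blast
    show "?f ` ?A \<subseteq> ?B"
    proof
      fix x assume "x \<in> ?f ` ?A"
      then obtain N where N: "N \<in> ?A" and x: "x = ?f N" by blast
      show "x \<in> ?B"
        using fN[of N] size[OF fN(1), of N "fst (snd x)" "snd (snd x)"] N unfolding x by auto
    qed
  qed
qed

section \<open>Pairs of strip chains and multisets of pairs\<close>

definition abs_mset :: "int multiset \<Rightarrow> nat multiset"
  where "abs_mset b = image_mset (\<lambda>j. nat \<bar>j\<bar>) b"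

lemma nat_abs_eq_iff: "nat \<bar>x\<bar> = i \<longleftrightarrow> x = int i \<or> x = - int i"
  by auto

lemma count_size_filter_image: "count (image_mset f X) y = size (filter_mset (\<lambda>x. f x = y) X)"
  by (induction X) auto

lemma count_abs_mset:
  "count (abs_mset b) i = (if i = 0 then count b 0 else count b (int i) + count b (- int i))"
  unfolding abs_mset_def
proof (induction b)
  case (add x b)
  then show ?case by (cases "x = int i"; cases "x = - int i") (auto simp: nat_abs_eq_iff split: if_splits)
qed auto

lemma size_abs_mset [simp]: "size (abs_mset b) = size b"
  by (simp add: abs_mset_def)

lemma abs_mset_union [simp]: "abs_mset (a + b) = abs_mset a + abs_mset b"
  by (simp add: abs_mset_def)

lemma finite_multisets_bounded_size:
  assumes "finite A"
  shows "finite {X. set_mset X \<subseteq> A \<and> size X \<le> n}"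
proof -
  have "{X. set_mset X \<subseteq> A \<and> size X \<le> n} \<subseteq> mset ` {xs. set xs \<subseteq> A \<and>
    length xs \<le> n}"
  proof
    fix X assume "X \<in> {X. set_mset X \<subseteq> A \<and> size X \<le> n}"
    moreover obtain xs where "X = mset xs" using ex_mset by metis
    ultimately show "X \<in> mset ` {xs. set xs \<subseteq> A \<and> length xs \<le> n}" by auto
  qed
  then show ?thesis
    using finite_lists_length_le[OF assms] finite_subset by blast
qed

text \<open>
  The states that consist of a single row in the component of the odd beads. In terms of dominoes
  these are the shapes of one row filled by horizontal dominoes.
\<close>

definition one_row :: "nat \<Rightarrow> bool \<Rightarrow> nat \<Rightarrow> nat"
  where "one_row a = (\<lambda>e i. if \<not> e \<and> i = 0 then a else 0)"

lemma bipartition_one_row: "bipartition (one_row a)"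
  unfolding bipartition_def
proof
  fix e
  show "is_partition (one_row a e)"
    by (rule is_partitionI[where L = 1]) (auto simp: one_row_def)
qed

lemma bsize_one_row [simp]: "bsize (one_row a) = a"
proof -
  have "psize (one_row a e) = (\<Sum>i<1. one_row a e i)" for e
    by (rule psize_eq) (auto simp: one_row_def)
  then show ?thesis by (simp add: bsize_def) (simp add: one_row_def)
qed

lemma one_row_inject [simp]: "one_row a = one_row b \<longleftrightarrow> a = b"
  by (auto simp: one_row_def fun_eq_iff)

lemma strip_one_row_iff:
  "strip H (one_row c) \<longleftrightarrow> (\<exists>h\<le>c. H = one_row h)"
proof
  assume H: "strip H (one_row c)"
  have "H = one_row (H False 0)"
  proof (intro ext)
    fix e i
    have "H e i \<le> one_row c e i" using H by (auto simp: strip_def)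
    then show "H e i = one_row (H False 0) e i" by (auto simp: one_row_def split: if_splits)
  qed
  moreover have "H False 0 \<le> c" using H unfolding strip_def
    by (metis one_row_def)
  ultimately show "\<exists>h\<le>c. H = one_row h" by blast
qed (auto simp: strip_def one_row_def)

definition strips_above :: "(bool \<Rightarrow> nat \<Rightarrow> nat) \<Rightarrow> nat \<Rightarrow> (bool \<Rightarrow> nat \<Rightarrow> nat) set"
  where "strips_above H a = {S. bipartition S \<and> strip H S \<and> bsize S = bsize H + a}"

definition strips_below :: "(bool \<Rightarrow> nat \<Rightarrow> nat) \<Rightarrow> nat \<Rightarrow> (bool \<Rightarrow> nat \<Rightarrow> nat) set"
  where "strips_below S a = {H. bipartition H \<and> strip H S \<and> bsize S = bsize H + a}"

lemma finite_strips_above [simp]: "finite (strips_above H a)"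
  by (rule finite_subset[OF _ finite_bipartitions_of[of "bsize H + a"]])
    (auto simp: strips_above_def bipartitions_of_def)

lemma finite_strips_below [simp]: "finite (strips_below S a)"
  by (rule finite_subset[OF _ finite_bipartitions_of[of "bsize S - a"]])
    (auto simp: strips_below_def bipartitions_of_def)

text \<open>
  The number of chains of strips that start with a row of length \<open>count \<beta> 0\<close>, have a step
  of size \<open>count \<beta> i\<close> for \<open>i = 1, \<dots>, m\<close> and end in \<open>S\<close>. They are the domino analogues of semistandard
  tableaux of content \<open>\<beta>\<close>; the entry \<open>0\<close> is confined to horizontal dominoes in the first row, which
  reflects the special role of the indeterminate \<open>x\<^sub>0\<close>.
\<close>

fun strip_chains :: "nat multiset \<Rightarrow> nat \<Rightarrow> (bool \<Rightarrow> nat \<Rightarrow> nat) \<Rightarrow> nat" where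
  "strip_chains \<beta> 0 S = (if S = one_row (count \<beta> 0) then 1 else 0)"
| "strip_chains \<beta> (Suc m) S = (\<Sum>H\<in>strips_below S (count \<beta> (Suc m)). strip_chains \<beta> m H)"

lemma strip_chains_cong:
  assumes "\<And>i. i \<le> m \<Longrightarrow> count \<beta> i = count \<beta>' i"
  shows "strip_chains \<beta> m S = strip_chains \<beta>' m S"
  using assms by (induction m arbitrary: S) auto

text \<open>
  A choice of \<open>a\<close> letters up to \<open>m\<close> from \<open>\<beta>\<close> where each positive letter is given a sign.
\<close>

definition signed_submsets :: "nat multiset \<Rightarrow> nat \<Rightarrow> nat \<Rightarrow> int multiset set"
  where "signed_submsets \<beta> m a =
    {b. size b = a \<and> (\<forall>j\<in>#b. nat \<bar>j\<bar> \<le> m) \<and> abs_mset b \<subseteq># \<beta>}"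

lemma finite_signed_submsets [simp]: "finite (signed_submsets \<beta> m a)"
proof (rule finite_subset)
  show "signed_submsets \<beta> m a \<subseteq> {b. set_mset b \<subseteq> {- int m..int m} \<and> size b \<le> a}"
    by (force simp: signed_submsets_def)
qed (rule finite_multisets_bounded_size, simp)

lemma signed_submsets_0:
  "signed_submsets \<beta> 0 a = (if a \<le> count \<beta> 0 then {replicate_mset a 0} else {})"
proof -
  have "b \<in> signed_submsets \<beta> 0 a \<longleftrightarrow>
    b = replicate_mset a 0 \<and> a \<le> count \<beta> 0" for b
  proof
    assume b: "b \<in> signed_submsets \<beta> 0 a"
    then have "set_mset b \<subseteq> {0}" by (auto simp: signed_submsets_def)
    then have eq: "b = replicate_mset a 0"
      using b by (metis (mono_tags, lifting) mem_Collect_eq set_mset_subset_singletonD signed_submsets_def)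
    moreover have "count (abs_mset b) 0 \<le> count \<beta> 0"
      using b by (auto simp: signed_submsets_def intro: mset_subset_eq_count)
    ultimately show "b = replicate_mset a 0 \<and> a \<le> count \<beta> 0" by (simp add: count_abs_mset)
  next
    assume "b = replicate_mset a 0 \<and> a \<le> count \<beta> 0"
    then show "b \<in> signed_submsets \<beta> 0 a"
      by (auto simp: signed_submsets_def subseteq_mset_def count_abs_mset)
  qed
  then show ?thesis by auto
qed

text \<open>
  The letter \<open>Suc m\<close> is split off: it is chosen \<open>k\<close> times with sign plus and \<open>k'\<close> times with sign
  minus.
\<close>

lemma signed_submsets_Suc:
  "bij_betw (\<lambda>((k, k'), b). b + replicate_mset k (int (Suc m)) + replicate_mset k' (- int (Suc m)))
     (SIGMA (k, k'):{(k, k'). k + k' \<le> a \<and>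
       k + k' \<le> count \<beta> (Suc m)}. signed_submsets \<beta> m (a - k - k'))
     (signed_submsets \<beta> (Suc m) a)"
    (is "bij_betw ?f ?A ?B")
proof (rule bij_betw_byWitness[where f' =
  "\<lambda>b. ((count b (int (Suc m)), count b (- int (Suc m))), filter_mset (\<lambda>j. nat \<bar>j\<bar> \<le> m) b)"])
  have z: "count b (1 + int m) = 0" "count b (- 1 - int m) =
    0" "filter_mset (\<lambda>j. nat \<bar>j\<bar> \<le> m) b = b"
    if "\<forall>j\<in>#b. nat \<bar>j\<bar> \<le> m" for b
    using that by (auto simp: not_in_iff[symmetric] filter_mset_eq_conv)
  show "\<forall>x\<in>?A. ((count (?f x) (int (Suc m)), count (?f x) (- int (Suc m))),
     filter_mset (\<lambda>j. nat \<bar>j\<bar> \<le> m) (?f x)) = x"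
    using z by (auto simp: signed_submsets_def) 
  have split: "filter_mset (\<lambda>j. nat \<bar>j\<bar> \<le> m) b + replicate_mset (count b (int (Suc m))) (int (Suc m)) +
     replicate_mset (count b (- int (Suc m))) (- int (Suc m)) = b"
    if "\<forall>j\<in>#b. nat \<bar>j\<bar> \<le> Suc m" for b
  proof (rule multiset_eqI)
    fix j
    show "count (filter_mset (\<lambda>j. nat \<bar>j\<bar> \<le> m) b + replicate_mset (count b (int (Suc m))) (int (Suc m)) +
     replicate_mset (count b (- int (Suc m))) (- int (Suc m))) j = count b j"
    proof (cases "j \<in># b")
      case True
      then have "nat \<bar>j\<bar> \<le> Suc m" using that by blast
      then consider "nat \<bar>j\<bar> \<le> m" | "j = int (Suc m)" | "j = - int (Suc m)" by linarith
      then show ?thesis by cases auto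
    next
      case False
      then show ?thesis by (auto simp: not_in_iff)
    qed
  qed
  then show "\<forall>b\<in>?B. ?f ((count b (int (Suc m)), count b (- int (Suc m))), filter_mset (\<lambda>j. nat \<bar>j\<bar> \<le> m) b) = b"
    by (auto simp: signed_submsets_def)
  show "?f ` ?A \<subseteq> ?B"
  proof (intro image_subsetI)
    fix x assume "x \<in> ?A"
    then obtain k k' b where x: "x = ((k, k'), b)" and k: "k + k' \<le> a" "k + k' \<le> count \<beta> (Suc m)"
      and b: "size b = a - k - k'" "\<forall>j\<in>#b. nat \<bar>j\<bar> \<le> m" "abs_mset b \<subseteq># \<beta>"
      by (auto simp: signed_submsets_def)
    have "count (abs_mset (?f x)) i \<le> count \<beta> i" for i
    proof -
      have "count (abs_mset b) i \<le> count \<beta> i" using b(3) by (rule mset_subset_eq_count)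
      then show ?thesis
        using z[OF b(2)] k by (cases "i = Suc m") (auto simp: x count_abs_mset)
    qed
    then show "?f x \<in> ?B" using k b
      by (auto simp: x signed_submsets_def subseteq_mset_def)
  qed
  show "(\<lambda>b. ((count b (int (Suc m)), count b (- int (Suc m))), filter_mset (\<lambda>j. nat \<bar>j\<bar> \<le> m) b)) ` ?B \<subseteq> ?A"
  proof (intro image_subsetI)
    fix b assume "b \<in> ?B"
    then have b: "size b = a" "\<forall>j\<in>#b. nat \<bar>j\<bar> \<le> Suc m" "abs_mset b \<subseteq># \<beta>"
      by (auto simp: signed_submsets_def)
    have c: "count (abs_mset b) i \<le> count \<beta> i" for i using b(3) by (rule mset_subset_eq_count)
    have "abs_mset (filter_mset (\<lambda>j. nat \<bar>j\<bar> \<le> m) b) \<subseteq># \<beta>"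
      using b(3) by (metis abs_mset_def image_mset_subseteq_mono multiset_filter_subset subset_mset.order_trans)
    moreover have "a =
      size (filter_mset (\<lambda>j. nat \<bar>j\<bar> \<le> m) b) + count b (int (Suc m)) + count b (- int (Suc m))"
      using arg_cong[OF split[OF b(2)], of size] b(1) by simp
    moreover have "count b (int (Suc m)) + count b (- int (Suc m)) \<le> count \<beta> (Suc m)"
      using c[of "Suc m"] by (simp add: count_abs_mset)
    ultimately show "((count b (int (Suc m)), count b (- int (Suc m))), filter_mset (\<lambda>j. nat \<bar>j\<bar> \<le> m) b) \<in> ?A"
      by (auto simp: signed_submsets_def)
  qed
qed

text \<open>
  Instead of removing a strip of size \<open>a\<close> from the end of a chain, one may move this removal through
  the chain to its beginning. By the local rule, passing a step of the chain makes both strips lose \<open>k + k'\<close> boxes,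
  where \<open>k\<close> and \<open>k'\<close> are the signed letters that are taken from this step. At the initial row only the
  sign plus is possible, because that row lives in a single component.
\<close>

lemma sum_strip_chains_above:
  assumes "bipartition H"
  shows "(\<Sum>S\<in>strips_above H a. strip_chains \<beta> m S)
    = (\<Sum>b\<in>signed_submsets \<beta> m a. strip_chains (\<beta> - abs_mset b) m H)"
  using assms
proof (induction m arbitrary: a \<beta> H)
  case 0
  define c where "c = count \<beta> 0"
  have "(\<Sum>S\<in>strips_above H a. strip_chains \<beta> 0 S) = (if one_row c \<in> strips_above H a then 1 else 0)"
    by (simp add: c_def)
  also have "one_row c \<in> strips_above H a \<longleftrightarrow> a \<le> c \<and> H = one_row (c - a)"
    using bipartition_one_row by (auto simp: strips_above_def strip_one_row_iff)
  also have "(if a \<le> c \<and> H = one_row (c - a) then 1 else 0)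
      = (\<Sum>b\<in>signed_submsets \<beta> 0 a. strip_chains (\<beta> - abs_mset b) 0 H)"
    by (auto simp: signed_submsets_0 c_def count_abs_mset)
  finally show ?case .
next
  case (Suc m)
  define c where "c = count \<beta> (Suc m)"
  let ?f = "strip_chains \<beta> m"
  define MS where "MS = {M. bipartition M \<and> bsize M + c = bsize H + a}"
  have finMS: "finite MS"
    by (rule finite_subset[OF _ finite_bipartitions_of[of "bsize H + a - c"]])
      (auto simp: MS_def bipartitions_of_def)
  define Z where "Z = (\<lambda>M. {(K, k, k'). K \<in> common_below H M \<and>
      (bsize H + a) + bsize K = bsize H + bsize M + k + k'})"
  have bij: "bij_betw (\<lambda>N. (\<lambda>e. toggle_down (H e) (M e) (N e),
                         N False 0 - max (H False 0) (M False 0),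
                         N True 0 - max (H True 0) (M True 0)))
           {N \<in> common_above H M. bsize N = bsize H + a} (Z M)" if "M \<in> MS" for M
    unfolding Z_def by (rule local_rule) (use that Suc.prems in \<open>auto simp: MS_def\<close>)
  have finN: "finite {N \<in> common_above H M. bsize N = bsize H + a}" for M
    by (rule finite_subset[OF _ finite_bipartitions_of[of "bsize H + a"]])
      (auto simp: common_above_def bipartitions_of_def)
  have finZ: "finite (Z M)" if "M \<in> MS" for M
    using bij[OF that] finN bij_betw_finite by blast
  have finK: "finite {(k, k'). k + k' \<le> a \<and> k + k' \<le> c}"
    by (rule finite_subset[of _ "{..a} \<times> {..a}"]) auto
  define i where "i = (\<lambda>((k::nat, k'::nat), K::bool \<Rightarrow> nat \<Rightarrow> nat, M::bool \<Rightarrow> nat \<Rightarrow> nat). (M, K, k, k'))"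
  define j where "j = (\<lambda>(M::bool \<Rightarrow> nat \<Rightarrow> nat, K::bool \<Rightarrow> nat \<Rightarrow> nat, k::nat, k'::nat). ((k, k'), K, M))"
  have "(\<Sum>S\<in>strips_above H a. strip_chains \<beta> (Suc m) S)
      = (\<Sum>S\<in>strips_above H a. \<Sum>M\<in>{M \<in> MS. strip M S}. ?f M)"
  proof (rule sum.cong[OF refl])
    fix S assume "S \<in> strips_above H a"
    then have "strips_below S c = {M \<in> MS. strip M S}"
      by (auto simp: strips_above_def strips_below_def MS_def)
    then show "strip_chains \<beta> (Suc m) S = (\<Sum>M\<in>{M \<in> MS. strip M S}. ?f M)"
      by (simp add: c_def)
  qed
  also have "\<dots> = (\<Sum>M\<in>MS. \<Sum>S\<in>{S \<in> strips_above H a. strip M S}. ?f M)"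
    by (rule sum.swap_restrict) (simp_all add: finMS)
  \<comment> \<open>The local rule replaces the common upper end \<open>S\<close> by a common lower end \<open>K\<close>.\<close>
  also have "\<dots> = (\<Sum>M\<in>MS. \<Sum>z\<in>Z M. ?f M)"
  proof (rule sum.cong[OF refl])
    fix M assume M: "M \<in> MS"
    have "{S \<in> strips_above H a. strip M S} = {N \<in> common_above H M. bsize N = bsize H + a}"
      by (auto simp: strips_above_def common_above_def)
    then show "(\<Sum>S\<in>{S \<in> strips_above H a. strip M S}. ?f M) = (\<Sum>z\<in>Z M. ?f M)"
      using bij_betw_same_card[OF bij[OF M]] by simp
  qed
  also have "\<dots> = (\<Sum>(M, z)\<in>Sigma MS Z. ?f M)"
    by (rule sum.Sigma) (use finMS finZ in auto)
  also have "\<dots> = (\<Sum>(M, K, k, k')\<in>Sigma MS Z. ?f M)"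
    by (rule sum.cong) auto
  also have "\<dots> = (\<Sum>((k, k'), K, M)\<in>(SIGMA (k, k'):{(k, k'). k + k' \<le> a \<and> k + k' \<le> c}.
       SIGMA K:strips_below H (c - k - k'). strips_above K (a - k - k')). ?f M)"
  proof (rule sum.reindex_bij_witness[where i = i and j = j])
    fix x assume x: "x \<in> Sigma MS Z"
    obtain M K k k' where x': "x = (M, K, k, k')" by (cases x)
    have bip: "bipartition M" "bipartition K" "strip K H" "strip K M"
      and s: "bsize M + c = bsize H + a" "a + bsize K = bsize M + k + k'"
      using x by (auto simp: x' MS_def Z_def common_below_def)
    show "j x \<in> (SIGMA (k, k'):{(k, k'). k + k' \<le> a \<and> k + k' \<le> c}.
       SIGMA K:strips_below H (c - k - k'). strips_above K (a - k - k'))"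
      using strip_bsize_le[OF bip(1,4)] strip_bsize_le[OF Suc.prems bip(3)] bip s
      by (auto simp: j_def x' strips_below_def strips_above_def)
  next
    fix y assume "y \<in> (SIGMA (k, k'):{(k, k'). k + k' \<le> a \<and> k + k' \<le> c}.
       SIGMA K:strips_below H (c - k - k'). strips_above K (a - k - k'))"
    then show "i y \<in> Sigma MS Z"
      by (auto simp: i_def MS_def Z_def common_below_def strips_below_def strips_above_def)
  qed (auto simp: i_def j_def)
  also have "\<dots> =
    (\<Sum>(k, k')\<in>{(k, k'). k + k' \<le> a \<and> k + k' \<le> c}. \<Sum>K\<in>strips_below H (c - k - k').
      \<Sum>M\<in>strips_above K (a - k - k'). ?f M)"
    by (subst sum.Sigma[symmetric]) (auto intro!: sum.cong sum.Sigma[symmetric] finK)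
  also have "\<dots> =
    (\<Sum>(k, k')\<in>{(k, k'). k + k' \<le> a \<and> k + k' \<le> c}. \<Sum>K\<in>strips_below H (c - k - k').
      \<Sum>b\<in>signed_submsets \<beta> m (a - k - k'). strip_chains (\<beta> - abs_mset b) m K)"
    using Suc.IH by (auto intro!: sum.cong simp: strips_below_def)
  also have "\<dots> =
    (\<Sum>((k, k'), b)\<in>(SIGMA (k, k'):{(k, k'). k + k' \<le> a \<and>
      k + k' \<le> c}. signed_submsets \<beta> m (a - k - k')).
     \<Sum>K\<in>strips_below H (c - k - k'). strip_chains (\<beta> - abs_mset b) m K)"
    by (subst sum.Sigma[symmetric]) (auto intro!: sum.cong sum.swap finK)
  also have "\<dots> =
    (\<Sum>x\<in>(SIGMA (k, k'):{(k, k'). k + k' \<le> a \<and>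
      k + k' \<le> c}. signed_submsets \<beta> m (a - k - k')).
     strip_chains (\<beta> - abs_mset ((\<lambda>((k, k'), b).
       b + replicate_mset k (int (Suc m)) + replicate_mset k' (- int (Suc m))) x)) (Suc m) H)"
  proof (rule sum.cong[OF refl], goal_cases)
    case (1 x)
    then obtain k k' b where x: "x = ((k, k'), b)" and b: "\<forall>j\<in>#b. nat \<bar>j\<bar> \<le> m"
      by (auto simp: signed_submsets_def)
    let ?b = "b + replicate_mset k (int (Suc m)) + replicate_mset k' (- int (Suc m))"
    have "int (Suc m) \<notin># b" "- int (Suc m) \<notin># b" using b by fastforce+
    then have "count (\<beta> - abs_mset ?b) (Suc m) = c - k - k'"
      by (simp add: count_abs_mset c_def not_in_iff)
    moreover have "strip_chains (\<beta> - abs_mset ?b) m = strip_chains (\<beta> - abs_mset b) m"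
      by (intro ext strip_chains_cong) (auto simp: count_abs_mset)
    ultimately show ?case
      by (simp add: x)
  qed
  also have "\<dots> = (\<Sum>b\<in>signed_submsets \<beta> (Suc m) a. strip_chains (\<beta> - abs_mset b) (Suc m) H)"
    unfolding c_def
    by (rule sum.reindex_bij_betw[OF signed_submsets_Suc])
  finally show ?case .
qed

text \<open>
  Multisets of pairs \<open>(i, j)\<close> with \<open>(i, j) \<ge> (0, 0)\<close> lexicographically: their first entries have the
  content of \<open>\<alpha>\<close> up to \<open>n\<close>, and the absolute values of their second entries form \<open>\<beta>\<close>. Negative \<open>j\<close> occur
  only together with positive \<open>i\<close>.
\<close>

definition pair_multisets :: "nat multiset \<Rightarrow> nat \<Rightarrow> nat multiset \<Rightarrow> (int \<times> int) multiset set"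
  where "pair_multisets \<alpha> n \<beta> = {X. (\<forall>z\<in>#X. (0, 0) \<le> z \<and> fst z \<le> int n) \<and>
    (\<forall>i\<le>n. count (image_mset fst X) (int i) =
      count \<alpha> i) \<and> abs_mset (image_mset snd X) = \<beta>}"

lemma finite_pair_multisets [simp]: "finite (pair_multisets \<alpha> n \<beta>)"
proof (rule finite_subset)
  let ?A = "{0..int n} \<times> (int ` set_mset \<beta> \<union> (\<lambda>j. - int j) ` set_mset \<beta>)"
  show "pair_multisets \<alpha> n \<beta> \<subseteq> {X. set_mset X \<subseteq> ?A \<and> size X \<le> size \<beta>}"
  proof (intro subsetI CollectI conjI)
    fix X z assume X: "X \<in> pair_multisets \<alpha> n \<beta>" and z: "z \<in># X"
    obtain i j where ij: "z = (i, j)" by (cases z)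
    have "nat \<bar>j\<bar> \<in># \<beta>"
      using X z by (force simp: pair_multisets_def abs_mset_def ij)
    moreover have "j = int (nat \<bar>j\<bar>) \<or> j = - int (nat \<bar>j\<bar>)" by auto
    ultimately have "j \<in> int ` set_mset \<beta> \<union> (\<lambda>j. - int j) ` set_mset \<beta>" by blast
    moreover have "0 \<le> i" "i \<le> int n"
      using X z by (force simp: pair_multisets_def ij less_eq_prod_def)+
    ultimately show "z \<in> ?A" by (simp add: ij)
  next
    fix X assume "X \<in> pair_multisets \<alpha> n \<beta>"
    then have "size (abs_mset (image_mset snd X)) = size \<beta>" by (simp add: pair_multisets_def)
    then show "size X \<le> size \<beta>" by simp
  qed
  show "finite {X. set_mset X \<subseteq> ?A \<and> size X \<le> size \<beta>}"
    by (rule finite_multisets_bounded_size) auto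
qed

lemma pair_multisets_0:
  "pair_multisets \<alpha> 0 \<beta> = (if size \<beta> =
    count \<alpha> 0 then {image_mset (\<lambda>j. (0, int j)) \<beta>} else {})"
proof -
  have "X = image_mset (\<lambda>j. (0, int j)) \<beta> \<and> size \<beta> =
    count \<alpha> 0" if X: "X \<in> pair_multisets \<alpha> 0 \<beta>" for X
  proof
    have z: "fst z = 0" "0 \<le> snd z" if "z \<in># X" for z
      using X that by (cases z; force simp: pair_multisets_def less_eq_prod_def)+
    have "image_mset (\<lambda>j. (0, int j)) \<beta> = image_mset (\<lambda>z. (0, \<bar>snd z\<bar>)) X"
      using X by (auto simp: pair_multisets_def abs_mset_def multiset.map_comp comp_def)
    also have "\<dots> = image_mset id X"
      by (rule image_mset_cong) (use z in \<open>auto simp: prod_eq_iff\<close>)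
    finally show "X = image_mset (\<lambda>j. (0, int j)) \<beta>" by simp
    have "image_mset fst X = image_mset (\<lambda>_. 0) X"
      by (rule image_mset_cong) (use z in auto)
    moreover have "count (image_mset fst X) 0 = count \<alpha> 0"
      using X by (auto simp: pair_multisets_def)
    moreover have "size X = size \<beta>" using X by (auto simp: pair_multisets_def)
    ultimately show "size \<beta> = count \<alpha> 0" by (simp add: image_mset_const_eq)
  qed
  moreover have "image_mset (\<lambda>j. (0, int j)) \<beta> \<in> pair_multisets \<alpha> 0 \<beta>"
    if "size \<beta> = count \<alpha> 0"
    using that by (auto simp: pair_multisets_def abs_mset_def multiset.map_comp comp_def image_mset_const_eq)
  ultimately show ?thesis by auto
qed

text \<open>
  The pairs with the largest first entry \<open>Suc n\<close> are split off; their second entries form an arbitrary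
  signed choice of letters from \<open>\<beta>\<close>.
\<close>

lemma pair_multisets_Suc:
  "bij_betw (\<lambda>(b, X). X + image_mset (\<lambda>j. (int (Suc n), j)) b)
     (SIGMA b:signed_submsets \<beta> m (count \<alpha> (Suc n)). pair_multisets \<alpha> n (\<beta> - abs_mset b))
     (pair_multisets \<alpha> (Suc n) \<beta>)"
    (is "bij_betw ?f ?A ?B")
  if \<beta>: "\<And>j. j \<in># \<beta> \<Longrightarrow> j \<le> m"
proof (rule bij_betw_byWitness[where f' = "\<lambda>X. (image_mset snd (filter_mset (\<lambda>z. fst z =
  int (Suc n)) X),
    filter_mset (\<lambda>z. fst z \<noteq> int (Suc n)) X)"])
  let ?g = "\<lambda>X. (image_mset snd (filter_mset (\<lambda>z. fst z = int (Suc n)) X),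
    filter_mset (\<lambda>z. fst z \<noteq> int (Suc n)) X)"
  have f0: "filter_mset (\<lambda>z. fst z = 1 + int n) X = {#}"
      "filter_mset (\<lambda>z. fst z \<noteq> 1 + int n) X = X"
    if "\<forall>z\<in>#X. (0, 0) \<le> z \<and> fst z \<le> int n" for X :: "(int \<times> int) multiset"
    using that by (force simp: filter_mset_eq_conv filter_mset_eq_mempty_iff)+
  show "\<forall>x\<in>?A. ?g (?f x) = x"
    using f0 by (auto simp: pair_multisets_def filter_mset_image_mset multiset.map_comp comp_def)
  have row: "image_mset (\<lambda>j. (int (Suc n), j)) (image_mset snd (filter_mset (\<lambda>z. fst z =
    int (Suc n)) X))
     = filter_mset (\<lambda>z. fst z = int (Suc n)) X" for X :: "(int \<times> int) multiset"
  proof -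
    have "image_mset (\<lambda>j. (int (Suc n), j)) (image_mset snd (filter_mset (\<lambda>z. fst z = int (Suc n)) X))
       = image_mset id (filter_mset (\<lambda>z. fst z = int (Suc n)) X)"
      unfolding multiset.map_comp by (rule image_mset_cong) auto
    then show ?thesis by simp
  qed
  show "\<forall>X\<in>?B. ?f (?g X) = X"
    unfolding prod.case row by (simp add: multiset_partition[symmetric] add.commute)
  show "?f ` ?A \<subseteq> ?B"
  proof (intro image_subsetI)
    fix x assume "x \<in> ?A"
    then obtain b X where x: "x = (b, X)" and b: "b \<in> signed_submsets \<beta> m (count \<alpha> (Suc n))"
      and X: "X \<in> pair_multisets \<alpha> n (\<beta> - abs_mset b)" by auto
    have "int (Suc n) \<notin># image_mset fst X"
      using X by (force simp: pair_multisets_def)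
    then have "count (image_mset fst X) (int (Suc n)) = 0" by (simp only: not_in_iff)
    then have "count (image_mset fst (?f x)) (int i) = count \<alpha> i" if "i \<le> Suc n" for i
      using that X b by (cases "i = Suc n")
        (auto simp: x pair_multisets_def signed_submsets_def not_in_iff multiset.map_comp comp_def image_mset_const_eq)
    moreover have "abs_mset (image_mset snd (?f x)) = \<beta>"
      using X b by (simp add: x pair_multisets_def signed_submsets_def multiset.map_comp comp_def)
    moreover have "\<forall>z\<in>#?f x. (0, 0) \<le> z \<and> fst z \<le> int (Suc n)"
      using X by (force simp: x pair_multisets_def less_eq_prod_def)
    ultimately show "?f x \<in> ?B" by (simp add: pair_multisets_def)
  qed
  show "?g ` ?B \<subseteq> ?A"
  proof (intro image_subsetI)
    fix X assume X: "X \<in> ?B"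
    define b where "b = image_mset snd (filter_mset (\<lambda>z. fst z = int (Suc n)) X)"
    define Y where "Y = filter_mset (\<lambda>z. fst z \<noteq> int (Suc n)) X"
    have XY: "X = Y + image_mset (\<lambda>j. (int (Suc n), j)) b"
      unfolding b_def Y_def row by (simp add: multiset_partition[symmetric] add.commute)
    have \<beta>_eq: "\<beta> = abs_mset (image_mset snd Y) + abs_mset b"
      using X by (simp add: pair_multisets_def XY multiset.map_comp comp_def)
    have "count (image_mset fst Y) (int i) = count (image_mset fst X) (int i)" if "i \<le> n" for i
      using that by (simp add: XY multiset.map_comp comp_def image_mset_const_eq)
    moreover have "\<forall>z\<in>#Y. (0, 0) \<le> z \<and> fst z \<le> int n"
    proof
      fix z assume "z \<in># Y"
      then have "z \<in># X" "fst z \<noteq> int (Suc n)" by (auto simp: Y_def)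
      moreover have "(0, 0) \<le> z" "fst z \<le> int (Suc n)" 
        using X \<open>z \<in># X\<close> by (auto simp: pair_multisets_def)
      ultimately show "(0, 0) \<le> z \<and> fst z \<le> int n" by auto
    qed
    ultimately have "Y \<in> pair_multisets \<alpha> n (\<beta> - abs_mset b)"
      using X by (simp add: pair_multisets_def \<beta>_eq)
    moreover have "size b = count \<alpha> (Suc n)"
    proof -
      have "size b = count (image_mset fst X) (int (Suc n))"
        by (simp add: b_def count_size_filter_image)
      then show ?thesis using X unfolding pair_multisets_def by (simp del: of_nat_Suc)
    qed
    moreover have "nat \<bar>j\<bar> \<le> m" if "j \<in># b" for j
    proof (rule \<beta>)
      show "nat \<bar>j\<bar> \<in># \<beta>" unfolding \<beta>_eq using that by (auto simp: abs_mset_def)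
    qed
    moreover have "abs_mset b \<subseteq># \<beta>" by (simp add: \<beta>_eq)
    ultimately have "(b, Y) \<in> ?A" by (auto simp: signed_submsets_def)
    then show "?g X \<in> ?A" by (simp add: b_def Y_def)
  qed
qed

lemma strip_chains_one_row:
  "strip_chains \<beta> m (one_row a) = (if a = (\<Sum>j\<le>m. count \<beta> j) then 1 else 0)"
proof (induction m arbitrary: a)
  case (Suc m)
  define c where "c = count \<beta> (Suc m)"
  have "strips_below (one_row a) c = (if c \<le> a then {one_row (a - c)} else {})"
    using bipartition_one_row by (auto simp: strips_below_def strip_one_row_iff)
  then show ?case by (auto simp: c_def[symmetric] Suc.IH)
qed auto

text \<open>
  Cauchy identity for strip chains: both sides satisfy the same recursion in \<open>n\<close>. On
  the left the last step of the \<open>\<alpha>\<close>-chain is moved through the \<open>\<beta>\<close>-chain by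
  \<open>sum_strip_chains_above\<close>, and on the right the last row is split off.
\<close>

theorem sum_strip_chains_product:
  assumes "\<And>j. j \<in># \<beta> \<Longrightarrow> j \<le> m"
  shows "(\<Sum>S\<in>bipartitions_of (\<Sum>i\<le>n. count \<alpha> i). strip_chains \<alpha> n S * strip_chains \<beta> m S)
    = card (pair_multisets \<alpha> n \<beta>)"
  using assms
proof (induction n arbitrary: \<beta>)
  case 0
  have "(\<Sum>j\<le>m. count \<beta> j) = size \<beta>"
    unfolding size_multiset_overloaded_eq
    by (rule sum.mono_neutral_right) (use 0 in \<open>auto simp: not_in_iff\<close>)
  moreover have "(\<Sum>S\<in>bipartitions_of (count \<alpha> 0). strip_chains \<alpha> 0 S * strip_chains \<beta> m S)
      = (\<Sum>S\<in>bipartitions_of (count \<alpha> 0). if S =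
        one_row (count \<alpha> 0) then strip_chains \<beta> m S else 0)"
    by (rule sum.cong) auto
  moreover have "one_row (count \<alpha> 0) \<in> bipartitions_of (count \<alpha> 0)"
    by (simp add: bipartitions_of_def bipartition_one_row)
  ultimately show ?case
    by (simp add: finite_bipartitions_of strip_chains_one_row pair_multisets_0)
next
  case (Suc n)
  define a where "a = count \<alpha> (Suc n)"
  define t where "t = (\<Sum>i\<le>n. count \<alpha> i)"
  have t: "(\<Sum>i\<le>Suc n. count \<alpha> i) = t + a" by (simp add: t_def a_def)
  have "(\<Sum>S\<in>bipartitions_of (t + a). strip_chains \<alpha> (Suc n) S * strip_chains \<beta> m S)
      = (\<Sum>S\<in>bipartitions_of (t + a). \<Sum>H\<in>{H \<in> bipartitions_of t. strip H S}. strip_chains \<alpha> n H * strip_chains \<beta> m S)"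
  proof (rule sum.cong[OF refl])
    fix S assume "S \<in> bipartitions_of (t + a)"
    then have "strips_below S a = {H \<in> bipartitions_of t. strip H S}"
      by (auto simp: strips_below_def bipartitions_of_def)
    then show "strip_chains \<alpha> (Suc n) S * strip_chains \<beta> m S
        = (\<Sum>H\<in>{H \<in> bipartitions_of t. strip H S}. strip_chains \<alpha> n H * strip_chains \<beta> m S)"
      by (simp add: a_def[symmetric] sum_distrib_right)
  qed
  also have "\<dots> =
    (\<Sum>H\<in>bipartitions_of t. \<Sum>S\<in>{S \<in> bipartitions_of (t + a). strip H S}. strip_chains \<alpha> n H * strip_chains \<beta> m S)"
    by (rule sum.swap_restrict) (simp_all add: finite_bipartitions_of)
  also have "\<dots> =
    (\<Sum>H\<in>bipartitions_of t. strip_chains \<alpha> n H * (\<Sum>b\<in>signed_submsets \<beta> m a. strip_chains (\<beta> - abs_mset b) m H))"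
  proof (rule sum.cong[OF refl])
    fix H assume H: "H \<in> bipartitions_of t"
    have "{S \<in> bipartitions_of (t + a). strip H S} = strips_above H a"
      using H by (auto simp: strips_above_def bipartitions_of_def)
    then show "(\<Sum>S\<in>{S \<in> bipartitions_of (t + a). strip H S}. strip_chains \<alpha> n H * strip_chains \<beta> m S)
        = strip_chains \<alpha> n H * (\<Sum>b\<in>signed_submsets \<beta> m a. strip_chains (\<beta> - abs_mset b) m H)"
      using sum_strip_chains_above[of H \<beta> m a] H
      by (simp add: sum_distrib_left[symmetric] bipartitions_of_def)
  qed
  also have "\<dots> =
    (\<Sum>b\<in>signed_submsets \<beta> m a. \<Sum>H\<in>bipartitions_of t. strip_chains \<alpha> n H * strip_chains (\<beta> - abs_mset b) m H)"
    unfolding sum_distrib_left by (rule sum.swap)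
  also have "\<dots> =
    (\<Sum>b\<in>signed_submsets \<beta> m a. card (pair_multisets \<alpha> n (\<beta> - abs_mset b)))"
    unfolding t_def by (intro sum.cong refl Suc.IH) (use Suc.prems in \<open>auto dest: in_diffD\<close>)
  also have "\<dots> = card (SIGMA b:signed_submsets \<beta> m a. pair_multisets \<alpha> n (\<beta> - abs_mset b))"
    by simp
  also have "\<dots> = card (pair_multisets \<alpha> (Suc n) \<beta>)"
    unfolding a_def by (rule bij_betw_same_card[OF pair_multisets_Suc[OF Suc.prems]])
  finally show ?case by (simp only: t)
qed

section \<open>Bead configurations of pairs of partitions\<close>

text \<open>
  The position of the bead that stands for row \<open>i\<close> of component \<open>e\<close> if this row has length \<open>k\<close>. For the
  empty pair the odd beads are at \<open>- 1, - 3, \<dots>\<close> and the even ones at \<open>- 2, - 4, \<dots>\<close>.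
\<close>

definition bead :: "bool \<Rightarrow> nat \<Rightarrow> nat \<Rightarrow> int"
  where "bead e i k = 2 * (int k - int i) - (if e then 2 else 1)"

definition beads :: "(bool \<Rightarrow> nat \<Rightarrow> nat) \<Rightarrow> int set"
  where "beads S = {bead e i (S e i) | e i. True}"

definition move :: "int set \<Rightarrow> int \<Rightarrow> int set"
  where "move B p = insert (p + 2) (B - {p})"

definition movable :: "int set \<Rightarrow> int \<Rightarrow> bool"
  where "movable B p \<longleftrightarrow> p \<in> B \<and> p + 2 \<notin> B"

fun path :: "int set \<Rightarrow> int list \<Rightarrow> int set \<Rightarrow> bool" where
  "path B [] B' \<longleftrightarrow> B = B'"
| "path B (p # ps) B' \<longleftrightarrow> movable B p \<and> path (move B p) ps B'"

lemma path_append: "path B (ps @ qs) B' \<longleftrightarrow> (\<exists>C. path B ps C \<and> path C qs B')"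
  by (induction ps arbitrary: B) auto

lemma path_unique: "path B ps C \<Longrightarrow> path B ps C' \<Longrightarrow> C = C'"
  by (induction ps arbitrary: B) auto

text \<open>
  A strictly decreasing sequence can be recovered from its range, hence a partition from its beads.
\<close>

lemma strict_decreasing_range_eq:
  fixes f g :: "nat \<Rightarrow> int"
  assumes f: "\<And>i j. i < j \<Longrightarrow> f j < f i" and g: "\<And>i j. i < j \<Longrightarrow> g j < g i"
    and r: "range f = range g"
  shows "f = g"
proof
  fix i
  show "f i = g i"
  proof (induction i rule: less_induct)
    case (less i)
    have le: "a i \<le> b i" if a: "\<And>i j. i < j \<Longrightarrow>
      a j < a i" and b: "\<And>i j. i < j \<Longrightarrow> b j < b i"
      and r: "range a \<subseteq> range b" and eq: "\<And>j. j < i \<Longrightarrow>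
        a j = b j" for a b :: "nat \<Rightarrow> int"
    proof -
      obtain k where k: "a i = b k" using r by blast
      have "\<not> k < i" using a[of k i] eq[of k] k by auto
      then show ?thesis using b[of i k] k by (cases "i = k") auto
    qed
    show ?case
    proof (rule antisym)
      show "f i \<le> g i" using le[of f g] f g r less by simp
      show "g i \<le> f i" using le[of g f] f g r less by simp
    qed
  qed
qed

lemma bead_eq_iff: "bead e i k = bead e' i' k' \<longleftrightarrow> e = e' \<and> int k - int i = int k' - int i'"
  unfolding bead_def by (cases e; cases e'; simp; presburger)

lemma beads_inject:
  assumes "bipartition S" "bipartition S'" "beads S = beads S'"
  shows "S = S'"
proof
  fix e
  have dec: "int (T e j) - int j < int (T e i) - int i" if "bipartition T" "i < j" for T i j
    using is_partitionD[of "T e" i j] that by (auto simp: bipartition_def)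
  have "x \<in> range (\<lambda>i. int (T e i) - int i) \<longleftrightarrow>
    2 * x - (if e then 2 else 1) \<in> beads T" for x T
  proof -
    have "2 * x - (if e then 2 else 1) = bead e' i (T e' i) \<longleftrightarrow>
      e' = e \<and> x = int (T e i) - int i" for e' i
      unfolding bead_def by (cases e; cases e'; simp; presburger)
    then show ?thesis by (auto simp: beads_def)
  qed
  then have "range (\<lambda>i. int (S e i) - int i) = range (\<lambda>i. int (S' e i) - int i)"
    using assms(3) by blast
  then have "(\<lambda>i. int (S e i) - int i) = (\<lambda>i. int (S' e i) - int i)"
    using strict_decreasing_range_eq[of "\<lambda>i. int (S e i) - int i" "\<lambda>i. int (S' e i) - int i"]
      dec assms(1,2) by blast
  then show "S e = S' e" by (auto simp: fun_eq_iff)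
qed

definition increment :: "(bool \<Rightarrow> nat \<Rightarrow> nat) \<Rightarrow> bool \<Rightarrow> nat \<Rightarrow> bool \<Rightarrow> nat \<Rightarrow> nat"
  where "increment S e i = S(e := (S e)(i := S e i + 1))"

definition corner :: "(bool \<Rightarrow> nat \<Rightarrow> nat) \<Rightarrow> bool \<Rightarrow> nat \<Rightarrow> bool"
  where "corner S e i \<longleftrightarrow> i = 0 \<or> S e i < S e (i - 1)"

text \<open>
  The place \<open>p + 2\<close> above a bead is occupied only by the bead of the preceding row of the same
  component, and this happens when both rows have equal length.
\<close>

lemma movable_beads_iff:
  assumes "bipartition S"
  shows "movable (beads S) p \<longleftrightarrow> (\<exists>e i. p = bead e i (S e i) \<and> corner S e i)"
proof -
  have h: "bead e i (S e i) + 2 \<in> beads S \<longleftrightarrow> \<not> corner S e i" for e i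
  proof -
    have dec: "S e k \<le> S e j" if "j \<le> k" for j k
      using is_partitionD[of "S e" j k] that assms by (auto simp: bipartition_def)
    have "bead e i (S e i) + 2 = bead e i (Suc (S e i))" by (simp add: bead_def)
    also have "\<dots> \<in> beads S \<longleftrightarrow>
      (\<exists>j. int (Suc (S e i)) - int i = int (S e j) - int j)"
      by (auto simp: beads_def bead_eq_iff)
    also have "\<dots> \<longleftrightarrow> \<not> corner S e i"
    proof
      assume "\<exists>j. int (Suc (S e i)) - int i = int (S e j) - int j"
      then obtain j where j: "int (Suc (S e i)) - int i = int (S e j) - int j" by blast
      have "j < i" using dec[of i j] j by linarith
      moreover have "\<not> S e i < S e (i - 1)" using dec[of j "i - 1"] j \<open>j < i\<close> 
        using dec[of "i - 1" i] by linarith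
      ultimately show "\<not> corner S e i" by (simp add: corner_def)
    next
      assume "\<not> corner S e i"
      then have "i > 0" "S e i = S e (i - 1)" using dec[of "i - 1" i] by (auto simp: corner_def)
      then show "\<exists>j. int (Suc (S e i)) - int i = int (S e j) - int j"
        by (intro exI[of _ "i - 1"]) auto
    qed
    finally show ?thesis .
  qed
  have "movable (beads S) p \<longleftrightarrow>
    (\<exists>e i. p = bead e i (S e i) \<and> bead e i (S e i) + 2 \<notin> beads S)"
    unfolding movable_def by (subst (1) beads_def) blast
  then show ?thesis by (simp add: h)
qed

lemma increment:
  assumes "bipartition S" "corner S e i"
  shows "beads (increment S e i) = move (beads S) (bead e i (S e i))"
    and "bipartition (increment S e i)"
    and "bsize (increment S e i) = bsize S + 1"
proof -
  have p: "is_partition (S e')" for e' using assms(1) by (simp add: bipartition_def)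
  have inj: "bead e' j (S e' j) = bead e'' k (S e'' k) \<longleftrightarrow> e' = e'' \<and> j = k" for e' e'' j k
    using is_partitionD[OF p, of j k e'] is_partitionD[OF p, of k j e']
    by (cases "e' = e''"; cases j k rule: linorder_cases) (auto simp: bead_eq_iff)
  have b: "bead e' j (increment S e i e' j) = (if e' = e \<and> j =
    i then bead e i (S e i) + 2 else bead e' j (S e' j))" for e' j
    by (auto simp: increment_def bead_def)
  show "beads (increment S e i) = move (beads S) (bead e i (S e i))"
    unfolding beads_def move_def b by (auto simp: inj)
  obtain L0 where L0: "\<And>j. j \<ge> L0 \<Longrightarrow> S e j = 0" using is_partition_bound[OF p] by blast
  have "is_partition ((S e)(i := S e i + 1))"
  proof (rule is_partitionI[where L = "max L0 (Suc i)"])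
    fix j
    show "((S e)(i := S e i + 1)) (Suc j) \<le> ((S e)(i := S e i + 1)) j"
      using assms(2) is_partitionD[OF p, of j "Suc j" e] by (auto simp: corner_def)
  qed (use L0 in auto)
  then show "bipartition (increment S e i)"
    using p by (simp add: bipartition_def increment_def)
  show "bsize (increment S e i) = bsize S + 1"
    using psize_fun_upd[OF is_partition_zeros[OF p[of e]], of i 1] by (cases e) (simp_all add: bsize_def increment_def)
qed

lemma path_beads:
  assumes "bipartition S" "path (beads S) ps B"
  shows "\<exists>S'. bipartition S' \<and> B = beads S' \<and> bsize S' = bsize S + length ps"
  using assms
proof (induction ps arbitrary: S)
  case (Cons p ps)
  then obtain e i where p: "p = bead e i (S e i)" "corner S e i"
    using movable_beads_iff by auto
  show ?case
    using Cons.IH[of "increment S e i"] Cons.prems increment[OF Cons.prems(1) p(2)] p(1) by auto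
qed auto

text \<open>
  The places from which beads are moved when \<open>S\<close> is transformed into \<open>S'\<close>. They are pairwise distinct if
  \<open>S\<close> and \<open>S'\<close> interlace.
\<close>

definition moved :: "(bool \<Rightarrow> nat \<Rightarrow> nat) \<Rightarrow> (bool \<Rightarrow> nat \<Rightarrow> nat) \<Rightarrow> int set"
  where "moved S S' = {bead e i k | e i k. S e i \<le> k \<and> k < S' e i}"

text \<open>
  If the places are visited in increasing order, then a bead cannot reach a place that was
  occupied initially: the bead there leaves only after it, and moves only upwards. This is the
  interlacing condition.
\<close>

lemma sorted_path_strip:
  assumes "bipartition S" "bipartition S'" "path (beads S) ps (beads S')" "sorted ps"
  shows "strip S S' \<and> set ps = moved S S' \<and> distinct ps"
  using assms(2-)
proof (induction ps arbitrary: S' rule: rev_induct)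
  case Nil
  then have "S = S'" using beads_inject assms(1) by auto
  then show ?case using is_partitionD assms(1)
    by (fastforce simp: strip_def moved_def bipartition_def)
next
  case (snoc p ps)
  from snoc.prems(2) obtain C where C: "path (beads S) ps C" "movable C p" "move C p = beads S'"
    by (auto simp: path_append)
  obtain T where T: "bipartition T" "C = beads T" using path_beads[OF assms(1) C(1)] by blast
  have IH: "strip S T" "set ps = moved S T" "distinct ps"
    using snoc.IH[OF T(1)] C(1) T(2) snoc.prems(3) by (auto simp: sorted_append)
  obtain e i where p: "p = bead e i (T e i)" "corner T e i"
    using movable_beads_iff T C(2) by auto
  have S': "S' = increment T e i"
    using beads_inject[OF snoc.prems(1) increment(2)[OF T(1) p(2)]] increment(1)[OF T(1) p(2)] C(3) T(2) p(1)
    by simp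
  have ge: "q \<le> p" if "q \<in> moved S T" for q
    using snoc.prems(3) IH(2) that by (auto simp: sorted_append)
  have st: "S e' j \<le> T e' j" "T e' (Suc j) \<le> S e' j" for e' j
    using IH(1) by (auto simp: strip_def)
  have dec: "T e' k \<le> T e' j" "S e' k \<le> S e' j" if "j \<le> k" for e' j k
    using that is_partitionD T(1) assms(1) by (auto simp: bipartition_def)
  \<comment> \<open>Otherwise the preceding row has grown before, and the place of its last move is larger than \<open>p\<close>.\<close>
  have key: "T e i < S e (i - 1)" if "i > 0"
  proof (rule ccontr)
    assume "\<not> T e i < S e (i - 1)"
    moreover have "T e i < T e (i - 1)" using p(2) that by (simp add: corner_def)
    ultimately have "bead e (i - 1) (T e (i - 1) - 1) \<in> moved S T" 
      unfolding moved_def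
      by (intro CollectI exI[of _ e] exI[of _ "i - 1"] exI[of _ "T e (i - 1) - 1"] conjI) auto
    from ge[OF this] have "bead e (i - 1) (T e (i - 1) - 1) \<le> p" .
    then show False using \<open>T e i < T e (i - 1)\<close> that by (auto simp: p(1) bead_def)
  qed
  have "p \<notin> moved S T"
  proof
    assume "p \<in> moved S T"
    then obtain j k where jk: "int k - int j = int (T e i) - int i" "S e j \<le> k" "k < T e j"
      by (auto simp: moved_def p(1) bead_eq_iff)
    consider "j < i" | "j = i" | "j > i" by linarith
    then show False
    proof cases
      case 1
      then have "S e (i - 1) \<le> S e j" by (intro dec) auto
      then show False using key 1 jk by linarith
    next
      case 3
      then show False using dec(1)[of i j e] jk by linarith
    qed (use jk in auto)
  qed
  moreover have "moved S S' = insert p (moved S T)"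
  proof -
    have "S e' j \<le> k \<and> k < S' e' j \<longleftrightarrow>
      (S e' j \<le> k \<and> k < T e' j) \<or> (e' = e \<and> j = i \<and> k = T e i)" for e' j k
      using st[of e i] by (auto simp: S' increment_def)
    then show ?thesis unfolding moved_def p(1) by auto
  qed
  moreover have "strip S S'"
    unfolding strip_def
  proof (intro allI conjI)
    fix e' j
    show "S e' j \<le> S' e' j" using st[of e' j] by (auto simp: S' increment_def)
    show "S' e' (Suc j) \<le> S e' j" using st[of e' j] key by (auto simp: S' increment_def)
  qed
  ultimately show ?case using IH by auto
qed

lemma finite_moved:
  assumes "bipartition S'"
  shows "finite (moved S S')"
proof -
  obtain L1 where L1: "\<And>i. i \<ge> L1 \<Longrightarrow> S' True i = 0"
    using assms is_partition_bound[of "S' True"] unfolding bipartition_def by blast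
  obtain L2 where L2: "\<And>i. i \<ge> L2 \<Longrightarrow> S' False i = 0"
    using assms is_partition_bound[of "S' False"] unfolding bipartition_def by blast
  define L where "L = max L1 L2"
  have L: "i < L" if "S' e i > 0" for e i
  proof (rule ccontr)
    assume "\<not> i < L"
    then have "i \<ge> L1" "i \<ge> L2" by (auto simp: L_def)
    then show False using L1[of i] L2[of i] that by (cases e) auto
  qed
  have "moved S S' \<subseteq> (\<Union>e. \<Union>i\<in>{..<L}. bead e i ` {..<S' e i})"
  proof
    fix q assume "q \<in> moved S S'"
    then obtain e i k where q: "q = bead e i k" "k < S' e i" by (auto simp: moved_def)
    then have "i < L" using L[of e i] by simp
    then show "q \<in> (\<Union>e. \<Union>i\<in>{..<L}. bead e i ` {..<S' e i})" using q by blast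
  qed
  then show ?thesis by (rule finite_subset) auto
qed

text \<open>
  Conversely, the largest place to be visited belongs to the last move of its bead, and undoing this
  move leaves an interlacing pair.
\<close>

lemma strip_path:
  assumes "bipartition S" "bipartition S'" "strip S S'"
  shows "path (beads S) (sorted_list_of_set (moved S S')) (beads S')"
  using assms(2,3)
proof (induction "bsize S' - bsize S" arbitrary: S' rule: less_induct)
  case less
  show ?case
  proof (cases "moved S S' = {}")
    case True
    have "S e i = S' e i" for e i
    proof (rule ccontr)
      assume "S e i \<noteq> S' e i"
      then have "S e i < S' e i" using less.prems(2) by (auto simp: strip_def le_neq_implies_less)
      then have "bead e i (S e i) \<in> moved S S'" unfolding moved_def by blast
      then show False using True by blast
    qed
    then have "S = S'" by (intro ext)
    then show ?thesis using True by simp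
  next
    case False
    define p where "p = Max (moved S S')"
    have pin: "p \<in> moved S S'" and pmax: "\<And>q. q \<in> moved S S' \<Longrightarrow> q \<le> p"
      using False finite_moved[OF less.prems(1)] by (auto simp: p_def)
    from pin obtain e i k where p: "p = bead e i k" "S e i \<le> k" "k < S' e i"
      by (auto simp: moved_def)
    have k: "S' e i = Suc k"
    proof (rule ccontr)
      assume "S' e i \<noteq> Suc k"
      then have "bead e i (Suc k) \<in> moved S S'" using p unfolding moved_def
        by (intro CollectI exI[of _ e] exI[of _ i] exI[of _ "Suc k"] conjI) auto
      from pmax[OF this] show False by (simp add: p(1) bead_def)
    qed
    define T where "T = S'(e := (S' e)(i := k))"
    have st: "S e' j \<le> S' e' j" "S' e' (Suc j) \<le> S e' j" for e' j
      using less.prems(2) by (auto simp: strip_def)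
    have dec: "S' e' (Suc j) \<le> S' e' j" for e' j
      using is_partitionD less.prems(1) by (auto simp: bipartition_def)
    have S'T: "S' = increment T e i" by (auto simp: T_def increment_def k fun_eq_iff)
    have "bipartition T"
      unfolding bipartition_def
    proof
      fix e'
      obtain L where L: "\<And>j. j \<ge> L \<Longrightarrow> S' e' j = 0"
        using less.prems(1) is_partition_bound[of "S' e'"] unfolding bipartition_def by blast
      have "i < L" if "e' = e" using L[of i] k that by (cases "i < L") auto
      then have "T e' j = 0" if "j \<ge> L" for j
        using L[OF that] that by (auto simp: T_def)
      moreover have "T e' (Suc j) \<le> T e' j" for j
      proof -
        have "S' e i = Suc k" "S' e (Suc i) \<le> k" using k st(2)[of e i] p(2) by auto
        then show ?thesis
          using dec[of e' j] unfolding T_def by (cases "e' = e"; cases "j = i"; cases "Suc j = i"; simp)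
      qed
      ultimately show "is_partition (T e')" by (rule is_partitionI[rotated])
    qed
    have Ti: "T e' j = (if e' = e \<and> j = i then k else S' e' j)" for e' j
      by (simp add: T_def)
    have corner: "corner T e i"
    proof (cases i)
      case (Suc h)
      have "S' e (Suc h) \<le> S' e h" using st(2)[of e h] st(1)[of e h] by (rule order.trans)
      then have "k < S' e h" unfolding k[unfolded Suc] by (simp only: Suc_le_eq)
      moreover have "T e (Suc h) = k" "T e h = S' e h" unfolding Ti Suc by simp_all
      ultimately show ?thesis unfolding corner_def Suc by simp
    qed (simp add: corner_def)
    have sT: "strip S T"
      unfolding strip_def
    proof (intro allI conjI)
      fix e' j
      show "S e' j \<le> T e' j" using st(1)[of e' j] p(2) by (simp add: Ti)
      have "T e' (Suc j) \<le> S' e' (Suc j)" using k by (simp add: Ti)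
      then show "T e' (Suc j) \<le> S e' j" using st(2)[of e' j] by (rule order.trans)
    qed
    have size: "bsize S' = bsize T + 1" using increment(3)[OF \<open>bipartition T\<close> corner] S'T by simp
    have "bsize S \<le> bsize T" using strip_bsize_le[OF \<open>bipartition T\<close> sT] .
    then have "bsize T - bsize S < bsize S' - bsize S" using size by linarith
    then have IH: "path (beads S) (sorted_list_of_set (moved S T)) (beads T)"
      using \<open>bipartition T\<close> sT by (rule less.hyps)
    have pT: "p = bead e i (T e i)" by (simp add: p(1) Ti)
    have step: "movable (beads T) p" "move (beads T) p = beads S'"
    proof -
      show "movable (beads T) p"
        unfolding movable_beads_iff[OF \<open>bipartition T\<close>] using corner pT by blast
      show "move (beads T) p = beads S'"
        by (simp only: S'T pT increment(1)[OF \<open>bipartition T\<close> corner])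
    qed
    have sub: "moved S T \<subseteq> moved S S'"
    proof -
      have "T e' j \<le> S' e' j" for e' j using k by (simp add: Ti)
      then show ?thesis unfolding moved_def by (blast intro: less_le_trans)
    qed
    let ?qs = "sorted_list_of_set (moved S T) @ [p]"
    have path: "path (beads S) ?qs (beads S')" using IH step by (auto simp: path_append)
    moreover have sorted: "sorted ?qs"
      using pmax sub finite_moved[OF \<open>bipartition T\<close>] by (auto simp: sorted_append)
    ultimately have "set ?qs = moved S S'" "distinct ?qs"
      using sorted_path_strip[OF assms(1) less.prems(1)] by blast+
    then have "?qs = sorted_list_of_set (moved S S')"
      using sorted by (metis sorted_list_of_set.idem_if_sorted_distinct)
    then show ?thesis using path by simp
  qed
qed

lemma sorted_path_iff:
  assumes "bipartition S" "bipartition S'"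
  shows "path (beads S) ps (beads S') \<and> sorted ps \<longleftrightarrow>
    strip S S' \<and> ps = sorted_list_of_set (moved S S')"
  using sorted_path_strip[OF assms] strip_path[OF assms]
  by (metis sorted_list_of_set.idem_if_sorted_distinct sorted_list_of_set.sorted_sorted_key_list_of_set)


text \<open>
  The bead configuration of the empty pair, and also of the empty partition.
\<close>

definition vacuum :: "int set" where "vacuum = {p. p < 0}"

lemma beads_one_row_0: "beads (one_row 0) = vacuum"
proof -
  have zero: "one_row 0 e i = 0" for e i by (simp add: one_row_def)
  have "p \<in> vacuum \<longleftrightarrow> (\<exists>e i. p = bead e i 0)" for p
  proof
    assume "p \<in> vacuum"
    then have "int (nat (- p - 1) div 2) = (- p - 1) div 2"
      by (simp add: vacuum_def zdiv_int)
    moreover have "p = 2 * (0 - (- p - 1) div 2) - (if even p then 2 else 1)"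
      by (cases "even p"; simp only: if_True if_False; presburger)
    ultimately have "p = bead (even p) (nat (- p - 1) div 2) 0"
      by (simp add: bead_def)
    then show "\<exists>e i. p = bead e i 0" by blast
  qed (auto simp: vacuum_def bead_def)
  then show ?thesis unfolding beads_def zero by blast
qed

fun content_word :: "nat multiset \<Rightarrow> nat \<Rightarrow> nat list" where
  "content_word \<beta> 0 = replicate (count \<beta> 0) 0"
| "content_word \<beta> (Suc m) = content_word \<beta> m @ replicate (count \<beta> (Suc m)) (Suc m)"

text \<open>
  The positions \<open>ps\<close> are weakly increasing along each block of equal letters of \<open>w\<close>. The additional entry
  \<open>(0, - 1)\<close> in front forces positions \<open>\<ge> - 1\<close> in the block of the letter \<open>0\<close>.
\<close>

definition blockwise_sorted :: "nat list \<Rightarrow> int list \<Rightarrow> bool"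
  where "blockwise_sorted w ps \<longleftrightarrow> length ps = length w \<and>
    successively (\<lambda>(i, p) (j, q). i = j \<longrightarrow> p \<le> q) ((0, - 1) # zip w ps)"

lemma content_word_le: "i \<in> set (content_word \<beta> m) \<Longrightarrow> i \<le> m"
  by (induction m) auto

lemma successively_le_iff_sorted: "successively (\<le>) (ps :: int list) \<longleftrightarrow> sorted ps"
  by (rule successively_conv_sorted_wrt) (auto simp: transp_def)

lemma blockwise_sorted_replicate_0:
  "blockwise_sorted (replicate c 0) ps \<longleftrightarrow> length ps = c \<and> sorted (- 1 # ps)"
proof (cases "length ps = c")
  case True
  have "(0, - 1) # zip (replicate c 0) ps = map (Pair (0::nat)) (- 1 # ps)"
    using True by (simp add: zip_replicate1)
  then show ?thesis
    unfolding blockwise_sorted_def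
    by (simp only: successively_map prod.case simp_thms True length_replicate successively_le_iff_sorted)
qed (simp add: blockwise_sorted_def)

lemma blockwise_sorted_append:
  assumes "\<And>i. i \<in> set w \<Longrightarrow> i < n" "n > 0" "length ps = length w"
  shows "blockwise_sorted (w @ replicate a n) (ps @ qs) \<longleftrightarrow>
    blockwise_sorted w ps \<and> length qs = a \<and> sorted qs"
proof (cases "length qs = a")
  case True
  let ?R = "\<lambda>(i, p) (j, q). i = j \<longrightarrow> p \<le> q"
  have 1: "((0, - 1) # zip (w @ replicate a n) (ps @ qs)) = ((0, - 1) # zip w ps) @ map (Pair n) qs"
    using True assms(3) by (simp add: zip_replicate1)
  have "successively ?R (map (Pair n) qs) \<longleftrightarrow> sorted qs"
    by (simp only: successively_map prod.case simp_thms successively_le_iff_sorted)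
  moreover have "fst (last ((0, - 1) # zip w ps)) < n"
  proof (cases "zip w ps = []")
    case False
    then have "last (zip w ps) \<in> set (zip w ps)" by (rule last_in_set)
    then have "fst (last (zip w ps)) \<in> set w"
      using set_zip_leftD[of "fst (last (zip w ps))" "snd (last (zip w ps))" w ps] by simp
    then show ?thesis using assms(1) False by simp
  qed (use assms(2) in simp)
  then have "?R (last ((0, - 1) # zip w ps)) (hd (map (Pair n) qs))" if "qs \<noteq> []"
    using that by (cases qs) (auto simp: case_prod_beta)
  ultimately have "successively ?R (((0, - 1) # zip w ps) @ map (Pair n) qs) \<longleftrightarrow>
      successively ?R ((0, - 1) # zip w ps) \<and> sorted qs"
    unfolding successively_append_iff by auto
  then show ?thesis
    unfolding blockwise_sorted_def 1 using True assms(3) by simp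
qed (use assms(3) in \<open>auto simp: blockwise_sorted_def\<close>)

definition content_paths :: "nat multiset \<Rightarrow> nat \<Rightarrow> (bool \<Rightarrow> nat \<Rightarrow> nat) \<Rightarrow> int list set"
  where "content_paths \<beta> m S =
    {ps. path vacuum ps (beads S) \<and> blockwise_sorted (content_word \<beta> m) ps}"

text \<open>
  Starting from the empty pair, increasing moves fill the first rows of the two components. If all
  positions are at least \<open>- 1\<close>, then the bead at \<open>- 2\<close> does not move, and the even component stays empty.
\<close>

lemma content_paths_0:
  assumes "bipartition S"
  shows "content_paths \<beta> 0 S =
    (if S = one_row (count \<beta> 0) then {sorted_list_of_set (moved (one_row 0) S)} else {})"
proof -
  have "ps \<in> content_paths \<beta> 0 S \<longleftrightarrow>
      S = one_row (count \<beta> 0) \<and> ps = sorted_list_of_set (moved (one_row 0) S)" for ps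
  proof -
    have "ps \<in> content_paths \<beta> 0 S \<longleftrightarrow>
        (path vacuum ps (beads S) \<and> sorted ps) \<and> length ps =
          count \<beta> 0 \<and> (\<forall>p\<in>set ps. - 1 \<le> p)"
      by (auto simp: content_paths_def blockwise_sorted_replicate_0)
    also have "\<dots> \<longleftrightarrow>
      (strip (one_row 0) S \<and> ps = sorted_list_of_set (moved (one_row 0) S)) \<and>
        length ps = count \<beta> 0 \<and> (\<forall>p\<in>moved (one_row 0) S. - 1 \<le> p)"
      using sorted_path_iff[OF bipartition_one_row assms, of 0 ps] finite_moved[OF assms]
      by (auto simp: beads_one_row_0)
    also have "\<dots> \<longleftrightarrow>
      S = one_row (count \<beta> 0) \<and> ps = sorted_list_of_set (moved (one_row 0) S)"
      (is "?l \<longleftrightarrow> ?r")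
    proof
      assume l: ?l
      have "path (beads (one_row 0)) ps (beads S)"
        using sorted_path_iff[OF bipartition_one_row assms, of 0 ps] l by blast
      from path_beads[OF bipartition_one_row this]
      have size: "bsize S = count \<beta> 0" using beads_inject[OF assms] l by auto
      have "S True 0 = 0"
      proof (rule ccontr)
        assume "S True 0 \<noteq> 0"
        then have "bead True 0 0 \<in> moved (one_row 0) S"
          unfolding moved_def
          by (intro CollectI exI[of _ True] exI[of _ 0] conjI) (auto simp: one_row_def)
        then show False using l by (force simp: bead_def)
      qed
      moreover have "S e (Suc i) \<le> one_row 0 e i" for e i
        using l by (simp add: strip_def)
      ultimately have "S e i = one_row (S False 0) e i" for e i
        by (cases i; cases e) (auto simp: one_row_def)
      then have "S = one_row (S False 0)" by (intro ext)
      then show ?r using size l by (metis bsize_one_row)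
    next
      assume r: ?r
      then have "strip (one_row 0) S" by (auto simp: strip_one_row_iff)
      then have "path (beads (one_row 0)) ps (beads S)"
        using sorted_path_iff[OF bipartition_one_row assms, of 0 ps] r by blast
      from path_beads[OF bipartition_one_row this]
      obtain S' where S': "bipartition S'" "beads S = beads S'" "bsize S' = bsize (one_row 0) + length ps"
        by blast
      have "S' = one_row (count \<beta> 0)" using beads_inject[OF assms S'(1,2)] r by simp
      then have "length ps = count \<beta> 0" using S'(3) by simp
      moreover have "\<forall>p\<in>moved (one_row 0) S. - 1 \<le> p"
        using r by (auto simp: moved_def one_row_def bead_def split: if_splits)
      ultimately show ?l using r \<open>strip (one_row 0) S\<close> by auto
    qed
    finally show ?thesis .
  qed
  then show ?thesis by auto
qed

text \<open>
  The last block of an admissible sequence of moves is determined by the two states that it connects.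
\<close>

lemma content_paths_Suc:
  assumes "bipartition S"
  shows "bij_betw (\<lambda>(H, ps). ps @ sorted_list_of_set (moved H S))
    (SIGMA H:strips_below S (count \<beta> (Suc m)). content_paths \<beta> m H) (content_paths \<beta> (Suc m) S)"
    (is "bij_betw ?f ?A ?B")
  unfolding bij_betw_def
proof
  let ?a = "count \<beta> (Suc m)"
  have len: "length ps = length (content_word \<beta> m)" if "ps \<in> content_paths \<beta> m H" for ps H
    using that by (simp add: content_paths_def blockwise_sorted_def)
  have app: "blockwise_sorted (content_word \<beta> (Suc m)) (ps @ qs) \<longleftrightarrow>
      blockwise_sorted (content_word \<beta> m) ps \<and> length qs = ?a \<and> sorted qs"
    if "length ps = length (content_word \<beta> m)" for ps qs
    using blockwise_sorted_append[of "content_word \<beta> m" "Suc m" ps ?a qs] that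
      content_word_le[of _ \<beta> m] by (auto simp: less_Suc_eq_le)
  show "inj_on ?f ?A"
  proof (rule inj_onI, clarify)
    fix H ps H' ps'
    assume H: "H \<in> strips_below S ?a" "ps \<in> content_paths \<beta> m H"
      and H': "H' \<in> strips_below S ?a" "ps' \<in> content_paths \<beta> m H'"
      and eq: "ps @ sorted_list_of_set (moved H S) = ps' @ sorted_list_of_set (moved H' S)"
    have ps: "ps = ps'" using eq len[OF H(2)] len[OF H'(2)] by simp
    have "beads H = beads H'"
      using H(2) H'(2) path_unique unfolding ps content_paths_def by blast
    then show "H = H' \<and> ps = ps'" using ps beads_inject H(1) H'(1) by (auto simp: strips_below_def)
  qed
  show "?f ` ?A = ?B"
  proof (intro equalityI subsetI)
    fix rs assume "rs \<in> ?f ` ?A"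
    then obtain H ps where H: "H \<in> strips_below S ?a" "ps \<in> content_paths \<beta> m H"
      and rs: "rs = ps @ sorted_list_of_set (moved H S)" by auto
    have p: "path (beads H) (sorted_list_of_set (moved H S)) (beads S)"
      by (rule strip_path) (use H assms in \<open>auto simp: strips_below_def\<close>)
    have "length (sorted_list_of_set (moved H S)) = ?a"
      using path_beads[OF _ p] beads_inject[OF assms] H(1) by (fastforce simp: strips_below_def)
    then have "blockwise_sorted (content_word \<beta> (Suc m)) rs"
      unfolding rs app[OF len[OF H(2)]] using H(2) by (simp add: content_paths_def)
    moreover have "path vacuum rs (beads S)"
      using p H(2) by (auto simp: rs path_append content_paths_def)
    ultimately show "rs \<in> ?B" by (simp add: content_paths_def)
  next
    fix rs assume rs: "rs \<in> ?B"
    define ps where "ps = take (length (content_word \<beta> m)) rs"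
    define qs where "qs = drop (length (content_word \<beta> m)) rs"
    have rs_eq: "rs = ps @ qs" by (simp add: ps_def qs_def)
    have "length ps = length (content_word \<beta> m)"
      using rs by (auto simp: ps_def content_paths_def blockwise_sorted_def)
    from app[OF this] have b: "blockwise_sorted (content_word \<beta> m) ps" "length qs = ?a" "sorted qs"
      using rs by (auto simp: content_paths_def rs_eq)
    obtain C where C: "path (beads (one_row 0)) ps C" "path C qs (beads S)"
      using rs by (auto simp: content_paths_def rs_eq path_append beads_one_row_0)
    obtain H where H: "bipartition H" "C = beads H"
      using path_beads[OF bipartition_one_row C(1)] by blast
    have q: "strip H S" "qs = sorted_list_of_set (moved H S)"
      using sorted_path_iff[OF H(1) assms, of qs] C(2) H(2) b(3) by auto
    have "bsize S = bsize H + ?a"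
      using path_beads[OF H(1), of qs "beads S"] C(2) H(2) beads_inject[OF assms] b(2) by auto
    then have "H \<in> strips_below S ?a" using H q by (simp add: strips_below_def)
    moreover have "ps \<in> content_paths \<beta> m H"
      using b C(1) H(2) by (simp add: content_paths_def beads_one_row_0)
    ultimately show "rs \<in> ?f ` ?A" unfolding rs_eq q(2) by force
  qed
qed

theorem strip_chains_eq_card:
  assumes "bipartition S"
  shows "finite (content_paths \<beta> m S) \<and> strip_chains \<beta> m S = card (content_paths \<beta> m S)"
  using assms
proof (induction m arbitrary: S)
  case 0
  then show ?case by (simp add: content_paths_0)
next
  case (Suc m)
  let ?A = "SIGMA H:strips_below S (count \<beta> (Suc m)). content_paths \<beta> m H"
  have IH: "finite (content_paths \<beta> m H)" "strip_chains \<beta> m H = card (content_paths \<beta> m H)"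
    if "H \<in> strips_below S (count \<beta> (Suc m))" for H
    using Suc.IH that by (auto simp: strips_below_def)
  have "finite ?A" using IH by (intro finite_SigmaI) auto
  moreover have "card ?A = strip_chains \<beta> (Suc m) S"
    using IH by (simp add: card_SigmaI)
  ultimately show ?case
    using content_paths_Suc[OF Suc.prems, of \<beta> m] bij_betw_finite bij_betw_same_card by metis
qed

section \<open>Adding a domino as a bead move\<close>

definition young_diagram :: "(nat \<Rightarrow> nat) \<Rightarrow> box set"
  where "young_diagram \<rho> = {(r, c). c < \<rho> r}"

text \<open>
  The bead configuration (Maya diagram) of a single partition, with one bead per row.
\<close>

definition row_beads :: "(nat \<Rightarrow> nat) \<Rightarrow> int set"
  where "row_beads \<rho> = range (\<lambda>r. int (\<rho> r) - int r - 1)"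

definition domino :: "box set \<Rightarrow> bool"
  where "domino d \<longleftrightarrow> horizontal_domino d \<or> vertical_domino d"

text \<open>
  The place from which a bead is moved when the domino \<open>d\<close> is added: one less than the smallest
  content of a box of \<open>d\<close>.
\<close>

definition domino_bead :: "box set \<Rightarrow> int"
  where "domino_bead d = Min ((\<lambda>(r, c). int c - int r) ` d) - 1"

definition adds_domino :: "(nat \<Rightarrow> nat) \<Rightarrow> box set \<Rightarrow> (nat \<Rightarrow> nat) \<Rightarrow> bool"
  where "adds_domino \<rho> d \<rho>' \<longleftrightarrow>
    is_partition \<rho> \<and> is_partition \<rho>' \<and> domino d \<and>
    d \<inter> young_diagram \<rho> = {} \<and> young_diagram \<rho>' = young_diagram \<rho> \<union> d"

lemma lessThan_eqI: "(\<And>x. x < a \<longleftrightarrow> x < b) \<Longrightarrow> a = (b :: nat)"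
  by (metis less_irrefl linorder_neqE_nat)

lemma young_diagram_inject: "young_diagram \<rho> = young_diagram \<rho>' \<Longrightarrow> \<rho> = \<rho>'"
  by (rule ext, rule lessThan_eqI) (auto simp: young_diagram_def set_eq_iff)

lemma row_beads_strict:
  assumes "is_partition \<rho>" "r < s"
  shows "int (\<rho> s) - int s - 1 < int (\<rho> r) - int r - 1"
  using is_partitionD[OF assms(1), of r s] assms(2) by simp

lemma row_beads_inject:
  assumes "is_partition \<rho>" "is_partition \<rho>'" "row_beads \<rho> = row_beads \<rho>'"
  shows "\<rho> = \<rho>'"
proof -
  have "(\<lambda>r. int (\<rho> r) - int r - 1) = (\<lambda>r. int (\<rho>' r) - int r - 1)"
    by (rule strict_decreasing_range_eq)
      (use row_beads_strict assms in \<open>auto simp: row_beads_def\<close>)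
  then show ?thesis by (auto simp: fun_eq_iff)
qed

text \<open>
  An added domino is either placed at the end of a row, or at the end of two adjacent rows of equal
  length.
\<close>

lemma adds_domino_cases [consumes 1, case_names horizontal vertical]:
  assumes "adds_domino \<rho> d \<rho>'"
  obtains m where "d = {(m, \<rho> m), (m, Suc (\<rho> m))}" "\<rho>' = \<rho>(m := \<rho> m + 2)"
  | m where "d = {(m, \<rho> m), (Suc m, \<rho> m)}" "\<rho> (Suc m) = \<rho> m"
    "\<rho>' = \<rho>(m := \<rho> m + 1, Suc m := \<rho> m + 1)"
proof -
  have disj: "\<not> c < \<rho> r" if "(r, c) \<in> d" for r c
    using assms that by (auto simp: adds_domino_def young_diagram_def)
  have rows: "c < \<rho>' r \<longleftrightarrow> c < \<rho> r \<or> (r, c) \<in> d" for r c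
    using assms by (auto simp: adds_domino_def young_diagram_def set_eq_iff)
  consider r c where "d = {(r, c), (r, Suc c)}" | r c where "d = {(r, c), (Suc r, c)}"
    using assms by (auto simp: adds_domino_def domino_def horizontal_domino_def vertical_domino_def)
  then show thesis
  proof cases
    case (1 r c)
    have c: "c = \<rho> r"
      using rows[of "\<rho> r" r] rows[of c r] disj[of r c] by (auto simp: 1)
    have "\<rho>' s = (\<rho>(r := \<rho> r + 2)) s" for s
      by (rule lessThan_eqI) (auto simp: rows 1 c)
    then have "\<rho>' = \<rho>(r := \<rho> r + 2)" by (intro ext)
    then show thesis using that(1)[of r] 1 c by simp
  next
    case (2 r c)
    have c: "c = \<rho> r" "c = \<rho> (Suc r)"
      using rows[of "\<rho> r" r] rows[of c r] disj[of r c]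
        rows[of "\<rho> (Suc r)" "Suc r"] rows[of c "Suc r"] disj[of "Suc r" c] by (auto simp: 2)
    have "\<rho>' s = (\<rho>(r := \<rho> r + 1, Suc r := \<rho> r + 1)) s" for s
      by (rule lessThan_eqI) (use c in \<open>auto simp: rows 2\<close>)
    then have "\<rho>' = \<rho>(r := \<rho> r + 1, Suc r := \<rho> r + 1)" by (intro ext)
    then show thesis using that(2)[of r] 2 c by simp
  qed
qed

lemma domino_bead_horizontal: "domino_bead {(m, c), (m, Suc c)} = int c - int m - 1"
  and domino_bead_vertical: "domino_bead {(m, c), (Suc m, c)} = int c - int m - 2"
  by (simp_all add: domino_bead_def)

text \<open>
  A horizontal domino moves the bead of its row over a free place. A vertical domino increases two
  neighbouring beads by one, which as a set is the move of the lower one over the other.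
\<close>

lemma adds_domino_move:
  assumes "adds_domino \<rho> d \<rho>'"
  shows "movable (row_beads \<rho>) (domino_bead d)"
    and "row_beads \<rho>' = move (row_beads \<rho>) (domino_bead d)"
    and "psize \<rho>' = psize \<rho> + 2"
proof -
  have p: "is_partition \<rho>" "is_partition \<rho>'" using assms by (auto simp: adds_domino_def)
  note dec = is_partitionD[OF p(1)] and dec' = is_partitionD[OF p(2)]
  define x where "x = (\<lambda>r. int (\<rho> r) - int r - 1)"
  have x: "row_beads \<rho> = range x" by (simp add: row_beads_def x_def)
  have inj: "x r = x s \<longleftrightarrow> r = s" for r s
    using row_beads_strict[OF p(1), of r s] row_beads_strict[OF p(1), of s r]
    by (cases r s rule: linorder_cases) (auto simp: x_def)
  have "movable (row_beads \<rho>) (domino_bead d) \<and> row_beads \<rho>' = move (row_beads \<rho>) (domino_bead d)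
      \<and> psize \<rho>' = psize \<rho> + 2"
    using assms
  proof (cases rule: adds_domino_cases)
    case (horizontal m)
    have b: "domino_bead d = x m" by (simp add: horizontal domino_bead_horizontal x_def)
    have x': "int (\<rho>' r) - int r - 1 = (if r = m then x m + 2 else x r)" for r
      by (simp add: horizontal x_def)
    have "x r \<noteq> x m + 2" for r
      using dec'[of r m] dec'[of m r] x'[of r] x'[of m]
      by (cases r m rule: linorder_cases) (auto split: if_splits)
    then have "x m + 2 \<notin> range x" by (metis rangeE)
    then have "movable (row_beads \<rho>) (x m)" by (simp add: movable_def x)
    moreover have "row_beads \<rho>' = move (row_beads \<rho>) (x m)"
      unfolding row_beads_def[of \<rho>'] x' x move_def by (auto simp: inj)
    moreover have "psize \<rho>' = psize \<rho> + 2"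
      using psize_fun_upd[OF is_partition_zeros[OF p(1)], of m 2] horizontal by simp
    ultimately show ?thesis by (simp add: b)
  next
    case (vertical m)
    have b: "domino_bead d = x (Suc m)" by (simp add: vertical(1,2) domino_bead_vertical x_def)
    have xm: "x m = x (Suc m) + 1" by (simp add: x_def vertical(2))
    have x': "int (\<rho>' r) - int r - 1 = (if r = m then x (Suc m) + 2 else if r = Suc m then x m else x r)" for r
      by (simp add: vertical(2,3) x_def)
    have "x r \<noteq> x (Suc m) + 2" for r
      using dec'[of r m] dec'[of m r] x'[of r] x'[of m] xm
      by (cases r m rule: linorder_cases) (auto split: if_splits)
    then have "x (Suc m) + 2 \<notin> range x" by (metis rangeE)
    then have "movable (row_beads \<rho>) (x (Suc m))" by (simp add: movable_def x)
    moreover have "row_beads \<rho>' = move (row_beads \<rho>) (x (Suc m))"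
    proof -
      have "q \<in> range (\<lambda>r. if r = m then x (Suc m) + 2 else if r =
        Suc m then x m else x r) \<longleftrightarrow>
          q = x (Suc m) + 2 \<or> (q \<noteq> x (Suc m) \<and> q \<in> range x)" for q
      proof
        assume "q = x (Suc m) + 2 \<or> (q \<noteq> x (Suc m) \<and> q \<in> range x)"
        then consider "q = x (Suc m) + 2" | "q = x m" | r where "q = x r" "r \<noteq> m" "r \<noteq> Suc m"
          by blast
        then show "q \<in> range (\<lambda>r. if r = m then x (Suc m) + 2 else if r = Suc m then x m else x r)"
        proof cases
          case 1 then show ?thesis by (intro range_eqI[of _ _ m]) simp
        next
          case 2 then show ?thesis by (intro range_eqI[of _ _ "Suc m"]) simp
        next
          case 3 then show ?thesis by (intro range_eqI[of _ _ r]) simp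
        qed
      qed (auto simp: inj)
      then show ?thesis unfolding row_beads_def[of \<rho>'] x' x move_def by blast
    qed
    moreover have "psize \<rho>' = psize \<rho> + 2"
    proof -
      obtain L where L: "\<And>i. i \<ge> L \<Longrightarrow> \<rho> i = 0" using is_partition_bound[OF p(1)] by blast
      have q: "\<exists>L. \<forall>i\<ge>L. (\<rho>(m := \<rho> m + 1)) i = 0"
        by (rule exI[of _ "max L (Suc m)"]) (use L in auto)
      have "\<rho>' = (\<rho>(m := \<rho> m + 1))(Suc m := (\<rho>(m := \<rho> m + 1)) (Suc m) + 1)"
        by (simp add: vertical(2,3))
      then show ?thesis
        by (simp only: psize_fun_upd[OF q] psize_fun_upd[OF is_partition_zeros[OF p(1)]])
    qed
    ultimately show ?thesis by (simp add: b)
  qed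
  then show "movable (row_beads \<rho>) (domino_bead d)"
    "row_beads \<rho>' = move (row_beads \<rho>) (domino_bead d)" "psize \<rho>' = psize \<rho> + 2"
    by blast+
qed

text \<open>
  Whether the place \<open>p + 1\<close> is occupied decides between a vertical and a horizontal domino.
\<close>

lemma movable_adds_domino:
  assumes "is_partition \<rho>" "movable (row_beads \<rho>) p"
  shows "\<exists>d \<rho>'. adds_domino \<rho> d \<rho>' \<and> domino_bead d = p"
proof -
  note dec = is_partitionD[OF assms(1)]
  obtain m where m: "p = int (\<rho> m) - int m - 1"
    using assms(2) by (auto simp: movable_def row_beads_def)
  have free: "p + 2 \<noteq> int (\<rho> r) - int r - 1" for r
    using assms(2) by (auto simp: movable_def row_beads_def)
  obtain L where L: "\<And>i. i \<ge> L \<Longrightarrow> \<rho> i = 0" using is_partition_bound[OF assms(1)] by blast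
  show ?thesis
  proof (cases "m > 0 \<and> \<rho> (m - 1) = \<rho> m")
    case True
    then obtain k where k: "m = Suc k" "\<rho> k = \<rho> (Suc k)" by (cases m) auto
    define \<rho>' where "\<rho>' = \<rho>(k := \<rho> k + 1, Suc k := \<rho> k + 1)"
    define d where "d = {(k, \<rho> k), (Suc k, \<rho> k)}"
    have "is_partition \<rho>'"
    proof (rule is_partitionI[where L = "max L (Suc (Suc k))"])
      fix r
      have "\<rho> (Suc k) < \<rho> r" if "Suc r = k"
        using dec[of r k] free[of r] m k that by auto
      then show "\<rho>' (Suc r) \<le> \<rho>' r"
        using dec[of r "Suc r"] k(2) by (cases "r = k"; cases "Suc r = k"; cases "r =
          Suc k") (simp_all add: \<rho>'_def)
    qed (use L in \<open>auto simp: \<rho>'_def\<close>)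
    moreover have "young_diagram \<rho>' = young_diagram \<rho> \<union> d"
      using k(2) by (auto simp: young_diagram_def \<rho>'_def d_def split: if_splits)
    moreover have "d \<inter> young_diagram \<rho> = {}" using k(2) by (auto simp: young_diagram_def d_def)
    moreover have "domino d" by (auto simp: domino_def vertical_domino_def d_def)
    moreover have "domino_bead d = p" by (simp add: d_def domino_bead_vertical m k)
    ultimately show ?thesis using assms(1) unfolding adds_domino_def by blast
  next
    case False
    define \<rho>' where "\<rho>' = \<rho>(m := \<rho> m + 2)"
    define d where "d = {(m, \<rho> m), (m, Suc (\<rho> m))}"
    have "is_partition \<rho>'"
    proof (rule is_partitionI[where L = "max L (Suc m)"])
      fix r
      have "\<rho> m + 2 \<le> \<rho> r" if "Suc r = m"
        using dec[of r m] free[of r] m False that by auto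
      then show "\<rho>' (Suc r) \<le> \<rho>' r"
        using dec[of r "Suc r"] by (cases "r = m"; cases "Suc r = m") (simp_all add: \<rho>'_def)
    qed (use L in \<open>auto simp: \<rho>'_def\<close>)
    moreover have "young_diagram \<rho>' = young_diagram \<rho> \<union> d"
      by (auto simp: young_diagram_def \<rho>'_def d_def split: if_splits)
    moreover have "d \<inter> young_diagram \<rho> = {}" by (auto simp: young_diagram_def d_def)
    moreover have "domino d" by (auto simp: domino_def horizontal_domino_def d_def)
    moreover have "domino_bead d = p" by (simp add: d_def domino_bead_horizontal m)
    ultimately show ?thesis using assms(1) unfolding adds_domino_def by blast
  qed
qed

lemma adds_domino_unique:
  assumes "adds_domino \<rho> d \<rho>'" "adds_domino \<rho> e \<rho>''" "domino_bead d = domino_bead e"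
  shows "d = e"
proof -
  have "\<rho>' = \<rho>''"
    using adds_domino_move(2)[OF assms(1)] adds_domino_move(2)[OF assms(2)] assms
    by (intro row_beads_inject) (auto simp: adds_domino_def)
  then show ?thesis using assms(1,2) unfolding adds_domino_def by blast
qed

text \<open>
  Descents in terms of beads. The beads of lower rows are at smaller places, and a
  domino that is not strictly below the preceding one cannot start at a smaller place, since after
  adding the latter all rows down to its last row are long enough.
\<close>

lemma domino_below_iff:
  assumes "adds_domino \<rho>1 d \<rho>2" "adds_domino \<rho>2 e \<rho>3"
  shows "(\<forall>p\<in>d. \<forall>q\<in>e. fst p < fst q) \<longleftrightarrow> domino_bead e < domino_bead d"
proof -
  note dec1 = is_partitionD[of \<rho>1] and dec2 = is_partitionD[of \<rho>2] and dec3 = is_partitionD[of \<rho>3]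
  have p: "is_partition \<rho>1" "is_partition \<rho>2" "is_partition \<rho>3"
    using assms by (auto simp: adds_domino_def)
  show ?thesis
    using assms(1)
  proof (cases rule: adds_domino_cases)
    case (horizontal m)
    note d = horizontal
    show ?thesis using assms(2)
    proof (cases rule: adds_domino_cases)
      case (horizontal k)
      have "m < k \<longleftrightarrow> int (\<rho>2 k) - int k - 1 < int (\<rho>1 m) - int m - 1"
        using dec1[OF p(1), of m k] dec1[OF p(1), of k m] unfolding d(2)
        by (cases m k rule: linorder_cases) auto
      then show ?thesis by (simp add: d(1) horizontal(1) domino_bead_horizontal)
    next
      case (vertical k)
      have "m < k \<longleftrightarrow> int (\<rho>2 k) - int k - 2 < int (\<rho>1 m) - int m - 1"
        using dec1[OF p(1), of m k] dec1[OF p(1), of "Suc k" m] dec1[OF p(1), of m "Suc k"] vertical(2) unfolding d(2)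
        by (cases m k rule: linorder_cases) (auto split: if_splits)
      then show ?thesis by (auto simp add: d(1) vertical(1) domino_bead_horizontal domino_bead_vertical)
    qed
  next
    case (vertical m)
    note d = vertical
    show ?thesis using assms(2)
    proof (cases rule: adds_domino_cases)
      case (horizontal k)
      have "Suc m < k \<longleftrightarrow> int (\<rho>2 k) - int k - 1 < int (\<rho>1 m) - int m - 2"
        using dec1[OF p(1), of m k] dec2[OF p(2), of k "Suc m"] d(2) unfolding d(3)
        by (cases "Suc m" k rule: linorder_cases) (auto split: if_splits)
      then show ?thesis by (auto simp add: d(1) horizontal(1) domino_bead_horizontal domino_bead_vertical)
    next
      case (vertical k)
      have "Suc m < k \<longleftrightarrow> int (\<rho>2 k) - int k - 2 < int (\<rho>1 m) - int m - 2"
      proof (cases "Suc m" k rule: linorder_cases)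
        case less
        then show ?thesis using dec1[OF p(1), of m k] d(2) unfolding d(3) by auto
      next
        case equal
        then show ?thesis
          using vertical(2) dec1[OF p(1), of m "Suc k"] d(2) unfolding d(3) by auto
      next
        case greater
        then have "\<rho>2 (Suc m) \<le> \<rho>2 (Suc k)" by (intro dec2[OF p(2)]) auto
        moreover have "\<rho>2 (Suc m) = \<rho>1 m + 1" by (simp add: d(3))
        ultimately show ?thesis using vertical(2) greater by auto
      qed
      then show ?thesis by (auto simp add: d(1) vertical(1) domino_bead_vertical)
    qed
  qed
qed

section \<open>Standard domino tableaux as sequences of bead moves\<close>

text \<open>
  Standard domino tableaux of the shape with row lengths \<open>\<rho>\<close>. Here the tiling condition is stated
  for the labelled dominoes rather than for the set of dominoes.
\<close>

definition domino_tableaux :: "nat \<Rightarrow> (nat \<Rightarrow> nat) \<Rightarrow> (nat \<Rightarrow> box set) set"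
  where "domino_tableaux n \<rho> = {T \<in> extensional {1..n}.
    (\<Union>a\<in>{1..n}. T a) = young_diagram \<rho> \<and>
    (\<forall>a\<in>{1..n}. \<forall>b\<in>{1..n}. a \<noteq> b \<longrightarrow> T a \<inter> T b = {}) \<and>
    (\<forall>a\<in>{1..n}. domino (T a)) \<and>
    (\<forall>a\<in>{1..n}. \<forall>b\<in>{1..n}. \<forall>r c c'. (r, c) \<in> T a \<and>
      (r, c') \<in> T b \<and> c \<le> c' \<longrightarrow> a \<le> b) \<and>
    (\<forall>a\<in>{1..n}. \<forall>b\<in>{1..n}. \<forall>r r' c. (r, c) \<in> T a \<and>
      (r', c) \<in> T b \<and> r \<le> r' \<longrightarrow> a \<le> b)}"

definition rows :: "nat list \<Rightarrow> nat \<Rightarrow> nat"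
  where "rows \<mu> r = (if r < length \<mu> then \<mu> ! r else 0)"

lemma diagram_eq_young_diagram: "diagram \<mu> = young_diagram (rows \<mu>)"
  by (auto simp: diagram_def young_diagram_def rows_def split: if_splits)

lemma domino_nonempty: "domino d \<Longrightarrow> d \<noteq> {}"
  by (auto simp: domino_def horizontal_domino_def vertical_domino_def)

lemma standard_domino_tableaux_eq: "standard_domino_tableaux n \<mu> = domino_tableaux n (rows \<mu>)"
proof -
  have "inj_on T A \<and> partition_on D (T ` A) \<and> (\<forall>d\<in>T ` A. domino d) \<longleftrightarrow>
      (\<Union>a\<in>A. T a) =
        D \<and> (\<forall>a\<in>A. \<forall>b\<in>A. a \<noteq> b \<longrightarrow> T a \<inter> T b =
          {}) \<and> (\<forall>a\<in>A. domino (T a))"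
    (is "?l \<longleftrightarrow> ?r") for T :: "nat \<Rightarrow> box set" and A D
  proof
    assume l: ?l
    then have "T a \<inter> T b = {}" if "a \<in> A" "b \<in> A" "a \<noteq> b" for a b
    proof -
      have "T a \<noteq> T b" using l that by (auto dest: inj_onD)
      then show ?thesis using l that by (auto simp only: partition_on_def disjoint_def imageI)
    qed
    then show ?r using l by (auto simp: partition_on_def)
  next
    assume r: ?r
    then have "inj_on T A" unfolding inj_on_def using domino_nonempty by (metis Int_absorb)
    moreover have "disjoint (T ` A)"
    proof (rule disjointI)
      fix X Y assume "X \<in> T ` A" "Y \<in> T ` A" "X \<noteq> Y"
      then obtain a b where "X = T a" "Y = T b" "a \<in> A" "b \<in> A" "a \<noteq> b" by blast
      then show "X \<inter> Y = {}" using r by simp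
    qed
    moreover have "{} \<notin> T ` A" using r domino_nonempty by blast
    ultimately show ?l using r by (auto simp: partition_on_def)
  qed
  note tiling = this
  show ?thesis
    unfolding standard_domino_tableaux_def domino_tableaux_def domino_tiling_def diagram_eq_young_diagram
      domino_def[symmetric]
  proof (rule Collect_cong, goal_cases)
    case (1 T)
    show ?case using tiling[of T "{1..n}" "young_diagram (rows \<mu>)"] by argo
  qed
qed

lemma finite_downset_eq_lessThan:
  assumes "finite (A :: nat set)" "\<And>x y. x \<in> A \<Longrightarrow> y \<le> x \<Longrightarrow> y \<in> A"
  shows "A = {..<card A}"
proof (cases "A = {}")
  case False
  define m where "m = Max A"
  have m: "m \<in> A" "\<And>x. x \<in> A \<Longrightarrow> x \<le> m"
    using assms(1) False by (auto simp: m_def)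
  have "A = {..m}" using m assms(2) by blast
  then show ?thesis by (simp add: lessThan_Suc_atMost)
qed simp

lemma finite_young_diagram:
  assumes "is_partition \<rho>"
  shows "finite (young_diagram \<rho>)"
proof -
  have "young_diagram \<rho> \<subseteq> {..<psize \<rho>} \<times> {..<psize \<rho>}"
  proof clarify
    fix r c assume "(r, c) \<in> young_diagram \<rho>"
    then have "c < \<rho> r" by (simp add: young_diagram_def)
    then show "r \<in> {..<psize \<rho>} \<and> c \<in> {..<psize \<rho>}"
      using is_partition_le_psize[OF assms, of r] is_partition_zero_beyond_psize[OF assms, of r]
      by (cases "r < psize \<rho>") auto
  qed
  then show ?thesis by (rule finite_subset) simp
qed

lemma downset_is_young_diagram:
  assumes "finite D" "\<And>r c r' c'. (r, c) \<in> D \<Longrightarrow> r' \<le> r \<Longrightarrow>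
    c' \<le> c \<Longrightarrow> (r', c') \<in> D"
  shows "\<exists>\<rho>. is_partition \<rho> \<and> D = young_diagram \<rho>"
proof -
  define row where "row = (\<lambda>r. {c. (r, c) \<in> D})"
  have fin: "finite (row r)" for r
    by (rule finite_subset[of _ "snd ` D"]) (use assms(1) in \<open>force simp: row_def\<close>)+
  have row: "row r = {..<card (row r)}" for r
    by (rule finite_downset_eq_lessThan[OF fin]) (use assms(2) in \<open>auto simp: row_def\<close>)
  have "finite (fst ` D)" using assms(1) by simp
  then obtain L where L: "\<And>r. r \<in> fst ` D \<Longrightarrow> r < L"
    unfolding finite_nat_set_iff_bounded by blast
  have "is_partition (\<lambda>r. card (row r))"
  proof (rule is_partitionI[where L = L])
    fix r
    show "card (row (Suc r)) \<le> card (row r)"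
      by (rule card_mono[OF fin]) (use assms(2)[of "Suc r"] in \<open>auto simp: row_def\<close>)
  next
    fix r assume "r \<ge> L"
    then have "(r, c) \<notin> D" for c using L[of r] imageI[of "(r, c)" D fst] by auto
    then have "row r = {}" by (simp add: row_def)
    then show "card (row r) = 0" by simp
  qed
  moreover have "D = young_diagram (\<lambda>r. card (row r))"
  proof -
    have "(r, c) \<in> D \<longleftrightarrow> c \<in> {..<card (row r)}" for r c
    proof -
      have "(r, c) \<in> D \<longleftrightarrow> c \<in> row r" by (simp add: row_def)
      also have "\<dots> \<longleftrightarrow> c \<in> {..<card (row r)}" by (subst row) (rule refl)
      finally show ?thesis .
    qed
    then show ?thesis by (auto simp: young_diagram_def)
  qed
  ultimately show ?thesis by blast
qed

lemma young_diagram_downset: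
  assumes "is_partition \<rho>" "(r, c) \<in> young_diagram \<rho>" "r' \<le> r" "c' \<le> c"
  shows "(r', c') \<in> young_diagram \<rho>"
  using is_partitionD[OF assms(1,3)] assms(2,4) by (auto simp: young_diagram_def)

text \<open>
  By the monotonicity of the labels the dominoes other than the last one again cover a Young
  diagram. Conversely, an added domino may carry the largest label, because no box of the old diagram
  is weakly to the right of and below it.
\<close>

lemma domino_tableaux_Suc_iff:
  assumes "is_partition \<rho>'"
  shows "T \<in> domino_tableaux (Suc n) \<rho>' \<longleftrightarrow> T \<in> extensional {1..Suc n} \<and>
    (\<exists>\<rho>. adds_domino \<rho> (T (Suc n)) \<rho>' \<and>
      restrict T {1..n} \<in> domino_tableaux n \<rho>)" (is "?l \<longleftrightarrow> ?r")
proof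
  assume l: ?l
  then have ext: "T \<in> extensional {1..Suc n}" and un: "(\<Union>a\<in>{1..Suc n}. T a) = young_diagram \<rho>'"
    and disj: "\<And>a b. a \<in> {1..Suc n} \<Longrightarrow> b \<in> {1..Suc n} \<Longrightarrow>
      a \<noteq> b \<Longrightarrow> T a \<inter> T b = {}"
    and dom: "\<And>a. a \<in> {1..Suc n} \<Longrightarrow> domino (T a)"
    and row: "\<And>a b r c c'. a \<in> {1..Suc n} \<Longrightarrow> b \<in> {1..Suc n} \<Longrightarrow>
      (r, c) \<in> T a \<Longrightarrow> (r, c') \<in> T b \<Longrightarrow> c \<le> c' \<Longrightarrow> a \<le> b"
    and col: "\<And>a b r r' c. a \<in> {1..Suc n} \<Longrightarrow> b \<in> {1..Suc n} \<Longrightarrow>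
      (r, c) \<in> T a \<Longrightarrow> (r', c) \<in> T b \<Longrightarrow> r \<le> r' \<Longrightarrow> a \<le> b"
    unfolding domino_tableaux_def by blast+
  define D where "D = (\<Union>a\<in>{1..n}. T a)"
  have ins: "{1..Suc n} = insert (Suc n) {1..n}" by auto
  have D: "young_diagram \<rho>' = D \<union> T (Suc n)"
    unfolding un[symmetric] ins D_def by blast
  have dj: "T (Suc n) \<inter> D = {}"
  proof -
    have "T (Suc n) \<inter> T a = {}" if "a \<in> {1..n}" for a
      using disj[of "Suc n" a] that by simp
    then show ?thesis unfolding D_def by blast
  qed
  have "(r', c') \<in> D" if rc: "(r, c) \<in> D" and le: "r' \<le> r" "c' \<le> c" for r c r' c'
  proof -
    obtain a where a: "a \<in> {1..n}" "(r, c) \<in> T a" using rc by (auto simp: D_def)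
    have rc': "(r, c) \<in> young_diagram \<rho>'" using rc D by blast
    have "(r, c') \<in> young_diagram \<rho>'" "(r', c') \<in> young_diagram \<rho>'"
      using young_diagram_downset[OF assms rc'] le by auto
    then obtain x y where x: "x \<in> {1..Suc n}" "(r, c') \<in> T x" and y: "y \<in> {1..Suc n}" "(r', c') \<in> T y"
      unfolding un[symmetric] by blast
    have "y \<le> x" using col[OF y(1) x(1) y(2) x(2) le(1)] .
    moreover have "x \<le> a" using row[OF x(1) _ x(2) a(2) le(2)] a(1) by auto
    ultimately have "y \<in> {1..n}" using a(1) y(1) by auto
    then show ?thesis using y(2) by (auto simp: D_def)
  qed
  moreover have "finite D" using finite_young_diagram[OF assms] D by simp
  ultimately obtain \<rho> where \<rho>: "is_partition \<rho>" "D =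
    young_diagram \<rho>" using downset_is_young_diagram by metis
  have "adds_domino \<rho> (T (Suc n)) \<rho>'"
    using \<rho> assms dom[of "Suc n"] dj D by (auto simp: adds_domino_def)
  moreover have "restrict T {1..n} \<in> domino_tableaux n \<rho>"
    unfolding domino_tableaux_def
  proof (intro CollectI conjI ballI allI impI; (elim conjE)?)
    show "(\<Union>a\<in>{1..n}. restrict T {1..n} a) = young_diagram \<rho>" using \<rho>(2) by (auto simp: D_def)
  next
    fix a b assume "a \<in> {1..n}" "b \<in> {1..n}" "a \<noteq> b"
    then show "restrict T {1..n} a \<inter> restrict T {1..n} b = {}" using disj[of a b] by auto
  next
    fix a assume "a \<in> {1..n}"
    then show "domino (restrict T {1..n} a)" using dom[of a] by auto
  next
    fix a b r c c' assume "a \<in> {1..n}" "b \<in> {1..n}" "(r, c) \<in> restrict T {1..n} a" "(r, c') \<in> restrict T {1..n} b" "c \<le> c'"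
    then show "a \<le> b" using row[of a b r c c'] by auto
  next
    fix a b r r' c assume "a \<in> {1..n}" "b \<in> {1..n}" "(r, c) \<in> restrict T {1..n} a" "(r', c) \<in> restrict T {1..n} b" "r \<le> r'"
    then show "a \<le> b" using col[of a b r c r'] by auto
  qed simp
  ultimately show ?r using ext by blast
next
  assume r: ?r
  then obtain \<rho> where ext: "T \<in> extensional {1..Suc n}" and ad: "adds_domino \<rho> (T (Suc n)) \<rho>'"
    and R: "restrict T {1..n} \<in> domino_tableaux n \<rho>" by blast
  define U where "U = restrict T {1..n}"
  have U: "U a = T a" if "a \<in> {1..n}" for a using that by (simp add: U_def)
  have R': "(\<Union>a\<in>{1..n}. U a) = young_diagram \<rho>"
    "\<forall>a\<in>{1..n}. \<forall>b\<in>{1..n}. a \<noteq> b \<longrightarrow> U a \<inter> U b =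
      {}" "\<forall>a\<in>{1..n}. domino (U a)"
    "\<forall>a\<in>{1..n}. \<forall>b\<in>{1..n}. \<forall>r c c'. (r, c) \<in> U a \<and>
      (r, c') \<in> U b \<and> c \<le> c' \<longrightarrow> a \<le> b"
    "\<forall>a\<in>{1..n}. \<forall>b\<in>{1..n}. \<forall>r r' c. (r, c) \<in> U a \<and>
      (r', c) \<in> U b \<and> r \<le> r' \<longrightarrow> a \<le> b"
    using R unfolding U_def[symmetric] domino_tableaux_def by blast+
  have un: "(\<Union>a\<in>{1..n}. T a) = young_diagram \<rho>" using R'(1) U by simp
  have disj: "T a \<inter> T b = {}" if "a \<in> {1..n}" "b \<in> {1..n}" "a \<noteq> b" for a b
    using R'(2) U that by metis
  have dom: "domino (T a)" if "a \<in> {1..n}" for a using R'(3) U that by metis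
  have row: "a \<le> b"
    if "a \<in> {1..n}" "b \<in> {1..n}" "(r, c) \<in> T a" "(r, c') \<in> T b" "c \<le> c'" for a b r c c'
    using R'(4) that unfolding U[OF that(1), symmetric] U[OF that(2), symmetric] by blast
  have col: "a \<le> b"
    if "a \<in> {1..n}" "b \<in> {1..n}" "(r, c) \<in> T a" "(r', c) \<in> T b" "r \<le> r'" for a b r r' c
    using R'(5) that unfolding U[OF that(1), symmetric] U[OF that(2), symmetric] by blast
  have \<rho>: "is_partition \<rho>" "domino (T (Suc n))" "T (Suc n) \<inter> young_diagram \<rho> =
    {}" "young_diagram \<rho>' = young_diagram \<rho> \<union> T (Suc n)"
    using ad by (auto simp: adds_domino_def)
  have ins: "{1..Suc n} = insert (Suc n) {1..n}" by auto
  have out: "False" if "a \<in> {1..n}" "(r, c) \<in> T (Suc n)" "(r', c') \<in> T a" "r \<le> r'" "c \<le> c'" for a r c r' c'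
  proof -
    have "(r', c') \<in> young_diagram \<rho>" using that un by blast
    then have "(r, c) \<in> young_diagram \<rho>" using young_diagram_downset[OF \<rho>(1)] that by blast
    then show False using \<rho>(3) that(2) by blast
  qed
  have new: "T (Suc n) \<inter> T a = {}" if "a \<in> {1..n}" for a
    using \<rho>(3) un that by blast
  show ?l
    unfolding domino_tableaux_def
  proof (intro CollectI conjI ballI allI impI; (elim conjE)?)
    show "T \<in> extensional {1..Suc n}" by (rule ext)
    show "(\<Union>a\<in>{1..Suc n}. T a) = young_diagram \<rho>'" unfolding ins \<rho>(4) un[symmetric] by blast
  next
    fix a b assume "a \<in> {1..Suc n}" "b \<in> {1..Suc n}" "a \<noteq> b"
    then show "T a \<inter> T b = {}"
      using disj[of a b] new[of a] new[of b] unfolding ins by blast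
  next
    fix a assume "a \<in> {1..Suc n}"
    then show "domino (T a)" using dom[of a] \<rho>(2) unfolding ins by blast
  next
    fix a b r c c' assume "a \<in> {1..Suc n}" "b \<in> {1..Suc n}" "(r, c) \<in> T a" "(r, c') \<in> T b" "c \<le> c'"
    then show "a \<le> b" using row[of a b r c c'] out[of b r c r c'] unfolding ins
      by (elim insertE) simp_all
  next
    fix a b r r' c assume "a \<in> {1..Suc n}" "b \<in> {1..Suc n}" "(r, c) \<in> T a" "(r', c) \<in> T b" "r \<le> r'"
    then show "a \<le> b" using col[of a b r c r'] out[of b r c r' c] unfolding ins
      by (elim insertE) simp_all
  qed
qed

text \<open>
  A tableau is encoded by the places of the moved beads, in the order of the labels.
\<close>

definition domino_code :: "nat \<Rightarrow> (nat \<Rightarrow> box set) \<Rightarrow> int list"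
  where "domino_code n T = map (\<lambda>i. domino_bead (T i)) [1..<Suc n]"

definition bead_paths :: "nat \<Rightarrow> int set \<Rightarrow> int list set"
  where "bead_paths n B = {ps. length ps = n \<and> path vacuum ps B}"

lemma domino_tableaux_extensional: "T \<in> domino_tableaux n \<rho> \<Longrightarrow> T \<in> extensional {1..n}"
  unfolding domino_tableaux_def by blast

lemma is_partition_0: "is_partition (\<lambda>_. 0)"
  by (rule is_partitionI) auto

lemma row_beads_0: "row_beads (\<lambda>_. 0) = vacuum"
proof -
  have "p \<in> range (\<lambda>r. int 0 - int r - 1)" if "p < 0" for p
    using that by (intro range_eqI[of _ _ "nat (- p - 1)"]) auto
  then show ?thesis by (auto simp: row_beads_def vacuum_def)
qed

lemma path_row_beads:
  assumes "is_partition \<rho>" "path (row_beads \<rho>) ps B"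
  shows "\<exists>\<rho>'. is_partition \<rho>' \<and> B = row_beads \<rho>' \<and> psize \<rho>' =
    psize \<rho> + 2 * length ps"
  using assms
proof (induction ps arbitrary: \<rho>)
  case (Cons p ps)
  then obtain d \<sigma> where ad: "adds_domino \<rho> d \<sigma>" "domino_bead d = p"
    using movable_adds_domino[OF Cons.prems(1), of p] by auto
  have "is_partition \<sigma>" using ad by (simp add: adds_domino_def)
  then show ?case
    using Cons.IH[of \<sigma>] adds_domino_move[OF ad(1)] ad(2) Cons.prems by auto
qed auto

lemma domino_tableaux_0: "domino_tableaux 0 \<rho> = (if \<rho> = (\<lambda>_. 0) then {\<lambda>_. undefined} else {})"
proof -
  have "young_diagram \<rho> = {} \<longleftrightarrow> \<rho> = (\<lambda>_. 0)"
    using young_diagram_inject[of \<rho> "\<lambda>_. 0"] by (auto simp: young_diagram_def)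
  then show ?thesis by (auto simp: domino_tableaux_def)
qed

lemma domino_code_Suc:
  "domino_code (Suc n) T = domino_code n (restrict T {1..n}) @ [domino_bead (T (Suc n))]"
proof -
  have "domino_code n (restrict T {1..n}) = domino_code n T"
    unfolding domino_code_def by (rule map_cong[OF refl]) (auto simp: restrict_def)
  moreover have "domino_code (Suc n) T = domino_code n T @ [domino_bead (T (Suc n))]"
    unfolding domino_code_def by (subst upt_Suc_append) auto
  ultimately show ?thesis by simp
qed

text \<open>
  The shape before a move and the place of the move determine the added domino, so a tableau can be
  rebuilt from its code step by step.
\<close>

lemma bij_betw_domino_code:
  assumes "is_partition \<rho>"
  shows "bij_betw (domino_code n) (domino_tableaux n \<rho>) (bead_paths n (row_beads \<rho>))"
  using assms
proof (induction n arbitrary: \<rho>)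
  case 0
  have "vacuum = row_beads \<rho> \<longleftrightarrow> \<rho> = (\<lambda>_. 0)"
    using row_beads_inject[OF 0 is_partition_0] row_beads_0 by auto
  then have "bead_paths 0 (row_beads \<rho>) = (if \<rho> = (\<lambda>_. 0) then {[]} else {})"
    unfolding bead_paths_def by auto
  moreover have "domino_code 0 T = []" for T by (simp add: domino_code_def)
  ultimately show ?case by (simp add: domino_tableaux_0 bij_betw_def)
next
  case (Suc n \<rho>')
  note step = domino_tableaux_Suc_iff[OF Suc.prems, of _ n]
  have code: "domino_code n (restrict T {1..n}) \<in> bead_paths n (row_beads \<rho>)"
    if "restrict T {1..n} \<in> domino_tableaux n \<rho>" "adds_domino \<rho> d \<rho>'" for T \<rho> d
  proof -
    have "is_partition \<rho>" using that(2) by (simp add: adds_domino_def)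
    from bij_betwE[OF Suc.IH[OF this]] show ?thesis using that(1) by blast
  qed
  show ?case
    unfolding bij_betw_def
  proof
    show "inj_on (domino_code (Suc n)) (domino_tableaux (Suc n) \<rho>')"
    proof (rule inj_onI)
      fix T U assume T: "T \<in> domino_tableaux (Suc n) \<rho>'" and U: "U \<in> domino_tableaux (Suc n) \<rho>'"
        and eq: "domino_code (Suc n) T = domino_code (Suc n) U"
      obtain \<rho> where \<rho>: "adds_domino \<rho> (T (Suc n)) \<rho>'" "restrict T {1..n} \<in> domino_tableaux n \<rho>"
        using T unfolding step by blast
      obtain \<sigma> where \<sigma>: "adds_domino \<sigma> (U (Suc n)) \<rho>'" "restrict U {1..n} \<in> domino_tableaux n \<sigma>"
        using U unfolding step by blast
      have c: "domino_code n (restrict T {1..n}) = domino_code n (restrict U {1..n})"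
        and b: "domino_bead (T (Suc n)) = domino_bead (U (Suc n))"
        using eq unfolding domino_code_Suc by simp_all
      have "row_beads \<rho> = row_beads \<sigma>"
      proof (rule path_unique)
        show "path vacuum (domino_code n (restrict T {1..n})) (row_beads \<rho>)"
          using code[OF \<rho>(2,1)] by (simp add: bead_paths_def)
        show "path vacuum (domino_code n (restrict T {1..n})) (row_beads \<sigma>)"
          unfolding c using code[OF \<sigma>(2,1)] by (simp add: bead_paths_def)
      qed
      moreover have p: "is_partition \<rho>" "is_partition \<sigma>"
        using \<rho>(1) \<sigma>(1) by (simp_all add: adds_domino_def)
      ultimately have "\<rho> = \<sigma>" using row_beads_inject by blast
      moreover have "inj_on (domino_code n) (domino_tableaux n \<rho>)"
        by (rule bij_betw_imp_inj_on[OF Suc.IH[OF p(1)]])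
      ultimately have "restrict T {1..n} = restrict U {1..n}"
        using c \<rho>(2) \<sigma>(2) unfolding inj_on_def by blast
      moreover have "T (Suc n) = U (Suc n)"
        using adds_domino_unique[OF \<rho>(1)] \<sigma>(1) b \<open>\<rho> = \<sigma>\<close> by blast
      ultimately have eq: "T a = U a" if "a \<in> {1..Suc n}" for a
      proof (cases "a = Suc n")
        case False
        then have "a \<in> {1..n}" using that by simp
        then show ?thesis
          using fun_cong[OF \<open>restrict T {1..n} = restrict U {1..n}\<close>, of a] by simp
      qed (use \<open>T (Suc n) = U (Suc n)\<close> in simp)
      show "T = U"
      proof (rule extensionalityI)
        show "T \<in> extensional {1..Suc n}" "U \<in> extensional {1..Suc n}"
          using T U unfolding step by blast+
      qed (rule eq)
    qed
    show "domino_code (Suc n) ` domino_tableaux (Suc n) \<rho>' = bead_paths (Suc n) (row_beads \<rho>')"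
    proof (intro equalityI subsetI)
      fix ps assume "ps \<in> domino_code (Suc n) ` domino_tableaux (Suc n) \<rho>'"
      then obtain T where T: "T \<in> domino_tableaux (Suc n) \<rho>'" "ps = domino_code (Suc n) T" by blast
      obtain \<rho> where \<rho>: "adds_domino \<rho> (T (Suc n)) \<rho>'" "restrict T {1..n} \<in> domino_tableaux n \<rho>"
        using T(1) unfolding step by blast
      show "ps \<in> bead_paths (Suc n) (row_beads \<rho>')"
      proof -
        have "path vacuum (domino_code n (restrict T {1..n})) (row_beads \<rho>)"
          "length (domino_code n (restrict T {1..n})) = n"
          using code[OF \<rho>(2,1)] by (simp_all add: bead_paths_def)
        moreover have "path (row_beads \<rho>) [domino_bead (T (Suc n))] (row_beads \<rho>')"
          using adds_domino_move(1,2)[OF \<rho>(1)] by simp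
        ultimately have "path vacuum (domino_code n (restrict T {1..n}) @ [domino_bead (T (Suc n))]) (row_beads \<rho>')"
          unfolding path_append by blast
        then show ?thesis
          unfolding T(2) domino_code_Suc bead_paths_def using \<open>length _ = n\<close> by simp
      qed
    next
      fix ps assume ps: "ps \<in> bead_paths (Suc n) (row_beads \<rho>')"
      then have "length ps = Suc n" by (simp add: bead_paths_def)
      then obtain qs p where qs: "ps = qs @ [p]" "length qs = n"
        by (cases ps rule: rev_cases) auto
      then obtain C where C: "path vacuum qs C" "movable C p" "move C p = row_beads \<rho>'"
        using ps by (auto simp: bead_paths_def path_append)
      obtain \<rho> where \<rho>: "is_partition \<rho>" "C = row_beads \<rho>"
        using path_row_beads[OF is_partition_0] C(1) unfolding row_beads_0 by blast
      obtain d \<rho>'' where ad: "adds_domino \<rho> d \<rho>''" "domino_bead d = p"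
        using movable_adds_domino[OF \<rho>(1)] C(2) \<rho>(2) by blast
      have "\<rho>'' = \<rho>'"
        using adds_domino_move(2)[OF ad(1)] ad Suc.prems C(3) \<rho>(2)
        by (intro row_beads_inject) (simp_all add: adds_domino_def)
      have "qs \<in> domino_code n ` domino_tableaux n \<rho>"
        using bij_betw_imp_surj_on[OF Suc.IH[OF \<rho>(1)]] C(1) \<rho>(2) qs(2) by (simp add: bead_paths_def)
      then obtain U where U: "U \<in> domino_tableaux n \<rho>" "qs = domino_code n U" by blast
      define T where "T = U(Suc n := d)"
      have Ue: "U \<in> extensional {1..n}" using U(1) by (rule domino_tableaux_extensional)
      have r: "restrict T {1..n} = U"
      proof
        fix a
        show "restrict T {1..n} a = U a"
          using extensional_arb[OF Ue, of a] by (cases "a \<in> {1..n}") (simp_all add: T_def)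
      qed
      have "T \<in> extensional {1..Suc n}"
        unfolding extensional_def
      proof (intro CollectI allI impI)
        fix a assume "a \<notin> {1..Suc n}"
        then have "a \<notin> {1..n}" "a \<noteq> Suc n" by auto
        then show "T a = undefined" using extensional_arb[OF Ue, of a] by (simp add: T_def)
      qed
      have "T \<in> domino_tableaux (Suc n) \<rho>'"
      proof -
        have "adds_domino \<rho> (T (Suc n)) \<rho>'" using ad(1) \<open>\<rho>'' = \<rho>'\<close> by (simp add: T_def)
        then show ?thesis unfolding step r using U(1) \<open>T \<in> extensional {1..Suc n}\<close> by blast
      qed
      moreover have "domino_code (Suc n) T = ps"
        unfolding domino_code_Suc r by (simp add: T_def ad(2) U(2) qs(1))
      ultimately show "ps \<in> domino_code (Suc n) ` domino_tableaux (Suc n) \<rho>'" by blast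
    qed
  qed
qed

text \<open>
  The position before the first move counts as \<open>- 1\<close>, so that \<open>0\<close> is a descent if the first move starts
  below \<open>- 1\<close>.
\<close>

definition path_descents :: "int list \<Rightarrow> nat set"
  where "path_descents ps = {j. j < length ps \<and> ps ! j < (- 1 # ps) ! j}"

lemma domino_tableaux_restrict:
  assumes "T \<in> domino_tableaux n \<rho>" "is_partition \<rho>" "k \<le> n"
  shows "\<exists>\<sigma>. is_partition \<sigma> \<and> restrict T {1..k} \<in> domino_tableaux k \<sigma>"
  using assms(3)
proof (induction rule: inc_induct)
  case base
  have "restrict T {1..n} = T" using domino_tableaux_extensional[OF assms(1)] by (rule extensional_restrict)
  then show ?case using assms(1,2) by auto
next
  case (step k)
  then obtain \<sigma> where \<sigma>: "is_partition \<sigma>" "restrict T {1..Suc k} \<in> domino_tableaux (Suc k) \<sigma>" by blast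
  have "restrict (restrict T {1..Suc k}) {1..k} = restrict T {1..k}"
    by (auto simp: restrict_def fun_eq_iff)
  then obtain \<rho>' where "adds_domino \<rho>' (restrict T {1..Suc k} (Suc k)) \<sigma>" "restrict T {1..k} \<in> domino_tableaux k \<rho>'"
    using \<sigma>(2) unfolding domino_tableaux_Suc_iff[OF \<sigma>(1)] by auto
  then show ?case unfolding adds_domino_def by blast
qed

lemma domino_tableaux_adds:
  assumes "T \<in> domino_tableaux n \<rho>" "is_partition \<rho>" "Suc k \<le> n"
  shows "\<exists>\<sigma> \<tau>. adds_domino \<sigma> (T (Suc k)) \<tau> \<and>
    restrict T {1..k} \<in> domino_tableaux k \<sigma> \<and>
      restrict T {1..Suc k} \<in> domino_tableaux (Suc k) \<tau>"
proof -
  obtain \<tau> where \<tau>: "is_partition \<tau>" "restrict T {1..Suc k} \<in> domino_tableaux (Suc k) \<tau>"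
    using domino_tableaux_restrict[OF assms] by blast
  have "restrict (restrict T {1..Suc k}) {1..k} = restrict T {1..k}"
    by (auto simp: restrict_def fun_eq_iff)
  then show ?thesis using \<tau>(2) domino_tableaux_Suc_iff[OF \<tau>(1), of "restrict T {1..Suc k}" k] by auto
qed

text \<open>
  In the empty diagram only the beads at \<open>- 1\<close> and \<open>- 2\<close> can be moved, and the second move adds a vertical
  domino. This accounts for the descent at \<open>0\<close>; for the others see \<open>domino_below_iff\<close>.
\<close>

lemma tableau_descent_set_eq:
  assumes T: "T \<in> domino_tableaux n \<rho>" and "is_partition \<rho>" "n \<ge> 1"
  shows "tableau_descent_set n T = path_descents (domino_code n T)"
proof (rule set_eqI)
  fix j
  have code: "domino_code n T ! j = domino_bead (T (Suc j))" if "j < n" for j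
    using that by (simp add: domino_code_def del: upt_Suc)
  show "j \<in> tableau_descent_set n T \<longleftrightarrow> j \<in> path_descents (domino_code n T)"
  proof (cases j)
    case 0
    obtain \<sigma> \<tau> where ad: "adds_domino \<sigma> (T (Suc 0)) \<tau>" "restrict T {1..0} \<in> domino_tableaux 0 \<sigma>"
      using domino_tableaux_adds[OF assms(1,2), of 0] assms(3) by auto
    have \<sigma>: "\<sigma> = (\<lambda>_. 0)" using ad(2) by (auto simp: domino_tableaux_0 split: if_splits)
    have "vertical_domino (T 1) \<longleftrightarrow> domino_bead (T 1) < - 1"
      using ad(1)
    proof (cases rule: adds_domino_cases)
      case (horizontal m)
      have "m = 0"
      proof (rule ccontr)
        assume "m \<noteq> 0"
        then show False
          using ad(1) horizontal(2) is_partitionD[of \<tau> 0 m] by (auto simp: adds_domino_def \<sigma>)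
      qed
      then show ?thesis using horizontal
        by (auto simp: domino_bead_horizontal \<sigma> vertical_domino_def doubleton_eq_iff)
    next
      case (vertical m)
      then show ?thesis
        by (auto simp: domino_bead_vertical \<sigma> vertical_domino_def)
    qed
    then show ?thesis using code[of 0] assms(3)
      by (auto simp: 0 tableau_descent_set_def path_descents_def domino_code_def)
  next
    case (Suc i)
    show ?thesis
    proof (cases "Suc i < n")
      case True
      obtain \<sigma>2 \<sigma>3 where ad2: "adds_domino \<sigma>2 (T (Suc (Suc i))) \<sigma>3" "restrict T {1..Suc i} \<in> domino_tableaux (Suc i) \<sigma>2"
        using domino_tableaux_adds[OF assms(1,2), of "Suc i"] True by auto
      obtain \<sigma>1 where ad1: "adds_domino \<sigma>1 (T (Suc i)) \<sigma>2"
        using domino_tableaux_Suc_iff[of \<sigma>2 "restrict T {1..Suc i}" i] ad2 by (auto simp: adds_domino_def)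
      have "(\<forall>p\<in>T (Suc i). \<forall>q\<in>T (Suc (Suc i)). fst p < fst q) \<longleftrightarrow>
          domino_bead (T (Suc (Suc i))) < domino_bead (T (Suc i))"
        by (rule domino_below_iff[OF ad1 ad2(1)])
      then show ?thesis
        using True code[of i] code[of "Suc i"]
        by (auto simp: Suc tableau_descent_set_def path_descents_def domino_code_def)
    next
      case False
      then show ?thesis
        by (auto simp: Suc tableau_descent_set_def path_descents_def domino_code_def)
    qed
  qed
qed

section \<open>Summing over shapes\<close>

text \<open>
  The indices of the monomial that detects \<open>A\<close>: with the zeroth index 0 in front, the word goes
  up by one after position \<open>j\<close> if \<open>j \<in> A\<close> and stays constant otherwise.
\<close>

definition index_word :: "nat \<Rightarrow> nat set \<Rightarrow> nat list"
  where "index_word n A = map (\<lambda>j. card (A \<inter> {..j})) [0..<n]"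

lemma length_index_word [simp]: "length (index_word n A) = n"
  by (simp add: index_word_def)

lemma index_word_step:
  assumes "j < n"
  shows "index_word n A ! j = (0 # index_word n A) ! j + (if j \<in> A then 1 else 0)"
proof -
  have prev: "(0 # index_word n A) ! j = card (A \<inter> {..<j})"
    using assms by (cases j) (auto simp: index_word_def lessThan_Suc_atMost)
  have "{..j} = insert j {..<j}" by auto
  then have "card (A \<inter> {..j}) = card (A \<inter> {..<j}) + (if j \<in> A then 1 else 0)"
    by (simp add: Int_insert_right)
  then show ?thesis using assms by (simp add: prev) (simp add: index_word_def)
qed

lemma sorted_index_word: "sorted (0 # index_word n A)"
proof -
  have "card (A \<inter> {..i}) \<le> card (A \<inter> {..j})" if "i \<le> j" for i j
    by (rule card_mono) (use that in auto)
  then show ?thesis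
    by (auto simp: index_word_def sorted_iff_nth_mono)
qed

lemma index_word_le: "i \<in> set (index_word n A) \<Longrightarrow> i \<le> n"
proof -
  assume "i \<in> set (index_word n A)"
  then obtain j where j: "j < n" "i = card (A \<inter> {..j})" by (auto simp: index_word_def)
  have "card (A \<inter> {..j}) \<le> card {..j}" by (rule card_mono) auto
  then show "i \<le> n" using j by simp
qed

lemma count_content_word: "count (mset (content_word \<beta> m)) i = (if i \<le> m then count \<beta> i else 0)"
  by (induction m) (auto simp: le_Suc_eq)

lemma sorted_content_word: "sorted (content_word \<beta> m)"
  by (induction m) (auto simp: sorted_append dest: content_word_le)

lemma content_word_mset:
  assumes "sorted w" "\<And>i. i \<in> set w \<Longrightarrow> i \<le> m"
  shows "content_word (mset w) m = w"
proof -
  have "mset (content_word (mset w) m) = mset w"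
  proof (rule multiset_eqI)
    fix i
    have "count (mset w) i = 0" if "\<not> i \<le> m"
      using assms(2)[of i] that by (auto simp: count_eq_zero_iff)
    then show "count (mset (content_word (mset w) m)) i = count (mset w) i"
      by (simp add: count_content_word)
  qed
  then have "sort w = content_word (mset w) m"
    using sorted_content_word by (rule properties_for_sort)
  then show ?thesis using assms(1) by (simp add: sorted_sort_id)
qed

text \<open>
  The blocks of the word of \<open>A\<close> are separated exactly at the positions in \<open>A\<close>.
\<close>

lemma blockwise_sorted_index_word:
  "blockwise_sorted (index_word n A) ps \<longleftrightarrow> length ps = n \<and> path_descents ps \<subseteq> A"
proof (cases "length ps = n")
  case True
  have z: "(0, - 1) # zip (index_word n A) ps = zip (0 # index_word n A) (- 1 # ps)" by simp
  have "blockwise_sorted (index_word n A) ps \<longleftrightarrow>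
      (\<forall>i<n. (0 # index_word n A) ! i = index_word n A ! i \<longrightarrow> (- 1 # ps) ! i \<le> ps ! i)"
    unfolding blockwise_sorted_def z successively_conv_nth using True
    by (simp add: nth_zip del: zip_Cons_Cons)
  also have "\<dots> \<longleftrightarrow> (\<forall>i<n. i \<notin> A \<longrightarrow> (- 1 # ps) ! i \<le> ps ! i)"
  proof -
    have "(0 # index_word n A) ! i = index_word n A ! i \<longleftrightarrow> i \<notin> A" if "i < n" for i
      unfolding index_word_step[OF that, of A] by simp
    then show ?thesis by blast
  qed
  also have "\<dots> \<longleftrightarrow> path_descents ps \<subseteq> A"
    using True by (auto simp: path_descents_def not_less[symmetric] simp del: nth_Cons_Suc not_less)
  finally show ?thesis using True by simp
qed (simp add: blockwise_sorted_def)

definition descent_paths :: "nat \<Rightarrow> nat set \<Rightarrow> int set \<Rightarrow> int list set"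
  where "descent_paths n A B = {ps \<in> bead_paths n B. path_descents ps \<subseteq> A}"

lemma content_paths_index_word:
  "content_paths (mset (index_word n A)) n S = descent_paths n A (beads S)"
proof -
  have "content_word (mset (index_word n A)) n = index_word n A"
    using sorted_index_word[of n A] index_word_le by (intro content_word_mset) auto
  then show ?thesis
    unfolding content_paths_def descent_paths_def bead_paths_def
    by (auto simp: blockwise_sorted_index_word)
qed

text \<open>
  Partitions of \<open>2 n\<close> and pairs of partitions of total size \<open>n\<close> parametrize bead configurations. A sum
  over either of them is transferred to the other through the configurations that are
  reachable in \<open>n\<close> moves, since only these contribute.
\<close>

lemma sum_over_reachable:
  assumes "finite X" "inj_on h X" "\<And>B. bead_paths n B \<noteq> {} \<Longrightarrow> B \<in> h ` X"
  shows "(\<Sum>x\<in>X. card (descent_paths n A (h x)) * card (descent_paths n A' (h x))) =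
    (\<Sum>B | bead_paths n B \<noteq> {}. card (descent_paths n A B) * card (descent_paths n A' B))"
proof -
  have "(\<Sum>x\<in>X. card (descent_paths n A (h x)) * card (descent_paths n A' (h x))) =
    (\<Sum>B\<in>h ` X. card (descent_paths n A B) * card (descent_paths n A' B))"
    by (simp add: sum.reindex[OF assms(2)])
  also have "\<dots> = (\<Sum>B | bead_paths n B \<noteq> {}. card (descent_paths n A B) * card (descent_paths n A' B))"
  proof (rule sum.mono_neutral_right)
    show "\<forall>B\<in>h ` X - {B. bead_paths n B \<noteq> {}}. card (descent_paths n A B) * card (descent_paths n A' B) = 0"
      by (simp add: descent_paths_def)
  qed (use assms in auto)
  finally show ?thesis .
qed

lemma bead_paths_beads:
  assumes "bead_paths n B \<noteq> {}"
  shows "B \<in> beads ` bipartitions_of n"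
proof -
  obtain ps where "length ps = n" "path (beads (one_row 0)) ps B"
    using assms by (auto simp: bead_paths_def beads_one_row_0)
  then show ?thesis
    using path_beads[OF bipartition_one_row, of 0 ps B] by (auto simp: bipartitions_of_def)
qed

lemma finite_bead_paths: "finite (bead_paths n B)"
proof (cases "bead_paths n B = {}")
  case False
  then obtain S where S: "B = beads S" "bipartition S"
    using bead_paths_beads by (auto simp: bipartitions_of_def)
  have "bead_paths n B = content_paths (mset (index_word n {..<n})) n S"
    unfolding content_paths_index_word S(1)[symmetric] descent_paths_def
    by (auto simp: bead_paths_def path_descents_def)
  then show ?thesis using strip_chains_eq_card[OF S(2)] by simp
qed simp

lemma is_partition_rows:
  assumes "\<mu> \<in> partitions_of m"
  shows "is_partition (rows \<mu>)"
proof (rule is_partitionI[where L = "length \<mu>"])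
  fix i
  show "rows \<mu> (Suc i) \<le> rows \<mu> i"
    using assms sorted_wrt_nth_less[of "(\<ge>)" \<mu> i "Suc i"] by (auto simp: partitions_of_def rows_def)
qed (simp add: rows_def)

lemma psize_rows: "psize (rows \<mu>) = sum_list \<mu>"
proof -
  have "psize (rows \<mu>) = (\<Sum>i<length \<mu>. rows \<mu> i)"
    by (rule psize_eq) (simp add: rows_def)
  also have "\<dots> = (\<Sum>i<length \<mu>. \<mu> ! i)" by (rule sum.cong) (auto simp: rows_def)
  finally show ?thesis by (simp add: sum_list_sum_nth atLeast0LessThan)
qed

lemma rows_nonzero_iff:
  assumes "\<mu> \<in> partitions_of m"
  shows "rows \<mu> i \<noteq> 0 \<longleftrightarrow> i < length \<mu>"
proof -
  have "\<mu> ! i \<noteq> 0" if "i < length \<mu>"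
  proof
    assume "\<mu> ! i = 0"
    then have "0 \<in> set \<mu>" using nth_mem[OF that] by simp
    then show False using assms by (simp add: partitions_of_def)
  qed
  then show ?thesis by (auto simp: rows_def)
qed

lemma inj_on_rows: "inj_on rows (partitions_of m)"
proof (rule inj_onI)
  fix \<mu> \<nu> assume mu: "\<mu> \<in> partitions_of m" and nu: "\<nu> \<in> partitions_of m" and eq: "rows \<mu> = rows \<nu>"
  have "i < length \<mu> \<longleftrightarrow> i < length \<nu>" for i
    using rows_nonzero_iff[OF mu, of i] rows_nonzero_iff[OF nu, of i] eq by simp
  then have len: "length \<mu> = length \<nu>" by (rule lessThan_eqI)
  show "\<mu> = \<nu>"
  proof (rule nth_equalityI[OF len])
    fix i assume "i < length \<mu>"
    then show "\<mu> ! i = \<nu> ! i" using fun_cong[OF eq, of i] len by (simp add: rows_def)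
  qed
qed

lemma finite_partitions_of: "finite (partitions_of m)"
proof (rule finite_subset)
  show "partitions_of m \<subseteq> {xs. set xs \<subseteq> {..m} \<and> length xs \<le> m}"
  proof (intro subsetI CollectI conjI)
    fix \<mu> x assume mu: "\<mu> \<in> partitions_of m"
    show "x \<in> {..m}" if "x \<in> set \<mu>"
      using member_le_sum_list[OF that] mu by (simp add: partitions_of_def)
    have "rows \<mu> m = 0"
      by (rule is_partition_zero_beyond_psize[OF is_partition_rows[OF mu]])
        (use mu in \<open>simp add: psize_rows partitions_of_def\<close>)
    then show "length \<mu> \<le> m" using rows_nonzero_iff[OF mu, of m] by simp
  qed
qed (simp add: finite_lists_length_le)

lemma ex_rows_eq:
  assumes "is_partition \<rho>"
  shows "\<exists>\<mu>\<in>partitions_of (psize \<rho>). rows \<mu> = \<rho>"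
proof -
  define L where "L = (LEAST i. \<rho> i = 0)"
  have "\<rho> (psize \<rho>) = 0" using is_partition_zero_beyond_psize[OF assms, of "psize \<rho>"] by simp
  then have "\<rho> L = 0" unfolding L_def by (rule LeastI)
  then have zero: "\<rho> i = 0" if "i \<ge> L" for i using is_partitionD[OF assms that] by simp
  have nz: "\<rho> i \<noteq> 0" if "i < L" for i using not_less_Least that unfolding L_def by blast
  define \<mu> where "\<mu> = map \<rho> [0..<L]"
  have r: "rows \<mu> = \<rho>" using zero by (auto simp: fun_eq_iff rows_def \<mu>_def)
  have "sorted_wrt (\<ge>) \<mu>"
    using is_partitionD[OF assms] by (auto simp: \<mu>_def sorted_wrt_iff_nth_less)
  moreover have "0 \<notin> set \<mu>"
  proof
    assume "0 \<in> set \<mu>"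
    then obtain i where "i < L" "\<rho> i = 0" by (auto simp: \<mu>_def)
    then show False using nz by blast
  qed
  moreover have "sum_list \<mu> = psize \<rho>" using psize_rows[of \<mu>] r by simp
  ultimately show ?thesis using r by (auto simp: partitions_of_def)
qed

lemma bead_paths_rows:
  assumes "bead_paths n B \<noteq> {}"
  shows "B \<in> (\<lambda>\<mu>. row_beads (rows \<mu>)) ` domino_partitions n"
proof -
  obtain ps where ps: "length ps = n" "path (row_beads (\<lambda>_. 0)) ps B"
    using assms by (auto simp: bead_paths_def row_beads_0)
  obtain \<rho> where \<rho>: "is_partition \<rho>" "B = row_beads \<rho>" "psize \<rho> = 2 * n"
    using path_row_beads[OF is_partition_0 ps(2)] ps(1) by (auto simp: psize_def)
  obtain \<mu> where \<mu>: "\<mu> \<in> partitions_of (2 * n)" "rows \<mu> = \<rho>"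
    using ex_rows_eq[OF \<rho>(1)] \<rho>(3) by auto
  have "domino_tableaux n \<rho> \<noteq> {}"
    using bij_betw_imp_surj_on[OF bij_betw_domino_code[OF \<rho>(1), of n]] assms \<rho>(2) by auto
  then obtain T where "T \<in> standard_domino_tableaux n \<mu>"
    using \<mu>(2) standard_domino_tableaux_eq by blast
  then have "domino_tiling \<mu> (T ` {1..n})" unfolding standard_domino_tableaux_def by blast
  then have "\<mu> \<in> domino_partitions n" using \<mu>(1) by (auto simp: domino_partitions_def)
  then show ?thesis using \<mu>(2) \<rho>(2) by blast
qed

lemma domino_descent_count_eq:
  assumes "\<mu> \<in> partitions_of m" "n \<ge> 1"
  shows "domino_descent_count n \<mu> I = card {ps \<in> bead_paths n (row_beads (rows \<mu>)). path_descents ps = I}"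
proof -
  note bij = bij_betw_domino_code[OF is_partition_rows[OF assms(1)], of n]
  have "bij_betw (domino_code n) {T \<in> domino_tableaux n (rows \<mu>). tableau_descent_set n T = I}
      {ps \<in> bead_paths n (row_beads (rows \<mu>)). path_descents ps = I}"
    unfolding bij_betw_def
  proof
    show "inj_on (domino_code n) {T \<in> domino_tableaux n (rows \<mu>). tableau_descent_set n T = I}"
      by (rule inj_on_subset[OF bij_betw_imp_inj_on[OF bij]]) blast
    show "domino_code n ` {T \<in> domino_tableaux n (rows \<mu>). tableau_descent_set n T = I} =
        {ps \<in> bead_paths n (row_beads (rows \<mu>)). path_descents ps = I}"
      unfolding bij_betw_imp_surj_on[OF bij, symmetric]
      using tableau_descent_set_eq[OF _ is_partition_rows[OF assms(1)] assms(2)] by blast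
  qed
  then show ?thesis
    unfolding domino_descent_count_def standard_domino_tableaux_eq by (rule bij_betw_same_card)
qed

lemma sum_domino_descent_count:
  assumes "\<mu> \<in> partitions_of m" "n \<ge> 1" "finite A"
  shows "(\<Sum>I\<in>Pow A. domino_descent_count n \<mu> I) = card (descent_paths n A (row_beads (rows \<mu>)))"
proof -
  let ?B = "row_beads (rows \<mu>)"
  have "(\<Sum>I\<in>Pow A. domino_descent_count n \<mu> I) =
      (\<Sum>I\<in>Pow A. \<Sum>ps | ps \<in> descent_paths n A ?B \<and> path_descents ps = I. 1)"
  proof (rule sum.cong[OF refl])
    fix I assume "I \<in> Pow A"
    then have "{ps \<in> bead_paths n ?B. path_descents ps = I} = {ps \<in> descent_paths n A ?B. path_descents ps = I}"
      by (auto simp: descent_paths_def)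
    then show "domino_descent_count n \<mu> I =
      (\<Sum>ps | ps \<in> descent_paths n A ?B \<and> path_descents ps = I. 1)"
      by (simp add: domino_descent_count_eq[OF assms(1,2)])
  qed
  also have "\<dots> = (\<Sum>ps\<in>descent_paths n A ?B. 1)"
    by (rule sum.group) (use assms(3) finite_bead_paths[of n ?B] in \<open>auto simp: descent_paths_def\<close>)
  finally show ?thesis by simp
qed

text \<open>
  Both sides count pairs of move sequences with a common end, whose descents are contained in \<open>A\<close> and
  \<open>A'\<close>.
\<close>

lemma sum_strip_chains_eq_sum_tableaux:
  assumes "n \<ge> 1" "finite A" "finite A'"
  shows "(\<Sum>S\<in>bipartitions_of n. strip_chains (mset (index_word n A)) n S * strip_chains (mset (index_word n A')) n S)
    = (\<Sum>I\<in>Pow A. \<Sum>J\<in>Pow A'. \<Sum>\<mu>\<in>domino_partitions n. domino_descent_count n \<mu> I * domino_descent_count n \<mu> J)"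
proof -
  have dp: "domino_partitions n \<subseteq> partitions_of (2 * n)" by (auto simp: domino_partitions_def)
  have inj1: "inj_on beads (bipartitions_of n)"
    using beads_inject by (auto simp: inj_on_def bipartitions_of_def)
  have inj2: "inj_on (\<lambda>\<mu>. row_beads (rows \<mu>)) (domino_partitions n)"
  proof (rule inj_onI)
    fix \<mu> \<nu> assume m: "\<mu> \<in> domino_partitions n" "\<nu> \<in> domino_partitions n"
      and eq: "row_beads (rows \<mu>) = row_beads (rows \<nu>)"
    then have "rows \<mu> = rows \<nu>"
      using dp by (intro row_beads_inject is_partition_rows[of _ "2 * n"]) auto
    then show "\<mu> = \<nu>" using inj_on_rows[of "2 * n"] m dp unfolding inj_on_def by blast
  qed
  have "(\<Sum>S\<in>bipartitions_of n. strip_chains (mset (index_word n A)) n S * strip_chains (mset (index_word n A')) n S)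
    = (\<Sum>S\<in>bipartitions_of n. card (descent_paths n A (beads S)) * card (descent_paths n A' (beads S)))"
  proof (rule sum.cong[OF refl])
    fix S assume "S \<in> bipartitions_of n"
    then have "bipartition S" by (simp add: bipartitions_of_def)
    then show "strip_chains (mset (index_word n A)) n S * strip_chains (mset (index_word n A')) n S =
        card (descent_paths n A (beads S)) * card (descent_paths n A' (beads S))"
      using strip_chains_eq_card by (simp add: content_paths_index_word)
  qed
  also have "\<dots> = (\<Sum>B | bead_paths n B \<noteq> {}. card (descent_paths n A B) * card (descent_paths n A' B))"
    by (rule sum_over_reachable[OF finite_bipartitions_of inj1 bead_paths_beads])
  also have "\<dots> =
    (\<Sum>\<mu>\<in>domino_partitions n. card (descent_paths n A (row_beads (rows \<mu>))) * card (descent_paths n A' (row_beads (rows \<mu>))))"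
    by (rule sum_over_reachable[symmetric, OF finite_subset[OF dp finite_partitions_of] inj2 bead_paths_rows])
  also have "\<dots> =
    (\<Sum>\<mu>\<in>domino_partitions n. \<Sum>I\<in>Pow A. \<Sum>J\<in>Pow A'. domino_descent_count n \<mu> I * domino_descent_count n \<mu> J)"
  proof (rule sum.cong[OF refl])
    fix \<mu> assume "\<mu> \<in> domino_partitions n"
    then have "\<mu> \<in> partitions_of (2 * n)" using dp by blast
    then show "card (descent_paths n A (row_beads (rows \<mu>))) * card (descent_paths n A' (row_beads (rows \<mu>)))
        = (\<Sum>I\<in>Pow A. \<Sum>J\<in>Pow A'. domino_descent_count n \<mu> I * domino_descent_count n \<mu> J)"
      using sum_domino_descent_count[OF _ assms(1,2)] sum_domino_descent_count[OF _ assms(1,3)]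
      by (simp add: sum_product[symmetric])
  qed
  also have "\<dots> =
    (\<Sum>I\<in>Pow A. \<Sum>J\<in>Pow A'. \<Sum>\<mu>\<in>domino_partitions n. domino_descent_count n \<mu> I * domino_descent_count n \<mu> J)"
    by (subst sum.swap) (simp add: sum.swap[of _ "domino_partitions n"])
  finally show ?thesis .
qed

section \<open>Coefficients of the fundamental quasisymmetric functions\<close>

lemma sum_list_singletons: "(\<Sum>i\<leftarrow>t. {#f i#}) = image_mset f (mset t)"
  by (induction t) auto

lemma index_seqs_Cons:
  "index_seqs n z I = {z # t | t. length t = n \<and> sorted (z # t) \<and> (\<forall>j\<in>I. (z # t) ! j < t ! j)}"
proof -
  have "s \<in> index_seqs n z I \<longleftrightarrow>
      (\<exists>t. s = z # t \<and> length t =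
        n \<and> sorted (z # t) \<and> (\<forall>j\<in>I. (z # t) ! j < t ! j))" for s
    unfolding index_seqs_def by (cases s) auto
  then show ?thesis by blast
qed

text \<open>
  The only candidate for an index sequence with this monomial is the word of \<open>A\<close> itself, and it
  increases strictly exactly at the positions in \<open>A\<close>.
\<close>

lemma fundamental_B_coeff:
  assumes "inj v" "I \<subseteq> {..<n}"
  shows "fundamental_B n (0::int) (\<lambda>i. {#v (nat \<bar>i\<bar>)#}) I (image_mset v (mset (index_word n A)))
    = (if I \<subseteq> A then 1 else 0)"
proof -
  let ?w = "index_word n A"
  have "{s \<in> index_seqs n (0::int) I. (\<Sum>i\<leftarrow>tl s. {#v (nat \<bar>i\<bar>)#}) = image_mset v (mset ?w)}
      = (if I \<subseteq> A then {0 # map int ?w} else {})"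
  proof -
    have "s \<in> index_seqs n (0::int) I \<and> (\<Sum>i\<leftarrow>tl s. {#v (nat \<bar>i\<bar>)#}) =
      image_mset v (mset ?w)
        \<longleftrightarrow> I \<subseteq> A \<and> s = 0 # map int ?w" for s
    proof -
      have key: "sorted (0 # t) \<and> (\<Sum>i\<leftarrow>t. {#v (nat \<bar>i\<bar>)#}) = image_mset v (mset ?w)
          \<longleftrightarrow> t = map int ?w" for t :: "int list"
      proof
        assume t: "sorted (0 # t) \<and> (\<Sum>i\<leftarrow>t. {#v (nat \<bar>i\<bar>)#}) = image_mset v (mset ?w)"
        have "image_mset v (mset (map (\<lambda>i. nat \<bar>i\<bar>) t)) = image_mset v (mset ?w)"
          using t by (simp add: sum_list_singletons multiset.map_comp comp_def)
        then have m: "mset (map (\<lambda>i. nat \<bar>i\<bar>) t) = mset ?w"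
          by (rule injD[OF multiset.inj_map[OF assms(1)]])
        have "sorted (map (\<lambda>i. nat \<bar>i\<bar>) t)"
          unfolding sorted_map by (rule sorted_wrt_mono_rel[of t "(\<le>)"]) (use t in auto)
        moreover have "sorted ?w" using sorted_index_word[of n A] by simp
        ultimately have "map (\<lambda>i. nat \<bar>i\<bar>) t = ?w"
          using properties_for_sort[OF m] by (simp add: sorted_sort_id)
        moreover have "map int (map (\<lambda>i. nat \<bar>i\<bar>) t) = map id t"
          unfolding map_map by (rule map_cong) (use t in auto)
        ultimately show "t = map int ?w" by simp
      next
        assume t: "t = map int ?w"
        have "sorted (map int ?w)"
          using sorted_index_word[of n A] by (simp add: sorted_map)
        then show "sorted (0 # t) \<and> (\<Sum>i\<leftarrow>t. {#v (nat \<bar>i\<bar>)#}) = image_mset v (mset ?w)"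
          by (auto simp: t sum_list_singletons multiset.map_comp comp_def)
      qed
      have strict: "(\<forall>j\<in>I. (0 # map int ?w) ! j < map int ?w ! j) \<longleftrightarrow> I \<subseteq> A"
      proof -
        have "(0 # map int ?w) ! j < map int ?w ! j \<longleftrightarrow> j \<in> A" if "j \<in> I" for j
        proof -
          have j: "j < n" using that assms(2) by auto
          have "(0 # map int ?w) ! j = int ((0 # ?w) ! j)" using j by (cases j) auto
          moreover have "map int ?w ! j = int (?w ! j)" using j by simp
          ultimately show ?thesis using index_word_step[OF j, of A] by simp
        qed
        then show ?thesis by blast
      qed
      show ?thesis
      proof
        assume s: "s \<in> index_seqs n (0::int) I \<and>
          (\<Sum>i\<leftarrow>tl s. {#v (nat \<bar>i\<bar>)#}) = image_mset v (mset ?w)"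
        then obtain t where t: "s = 0 # t" "sorted (0 # t)" "\<forall>j\<in>I. (0 # t) ! j < t ! j"
          unfolding index_seqs_Cons by blast
        have "t = map int ?w" using s t(2) key[of t] unfolding t(1) list.sel by blast
        then show "I \<subseteq> A \<and> s = 0 # map int ?w" using strict t(1,3) by blast
      next
        assume s: "I \<subseteq> A \<and> s = 0 # map int ?w"
        have "sorted (0 # map int ?w)" "(\<Sum>i\<leftarrow>map int ?w. {#v (nat \<bar>i\<bar>)#}) =
          image_mset v (mset ?w)"
          using key[of "map int ?w"] by blast+
        moreover have "length (map int ?w) = n" by simp
        moreover have "\<forall>j\<in>I. (0 # map int ?w) ! j < map int ?w ! j" using s strict by blast
        ultimately have "0 # map int ?w \<in> index_seqs n (0::int) I"
          unfolding index_seqs_Cons by blast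
        then show "s \<in> index_seqs n (0::int) I \<and>
          (\<Sum>i\<leftarrow>tl s. {#v (nat \<bar>i\<bar>)#}) = image_mset v (mset ?w)"
          using s \<open>(\<Sum>i\<leftarrow>map int ?w. {#v (nat \<bar>i\<bar>)#}) = image_mset v (mset ?w)\<close>
          by (simp only: list.sel simp_thms)
      qed
    qed
    then have "s \<in> {s \<in> index_seqs n (0::int) I. (\<Sum>i\<leftarrow>tl s. {#v (nat \<bar>i\<bar>)#}) =
      image_mset v (mset ?w)}
        \<longleftrightarrow> s \<in> (if I \<subseteq> A then {0 # map int ?w} else {})" for s
      by (simp only: mem_Collect_eq) simp
    then show ?thesis by blast
  qed
  then show ?thesis by (simp add: fundamental_B_def)
qed

lemma FX_coeff:
  "I \<subseteq> {..<n} \<Longrightarrow>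
    FX n I (image_mset xvar (mset (index_word n A))) = (if I \<subseteq> A then 1 else 0)"
  using fundamental_B_coeff[of xvar I n A] by (simp add: FX_def monX_def[abs_def] inj_def)

lemma FY_coeff:
  "I \<subseteq> {..<n} \<Longrightarrow>
    FY n I (image_mset yvar (mset (index_word n A))) = (if I \<subseteq> A then 1 else 0)"
  using fundamental_B_coeff[of yvar I n A] by (simp add: FY_def monY_def[abs_def] inj_def)

lemma fundamental_B_nonzeroD:
  assumes "fundamental_B n z (\<lambda>i. {#f i#}) I M \<noteq> 0"
  shows "set_mset M \<subseteq> range f"
proof -
  have "{s \<in> index_seqs n z I. (\<Sum>i\<leftarrow>tl s. {#f i#}) = M} \<noteq> {}"
  proof
    assume e: "{s \<in> index_seqs n z I. (\<Sum>i\<leftarrow>tl s. {#f i#}) = M} = {}"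
    have "fundamental_B n z (\<lambda>i. {#f i#}) I M = 0"
      unfolding fundamental_B_def e by simp
    then show False using assms by simp
  qed
  then obtain s where "(\<Sum>i\<leftarrow>tl s. {#f i#}) = M" by blast
  then have "M = image_mset f (mset (tl s))" by (simp add: sum_list_singletons)
  then show ?thesis by auto
qed

text \<open>
  The alphabets are disjoint, so a monomial has only one factorization that contributes to the product.
\<close>

lemma ps_mult_FX_FY:
  "(FX n I \<otimes> FY n J) (image_mset xvar \<alpha> + image_mset yvar \<beta>) =
    FX n I (image_mset xvar \<alpha>) * FY n J (image_mset yvar \<beta>)"
proof -
  let ?M = "image_mset xvar \<alpha> + image_mset yvar \<beta>"
  let ?S = "{(A, B). A + B = ?M}"
  have fin: "finite ?S"
  proof (rule finite_subset)
    show "?S \<subseteq> (\<lambda>A. (A, ?M - A)) ` {A. set_mset A \<subseteq> set_mset ?M \<and>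
      size A \<le> size ?M}"
    proof
      fix x assume "x \<in> ?S"
      then obtain A B where x: "x = (A, B)" "A + B = ?M" by blast
      then have "A \<subseteq># ?M" by (metis mset_subset_eq_add_left)
      moreover have "B = ?M - A" using x(2) by (metis add_diff_cancel_left')
      ultimately show "x \<in> (\<lambda>A. (A, ?M - A)) ` {A. set_mset A \<subseteq> set_mset ?M \<and>
        size A \<le> size ?M}"
        using set_mset_mono size_mset_mono unfolding x(1) by blast
    qed
    show "finite ((\<lambda>A. (A, ?M - A)) ` {A. set_mset A \<subseteq> set_mset ?M \<and> size A \<le> size ?M})"
      by (intro finite_imageI finite_multisets_bounded_size) simp
  qed
  have zero: "FX n I A * FY n J B = 0"
    if AB: "A + B = ?M" and ne: "(A, B) \<noteq> (image_mset xvar \<alpha>, image_mset yvar \<beta>)" for A B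
  proof (rule ccontr)
    assume "FX n I A * FY n J B \<noteq> 0"
    then have "FX n I A \<noteq> 0" "FY n J B \<noteq> 0" by auto
    then have A: "set_mset A \<subseteq> range xvar" and B: "set_mset B \<subseteq> range yvar"
      using fundamental_B_nonzeroD[of n "0::int" "\<lambda>i. xvar (nat \<bar>i\<bar>)" I A]
        fundamental_B_nonzeroD[of n "0::int" "\<lambda>i. yvar (nat \<bar>i\<bar>)" J B]
      unfolding FX_def FY_def monX_def[abs_def] monY_def[abs_def] by blast+
    have "filter_mset (\<lambda>v. v \<in> range xvar) A = A"
      "filter_mset (\<lambda>v. v \<in> range xvar) (image_mset xvar \<alpha>) = image_mset xvar \<alpha>"
      using A by (auto simp: filter_mset_eq_conv)
    moreover have "filter_mset (\<lambda>v. v \<in> range xvar) B = {#}"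
      "filter_mset (\<lambda>v. v \<in> range xvar) (image_mset yvar \<beta>) = {#}"
      using B by auto
    moreover have "filter_mset (\<lambda>v. v \<in> range xvar) A + filter_mset (\<lambda>v. v \<in> range xvar) B =
        filter_mset (\<lambda>v. v \<in> range xvar) (image_mset xvar \<alpha>) +
        filter_mset (\<lambda>v. v \<in> range xvar) (image_mset yvar \<beta>)"
      unfolding filter_union_mset[symmetric] AB ..
    ultimately have "A = image_mset xvar \<alpha>" by (simp only: add_0_right)
    then show False using AB ne by simp
  qed
  have "(FX n I \<otimes> FY n J) ?M = (\<Sum>(A, B)\<in>?S. FX n I A * FY n J B)"
    by (simp add: ps_mult_def)
  also have "\<dots> = (\<Sum>(A, B)\<in>{(image_mset xvar \<alpha>, image_mset yvar \<beta>)}. FX n I A * FY n J B)"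
  proof (rule sum.mono_neutral_right[OF fin])
    show "\<forall>x\<in>?S - {(image_mset xvar \<alpha>, image_mset yvar \<beta>)}. (case x of (A, B) \<Rightarrow> FX n I A * FY n J B) = 0"
    proof
      fix x assume x: "x \<in> ?S - {(image_mset xvar \<alpha>, image_mset yvar \<beta>)}"
      obtain A B where AB: "x = (A, B)" by (cases x)
      have "A + B = ?M" "(A, B) \<noteq> (image_mset xvar \<alpha>, image_mset yvar \<beta>)"
        using x unfolding AB by blast+
      then show "(case x of (A, B) \<Rightarrow> FX n I A * FY n J B) = 0"
        unfolding AB prod.case by (rule zero)
    qed
  qed simp
  finally show ?thesis by simp
qed

text \<open>
  A weakly increasing sequence is the same as a multiset, and its monomial forgets the signs of both
  indices; the first indices are nonnegative by the lexicographic order.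
\<close>

lemma FXY_coeff:
  assumes "\<And>i. i \<in># \<alpha> \<Longrightarrow> i \<le> m" "size \<beta> = n"
  shows "FXY n {} (image_mset xvar \<alpha> + image_mset yvar \<beta>) =
    of_nat (card (pair_multisets \<alpha> m \<beta>))"
proof -
  let ?M = "image_mset xvar \<alpha> + image_mset yvar \<beta>"
  let ?S = "{s \<in> index_seqs n (0::int, 0::int) {}. (\<Sum>i\<leftarrow>tl s. (\<lambda>(i, j). monX i + monY j) i) = ?M}"
  have mon: "(\<Sum>i\<leftarrow>t. (\<lambda>(i, j). monX i + monY j) i)
      = image_mset xvar (abs_mset (image_mset fst (mset t))) + image_mset yvar (abs_mset (image_mset snd (mset t)))"
    for t
    by (induction t) (auto simp: monX_def monY_def abs_mset_def)
  have split: "image_mset xvar \<gamma> + image_mset yvar \<delta> = ?M \<longleftrightarrow>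
    \<gamma> = \<alpha> \<and> \<delta> = \<beta>" for \<gamma> \<delta>
  proof
    assume eq: "image_mset xvar \<gamma> + image_mset yvar \<delta> = ?M"
    have cx: "count (image_mset xvar \<mu> + image_mset yvar \<nu>) (xvar i) = count \<mu> i"
      and cy: "count (image_mset xvar \<mu> + image_mset yvar \<nu>) (yvar i) =
        count \<nu> i" for \<mu> \<nu> :: "nat multiset" and i
      by (simp_all add: count_size_filter_image) (simp_all add: count_conv_size_mset eq_commute)
    show "\<gamma> = \<alpha> \<and> \<delta> = \<beta>"
      using cx[of \<gamma> \<delta>] cx[of \<alpha> \<beta>] cy[of \<gamma> \<delta>] cy[of \<alpha> \<beta>] unfolding eq by (auto intro: multiset_eqI)
  qed auto
  have member: "X \<in> pair_multisets \<alpha> m \<beta> \<longleftrightarrow>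
    (\<forall>z\<in>#X. (0, 0) \<le> z) \<and>
      abs_mset (image_mset fst X) = \<alpha> \<and> abs_mset (image_mset snd X) = \<beta>" for X
  proof (cases "\<forall>z\<in>#X. (0, 0) \<le> z")
    case True
    then have nonneg: "i \<ge> 0" if "i \<in># image_mset fst X" for i
      using that by (auto simp: less_eq_prod_def)
    have count: "count (abs_mset (image_mset fst X)) i = count (image_mset fst X) (int i)" for i
    proof -
      have "count (image_mset fst X) (- int i) = 0" if "i \<noteq> 0"
        using nonneg[of "- int i"] that by (auto simp: count_eq_zero_iff)
      then show ?thesis by (auto simp: count_abs_mset)
    qed
    have "abs_mset (image_mset fst X) = \<alpha> \<longleftrightarrow> (\<forall>z\<in>#X. fst z \<le> int m) \<and>
        (\<forall>i\<le>m. count (image_mset fst X) (int i) = count \<alpha> i)" (is "?l \<longleftrightarrow> ?r")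
    proof
      assume l: ?l
      have "fst z \<le> int m" if "z \<in># X" for z
      proof -
        have "fst z \<ge> 0" using nonneg[of "fst z"] that by simp
        moreover have "nat \<bar>fst z\<bar> \<in># \<alpha>" using that unfolding l[symmetric] abs_mset_def by simp
        ultimately show ?thesis using assms(1)[of "nat \<bar>fst z\<bar>"] by simp
      qed
      then show ?r using count l by simp
    next
      assume r: ?r
      show ?l
      proof (rule multiset_eqI)
        fix i
        show "count (abs_mset (image_mset fst X)) i = count \<alpha> i"
        proof (cases "i \<le> m")
          case False
          then have "int i \<notin># image_mset fst X" "i \<notin># \<alpha>" using r assms(1)[of i] by force+
          then show ?thesis unfolding count by (simp only: not_in_iff)
        qed (use r count in simp)
      qed
    qed
    then show ?thesis using True by (auto simp: pair_multisets_def)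
  qed (auto simp: pair_multisets_def)
  have S: "?S = {(0, 0) # t | t. length t = n \<and> sorted t \<and> mset t \<in> pair_multisets \<alpha> m \<beta>}"
  proof -
    have "s \<in> ?S \<longleftrightarrow>
      (\<exists>t. s = (0, 0) # t \<and> length t =
        n \<and> sorted t \<and> mset t \<in> pair_multisets \<alpha> m \<beta>)" for s
      unfolding index_seqs_Cons member by (auto simp: mon split simp del: less_eq_prod_simp)
    then show ?thesis by blast
  qed
  have "bij_betw (\<lambda>s. mset (tl s)) ?S (pair_multisets \<alpha> m \<beta>)"
  proof (rule bij_betw_byWitness[where f' = "\<lambda>X. (0, 0) # sorted_list_of_multiset X"])
    show "\<forall>s\<in>?S. (0, 0) # sorted_list_of_multiset (mset (tl s)) = s"
    proof
      fix s assume "s \<in> ?S"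
      then obtain t where "s = (0, 0) # t" "sorted t" unfolding S by blast
      then show "(0, 0) # sorted_list_of_multiset (mset (tl s)) = s"
        by (simp add: sorted_sort_id)
    qed
    show "\<forall>X\<in>pair_multisets \<alpha> m \<beta>. mset (tl ((0, 0) # sorted_list_of_multiset X)) = X"
      by simp
    show "(\<lambda>s. mset (tl s)) ` ?S \<subseteq> pair_multisets \<alpha> m \<beta>"
    proof (rule image_subsetI)
      fix s assume "s \<in> ?S"
      then obtain t where "s = (0, 0) # t" "mset t \<in> pair_multisets \<alpha> m \<beta>" unfolding S by blast
      then show "mset (tl s) \<in> pair_multisets \<alpha> m \<beta>" by simp
    qed
    show "(\<lambda>X. (0, 0) # sorted_list_of_multiset X) ` pair_multisets \<alpha> m \<beta> \<subseteq> ?S"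
    proof (intro image_subsetI)
      fix X assume X: "X \<in> pair_multisets \<alpha> m \<beta>"
      then have "abs_mset (image_mset snd X) = \<beta>" by (simp add: pair_multisets_def)
      then have "size X = n" using assms(2) size_abs_mset[of "image_mset snd X"] by simp
      moreover have "length (sorted_list_of_multiset X) = size X"
        by (metis mset_sorted_list_of_multiset size_mset)
      moreover have "sorted (sorted_list_of_multiset X)" "mset (sorted_list_of_multiset X) \<in> pair_multisets \<alpha> m \<beta>"
        using X by simp_all
      ultimately show "(0, 0) # sorted_list_of_multiset X \<in> ?S"
        unfolding S by blast
    qed
  qed
  then show ?thesis
    unfolding FXY_def fundamental_B_def by (simp only: bij_betw_same_card)
qed

text \<open>
  Moebius inversion on the Boolean lattice, in the form of uniqueness.
\<close>

lemma sum_Pow_inject: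
  fixes f g :: "'a set \<Rightarrow> 'b :: ab_group_add"
  assumes "finite U" "\<And>A. A \<subseteq> U \<Longrightarrow>
    (\<Sum>I\<in>Pow A. f I) = (\<Sum>I\<in>Pow A. g I)" "A \<subseteq> U"
  shows "f A = g A"
proof -
  have "finite A" using assms(1,3) finite_subset by blast
  then show ?thesis using assms(3)
  proof (induction rule: finite_psubset_induct)
    case (psubset A)
    have "Pow A = insert A (Pow A - {A})" by blast
    then have s: "(\<Sum>I\<in>Pow A. h I) = h A + (\<Sum>I\<in>Pow A - {A}. h I)" for h :: "'a set \<Rightarrow> 'b"
      using psubset.hyps by (metis Diff_iff finite_Diff finite_Pow_iff insertI1 sum.insert)
    have "(\<Sum>I\<in>Pow A - {A}. f I) = (\<Sum>I\<in>Pow A - {A}. g I)"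
      by (rule sum.cong) (use psubset in auto)
    then show ?case using assms(2)[OF psubset.prems] by (simp add: s)
  qed
qed

lemma sum_fun_apply: "(\<Sum>i\<in>A. f i) x = (\<Sum>i\<in>A. f i x)"
  by (induction A rule: infinite_finite_induct) auto

theorem theorem3:
  fixes n :: nat
  assumes "n \<ge> 1"
    and "\<And>K. K \<subseteq> {..<n} \<Longrightarrow>
      FXY n K = (\<Sum>I\<in>Pow {..<n}. \<Sum>J\<in>Pow {..<n}.
        descent_structure_const n K I J \<odot> (FX n I \<otimes> FY n J))"
  shows "\<And>I J. I \<subseteq> {..<n} \<Longrightarrow> J \<subseteq> {..<n} \<Longrightarrow>
    descent_structure_const n {} I J =
      of_nat (\<Sum>\<mu>\<in>domino_partitions n. domino_descent_count n \<mu> I * domino_descent_count n \<mu> J)"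
proof -
  let ?c = "descent_structure_const n {}"
  let ?d = "\<lambda>I J. \<Sum>\<mu>\<in>domino_partitions n. domino_descent_count n \<mu> I * domino_descent_count n \<mu> J"
  \<comment> \<open>Compare the coefficients of the monomial that detects \<open>A\<close> and \<open>B\<close>.\<close>
  have sums: "(\<Sum>I\<in>Pow A. \<Sum>J\<in>Pow B. ?c I J) = (\<Sum>I\<in>Pow A. \<Sum>J\<in>Pow B. of_nat (?d I J))"
    if A: "A \<subseteq> {..<n}" and B: "B \<subseteq> {..<n}" for A B
  proof -
    define \<alpha> \<beta> where "\<alpha> = mset (index_word n A)" and "\<beta> = mset (index_word n B)"
    let ?M = "image_mset xvar \<alpha> + image_mset yvar \<beta>"
    have le: "i \<le> n" if "i \<in># \<alpha> \<or> i \<in># \<beta>" for i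
      using that index_word_le by (auto simp: \<alpha>_def \<beta>_def)
    have "FXY n {} ?M = (\<Sum>I\<in>Pow {..<n}. \<Sum>J\<in>Pow {..<n}. ?c I J * (FX n I \<otimes> FY n J) ?M)"
      by (simp add: assms(2) sum_fun_apply fscale_def)
    also have "\<dots> =
      (\<Sum>I\<in>Pow {..<n}. \<Sum>J\<in>Pow {..<n}. if I \<subseteq> A then if J \<subseteq> B then ?c I J else 0 else 0)"
      by (intro sum.cong refl)
        (simp add: ps_mult_FX_FY \<alpha>_def \<beta>_def FX_coeff FY_coeff)
    also have "\<dots> = (\<Sum>I\<in>Pow A. \<Sum>J\<in>Pow {..<n}. if J \<subseteq> B then ?c I J else 0)"
      by (rule sum.mono_neutral_cong_right) (use A in auto)
    also have "\<dots> = (\<Sum>I\<in>Pow A. \<Sum>J\<in>Pow B. ?c I J)"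
      by (intro sum.cong refl sum.mono_neutral_cong_right) (use B in auto)
    finally have 1: "FXY n {} ?M = (\<Sum>I\<in>Pow A. \<Sum>J\<in>Pow B. ?c I J)" .
    have fin: "finite A" "finite B" using A B finite_subset by blast+
    have "(\<Sum>i\<le>n. count \<alpha> i) = size \<alpha>"
      unfolding size_multiset_overloaded_eq
      by (rule sum.mono_neutral_right) (use le in \<open>auto simp: not_in_iff\<close>)
    then have n: "(\<Sum>i\<le>n. count \<alpha> i) = n" by (simp add: \<alpha>_def)
    have "FXY n {} ?M = of_nat (card (pair_multisets \<alpha> n \<beta>))"
      by (rule FXY_coeff) (use le in \<open>auto simp: \<beta>_def\<close>)
    also have "card (pair_multisets \<alpha> n \<beta>) =
      (\<Sum>S\<in>bipartitions_of n. strip_chains \<alpha> n S * strip_chains \<beta> n S)"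
      using sum_strip_chains_product[of \<beta> n \<alpha> n] le by (simp add: n)
    also have "\<dots> = (\<Sum>I\<in>Pow A. \<Sum>J\<in>Pow B. ?d I J)"
      unfolding \<alpha>_def \<beta>_def by (rule sum_strip_chains_eq_sum_tableaux[OF assms(1) fin])
    finally show ?thesis using 1 by simp
  qed
  fix I J assume I: "I \<subseteq> {..<n}" and J: "J \<subseteq> {..<n}"
  have "(\<Sum>J\<in>Pow B. ?c I J) = (\<Sum>J\<in>Pow B. of_nat (?d I J))" if "B \<subseteq> {..<n}" for B
    by (rule sum_Pow_inject[where f =
      "\<lambda>I. \<Sum>J\<in>Pow B. ?c I J", OF finite_lessThan sums I]) (use that in auto)
  then show "?c I J = of_nat (?d I J)"
    by (rule sum_Pow_inject[OF finite_lessThan _ J])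
qed

end
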